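(* Let $m>1$, $D>0$ and $r\ge 0$, and let $b,d$ satisfy the standing assumptions below. Then there exists a constant $c_0=c_0(m,r,b,d)>0$, depending on $m$, $r$ and the structure of $b(\cdot),d(\cdot)$, such that for $c=c_0$ the wave profile equation $$c\phi'(t)=D(\phi^m)''(t)-d(\phi(t))+b(\phi(t-cr)),\qquad t\in\mathbb R,$$ admits a sharp wave solution $\phi$ (a semi-wavefront or wavefront, of non-$C^1$ type or $C^1$ type) with $\phi(t)\equiv0$ for $t\le0$, $\phi(t)>0$ for $t>0$, $$0<\zeta_1\le\liminf_{t\to+\infty}\phi(t)\le\limsup_{t\to+\infty}\phi(t)\le\zeta_2,$$ and $$|\phi(t)-C_1t_+^{\lambda}|\le C_2t_+^{\Lambda}\quad\text{for all } t\in(0,1),$$ where $t_+=\max\{t,0\}$, $\lambda=1/(m-1)$, and $\Lambda>\lambda$, $C_1,C_2>0$ are constants.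
   Context: Standing assumptions: the death rate $d\in C^2([0,+\infty))$ satisfies $d(0)=0$, $d'(s)>0$ and $d''(s)\ge0$ for $s>0$. The birth rate $b\in C^1([0,+\infty);[0,+\infty))$ has exactly one positive local extremum point $s_M$, which is its global maximum point; $b(0)=0$; there is $\kappa>0$ with $b(\kappa)=d(\kappa)$; $b'(0)>d'(0)$; $b'(\kappa)<d'(\kappa)$; and $d(s)<b(s)\le b'(0)s$ for $s\in(0,\kappa)$. Moreover $s_M<\kappa$. Set $M:=b(s_M)=\max b$, $\zeta_2:=d^{-1}(M)$, $\theta:=b(\zeta_2)$, and let $\zeta_1\in(0,s_M)$ be the unique point with $b(\zeta_1)=\theta$. Definitions: a function $0\le\phi\in W^{1,1}_{\rm loc}(\mathbb R)\cap L^\infty(\mathbb R)$ with $\phi^m\in W^{1,1}_{\rm loc}(\mathbb R)$ is a semi-wavefront (of speed $c>0$) if (i) it satisfies the wave profile equation in the sense of distributions; (ii) $\phi(-\infty)=0$ and $0<\liminf_{t\to+\infty}\phi(t)\le\limsup_{t\to+\infty}\phi(t)<+\infty$; (iii) there is a maximal interval $(-\infty,t_0)$, $t_0\in(-\infty,+\infty]$, on which $\phi$ is monotonically increasing, and if $t_0<+\infty$ then $\phi(t_0)>\kappa$. A wavefront is a semi-wavefront with $\phi(+\infty)=\kappa$. A wave solution means a semi-wavefront or wavefront. It is sharp if there is $t_*\in\mathbb R$ with $\phi(t)=0$ for $t\le t_*$ and $\phi(t)>0$ for $t>t_*$. A sharp wave is of non-$C^1$ type if $\phi''\notin L^1_{\rm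 loc}(\mathbb R)$ and of $C^1$ type if $\phi''\in L^1_{\rm loc}(\mathbb R)$.
   Formalization: The constant c_0 is allowed to depend on D as well as on m, r, b, d; independence of D is impossible, since rescaling t by √D multiplies the sharp speed by √D (for r=0, m=2, b−d=s(1−s) on [0,1], the sharp speed is √D). *)

theory Defs
  imports "HOL-Analysis.Analysis"
begin

definition test_fun :: "(real \<Rightarrow> real) \<Rightarrow> bool" where
  "test_fun \<psi> \<longleftrightarrow> (\<forall>k x. ((deriv ^^ k) \<psi>) differentiable (at x))
                  \<and> (\<exists>R. \<forall>x. \<bar>x\<bar> > R \<longrightarrow> \<psi> x = 0)"

definition loc_integrable :: "(real \<Rightarrow> real) \<Rightarrow> bool" where
  "loc_integrable f \<longleftrightarrow> (\<forall>a b. set_integrable lborel {a..b} f)"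

definition W11_loc :: "(real \<Rightarrow> real) \<Rightarrow> bool" where
  "W11_loc f \<longleftrightarrow> loc_integrable f \<and>
     (\<exists>g. loc_integrable g \<and>
        (\<forall>\<psi>. test_fun \<psi> \<longrightarrow>
           integral\<^sup>L lborel (\<lambda>t. f t * deriv \<psi> t) = - integral\<^sup>L lborel (\<lambda>t. g t * \<psi> t)))"

text \<open>The wave profile equation
  c phi' = D (phi^m)'' - d(phi(t)) + b(phi(t - c r)) in the sense of distributions.\<close>
definition wave_profile_eq ::
  "real \<Rightarrow> real \<Rightarrow> real \<Rightarrow> real \<Rightarrow> (real \<Rightarrow> real) \<Rightarrow> (real \<Rightarrow> real) \<Rightarrow> (real \<Rightarrow> real) \<Rightarrow> bool" where
  "wave_profile_eq D m c r b d \<phi> \<longleftrightarrow>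
     (\<forall>\<psi>. test_fun \<psi> \<longrightarrow>
        (let F = (\<lambda>t. D * (\<phi> t powr m) * deriv (deriv \<psi>) t + c * \<phi> t * deriv \<psi> t
                     - d (\<phi> t) * \<psi> t + b (\<phi> (t - c * r)) * \<psi> t)
         in integrable lborel F \<and> integral\<^sup>L lborel F = 0))"

definition semi_wavefront ::
  "real \<Rightarrow> real \<Rightarrow> real \<Rightarrow> real \<Rightarrow> (real \<Rightarrow> real) \<Rightarrow> (real \<Rightarrow> real) \<Rightarrow> real \<Rightarrow> (real \<Rightarrow> real) \<Rightarrow> bool" where
  "semi_wavefront D m c r b d \<kappa> \<phi> \<longleftrightarrow>
     c > 0 \<and>
     (\<forall>t. 0 \<le> \<phi> t) \<and> W11_loc \<phi> \<and> (\<exists>B. \<forall>t. \<bar>\<phi> t\<bar> \<le> B) \<and> W11_loc (\<lambda>t. \<phi> t powr m) \<and>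
     wave_profile_eq D m c r b d \<phi> \<and>
     (\<phi> \<longlongrightarrow> 0) at_bot \<and>
     0 < Liminf at_top (\<lambda>t. ereal (\<phi> t)) \<and>
     Limsup at_top (\<lambda>t. ereal (\<phi> t)) < \<infinity> \<and>
     (\<exists>t0::ereal. mono_on {t. ereal t < t0} \<phi>
        \<and> (\<forall>t1::ereal. t0 < t1 \<longrightarrow> \<not> mono_on {t. ereal t < t1} \<phi>)
        \<and> (\<forall>s. t0 = ereal s \<longrightarrow> \<phi> s > \<kappa>))"

definition wavefront ::
  "real \<Rightarrow> real \<Rightarrow> real \<Rightarrow> real \<Rightarrow> (real \<Rightarrow> real) \<Rightarrow> (real \<Rightarrow> real) \<Rightarrow> real \<Rightarrow> (real \<Rightarrow> real) \<Rightarrow> bool" where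
  "wavefront D m c r b d \<kappa> \<phi> \<longleftrightarrow> semi_wavefront D m c r b d \<kappa> \<phi> \<and> (\<phi> \<longlongrightarrow> \<kappa>) at_top"

definition sharp :: "(real \<Rightarrow> real) \<Rightarrow> bool" where
  "sharp \<phi> \<longleftrightarrow> (\<exists>ts. (\<forall>t\<le>ts. \<phi> t = 0) \<and> (\<forall>t>ts. \<phi> t > 0))"

definition pos_local_extremum :: "(real \<Rightarrow> real) \<Rightarrow> real \<Rightarrow> bool" where
  "pos_local_extremum b s \<longleftrightarrow> s > 0 \<and>
     (\<exists>e>0. (\<forall>y. y > 0 \<and> \<bar>y - s\<bar> < e \<longrightarrow> b y \<le> b s) \<or>
            (\<forall>y. y > 0 \<and> \<bar>y - s\<bar> < e \<longrightarrow> b s \<le> b y))"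

definition zeta2 :: "(real \<Rightarrow> real) \<Rightarrow> (real \<Rightarrow> real) \<Rightarrow> real \<Rightarrow> real" where
  "zeta2 b d sM = (THE s. 0 \<le> s \<and> d s = b sM)"

definition zeta1 :: "(real \<Rightarrow> real) \<Rightarrow> (real \<Rightarrow> real) \<Rightarrow> real \<Rightarrow> real" where
  "zeta1 b d sM = (THE s. 0 < s \<and> s < sM \<and> b s = b (zeta2 b d sM))"

end

theory Submission
  imports Defs "HOL-Real_Asymp.Real_Asymp"
begin

text \<open>
  In the time variable \<open>t / c\<close> the delay does not depend on the speed, and \<open>v = f powr (m - 1)\<close> turns the
  equation into \<open>v' = q (1 + G / f)\<close> with \<open>G t = \<integral>\<^sub>0\<^sup>t d (f s) - b (f (s - r)) ds\<close>, where the parameter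
  \<open>q\<close> is proportional to \<open>c\<^sup>2\<close>. For sharp initial data \<open>v\<close> is asymptotically linear at \<open>0\<close>, so after
  clipping \<open>v\<close> between suitable bounds the equation for \<open>v / t\<close> is a contractive Volterra equation whose
  solution depends continuously on \<open>q\<close>. For large \<open>q\<close> the solution exceeds \<open>\<zeta>2\<close>. For small
  \<open>q\<close> it does not: a monotone solution would satisfy a linear delay inequality forcing geometric growth
  of \<open>\<integral> f\<close>, which is incompatible with its polynomial bound, so it turns below \<open>\<kappa>\<close>; and a
  solution turning below \<open>\<kappa>\<close> decreases to extinction, since \<open>b\<close> is unimodal. Both exits from the strip
  are transversal, hence open in \<open>q\<close>, and some \<open>q\<close> produces a solution that never leaves the strip. The
  same flux arguments show that this solution turns only above \<open>\<kappa>\<close>, if at all, and finally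
  stays between \<open>\<zeta>1\<close> and \<open>\<zeta>2\<close>.
\<close>

section \<open>Fixed points of Volterra operators\<close>

text \<open>For large \<open>k\<close> this makes \<open>\<Psi>\<close> a contraction in the norm with weight \<open>exp (- k * t)\<close>.\<close>

definition volterra_bound :: "((real \<Rightarrow> real) \<Rightarrow> real \<Rightarrow> real) \<Rightarrow> real \<Rightarrow> real \<Rightarrow> bool" where
  "volterra_bound \<Psi> T C \<longleftrightarrow>
     (\<forall>z1 z2 N k. continuous_on {0..T} z1 \<longrightarrow> continuous_on {0..T} z2 \<longrightarrow> N \<ge> 0 \<longrightarrow> k \<ge> 1 \<longrightarrow>
        (\<forall>t\<in>{0..T}. \<bar>z1 t - z2 t\<bar> \<le> N * exp (k * t)) \<longrightarrow>
        (\<forall>t\<in>{0..T}. \<bar>\<Psi> z1 t - \<Psi> z2 t\<bar> \<le> C / k * N * exp (k * t)))"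

lemma volterra_boundD:
  assumes "volterra_bound \<Psi> T C" "continuous_on {0..T} z1" "continuous_on {0..T} z2" "N \<ge> 0" "k \<ge> 1"
    "\<And>t. t \<in> {0..T} \<Longrightarrow> \<bar>z1 t - z2 t\<bar> \<le> N * exp (k * t)" "t \<in> {0..T}"
  shows "\<bar>\<Psi> z1 t - \<Psi> z2 t\<bar> \<le> C / k * N * exp (k * t)"
  using assms unfolding volterra_bound_def by blast

lemma volterra_fixpoint_dependence:
  fixes \<Psi> :: "(real \<Rightarrow> real) \<Rightarrow> real \<Rightarrow> real"
  assumes vb: "volterra_bound \<Psi> T C" and C: "C \<ge> 0" and T: "T > 0"
    and q: "q1 \<in> {0..Q}" "q2 \<in> {0..Q}"
    and z1: "continuous_on {0..T} z1" "\<And>t. t \<in> {0..T} \<Longrightarrow> z1 t = q1 * \<Psi> z1 t"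
    and z2: "continuous_on {0..T} z2" "\<And>t. t \<in> {0..T} \<Longrightarrow> z2 t = q2 * \<Psi> z2 t"
    and B: "\<And>t. t \<in> {0..T} \<Longrightarrow> \<bar>\<Psi> z2 t\<bar> \<le> B"
    and t: "t \<in> {0..T}"
  shows "\<bar>z1 t - z2 t\<bar> \<le> 2 * B * exp ((1 + 2 * Q * C) * T) * \<bar>q1 - q2\<bar>"
proof -
  define k where "k = 1 + 2 * Q * C"
  have Q: "Q \<ge> 0" using q by auto
  have k: "k \<ge> 1" "2 * (Q * C) \<le> k" using Q C by (auto simp: k_def)
  have B0: "B \<ge> 0" using B[of 0] T by auto
  define h where "h t = \<bar>z1 t - z2 t\<bar> * exp (- k * t)" for t
  have "continuous_on {0..T} h" unfolding h_def by (intro continuous_intros z1 z2)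
  from continuous_attains_sup[OF compact_Icc _ this] T
  obtain s where s: "s \<in> {0..T}" "\<And>t. t \<in> {0..T} \<Longrightarrow> h t \<le> h s" by auto
  define N where "N = h s"
  have N0: "N \<ge> 0" by (simp add: N_def h_def)
  have bound: "\<bar>z1 t - z2 t\<bar> \<le> N * exp (k * t)" if "t \<in> {0..T}" for t
  proof -
    have "\<bar>z1 t - z2 t\<bar> = h t * exp (k * t)" by (simp add: h_def mult.assoc flip: exp_add)
    also have "\<dots> \<le> N * exp (k * t)" using s(2)[OF that] by (simp add: N_def)
    finally show ?thesis .
  qed
  define E where "E = N * exp (k * s)"
  have E: "\<bar>z1 s - z2 s\<bar> = E" by (simp add: E_def N_def h_def mult.assoc flip: exp_add)
  have "\<bar>\<Psi> z1 s - \<Psi> z2 s\<bar> \<le> C / k * N * exp (k * s)"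
    using volterra_boundD[OF vb z1(1) z2(1) N0 k(1) bound s(1)] by auto
  hence PE: "\<bar>\<Psi> z1 s - \<Psi> z2 s\<bar> \<le> C / k * E" by (simp add: E_def mult.assoc)
  have E0: "E \<ge> 0" using N0 by (simp add: E_def)
  have "z1 s - z2 s = q1 * (\<Psi> z1 s - \<Psi> z2 s) + (q1 - q2) * \<Psi> z2 s"
    using z1(2)[OF s(1)] z2(2)[OF s(1)] by (simp add: algebra_simps)
  hence "E \<le> \<bar>q1 * (\<Psi> z1 s - \<Psi> z2 s)\<bar> + \<bar>(q1 - q2) * \<Psi> z2 s\<bar>"
    unfolding E[symmetric] by (simp add: abs_triangle_ineq)
  also have "\<dots> \<le> Q * (C / k * E) + \<bar>q1 - q2\<bar> * B"
    unfolding abs_mult using q PE B[OF s(1)] by (intro add_mono mult_mono) auto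
  also have "Q * (C / k * E) \<le> E / 2"
  proof -
    have "Q * (C / k * E) = (2 * (Q * C)) / k * (E / 2)" by simp
    also have "\<dots> \<le> 1 * (E / 2)" using k E0 by (intro mult_right_mono) auto
    finally show ?thesis by simp
  qed
  finally have "E \<le> 2 * (\<bar>q1 - q2\<bar> * B)" by linarith
  hence "E \<le> 2 * B * \<bar>q1 - q2\<bar>" by (simp add: mult_ac)
  moreover have "N \<le> E" using N0 s(1) k unfolding E_def by (simp add: mult_le_cancel_left1)
  ultimately have N: "N \<le> 2 * B * \<bar>q1 - q2\<bar>" by simp
  have "\<bar>z1 t - z2 t\<bar> \<le> N * exp (k * t)" by (rule bound[OF t])
  also have "\<dots> \<le> (2 * B * \<bar>q1 - q2\<bar>) * exp (k * T)"
    using N N0 t k B0 by (intro mult_mono) auto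
  finally show ?thesis by (simp add: k_def mult_ac)
qed

lemma volterra_fixpoint_compact:
  fixes \<Psi> :: "(real \<Rightarrow> real) \<Rightarrow> real \<Rightarrow> real"
  assumes cont: "\<And>z. continuous_on {0..T} z \<Longrightarrow> continuous_on {0..T} (\<Psi> z)"
    and vb: "volterra_bound \<Psi> T C" and C: "C \<ge> 0" and T: "T > 0" and q: "q \<ge> 0"
  shows "\<exists>z. continuous_on {0..T} z \<and> (\<forall>t\<in>{0..T}. z t = q * \<Psi> z t)"
proof -
  define k where "k = 1 + 2 * q * C"
  have k: "k \<ge> 1" "2 * (q * C) \<le> k" using q C by (auto simp: k_def)
  define W where "W x s = exp (k * s) * apply_bcontfun x s" for x :: "real \<Rightarrow>\<^sub>C real" and s
  define h where "h x t = exp (- k * t) * (q * \<Psi> (W x) t)" for x :: "real \<Rightarrow>\<^sub>C real" and t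
  have Wc: "continuous_on A (W x)" for x A
    unfolding W_def by (intro continuous_intros continuous_on_apply_bcontfun)
  have hc: "continuous_on (cbox 0 T) (h x)" for x
  proof -
    have "continuous_on {0..T} (\<Psi> (W x))" by (rule cont[OF Wc])
    thus ?thesis unfolding h_def cbox_interval by (intro continuous_intros)
  qed
  have "\<exists>g :: real \<Rightarrow>\<^sub>C real. \<forall>t. g t = h x (clamp 0 T t)" for x
  proof -
    obtain g :: "real \<Rightarrow>\<^sub>C real" where "\<And>t. g t = h x (clamp 0 T t)"
      using continuous_on_cbox_bcontfunE[OF hc] by metis
    thus ?thesis by blast
  qed
  hence "\<forall>x. \<exists>g :: real \<Rightarrow>\<^sub>C real. \<forall>t. g t = h x (clamp 0 T t)" by simp
  from choice[OF this] obtain F :: "(real \<Rightarrow>\<^sub>C real) \<Rightarrow> real \<Rightarrow>\<^sub>C real"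
    where F: "\<And>x t. F x t = h x (clamp 0 T t)" by blast
  have lip: "dist (F x) (F y) \<le> 1/2 * dist x y" for x y
  proof (rule dist_bound)
    fix t
    define u where "u = clamp 0 T t"
    have u: "u \<in> {0..T}" using clamp_in_interval[of 0 T t] T by (auto simp: u_def)
    have "\<bar>\<Psi> (W x) u - \<Psi> (W y) u\<bar> \<le> C / k * dist x y * exp (k * u)"
    proof (rule volterra_boundD[OF vb Wc Wc zero_le_dist k(1) _ u])
      fix s
      have "W x s - W y s = exp (k * s) * (x s - y s)" by (simp add: W_def algebra_simps)
      thus "\<bar>W x s - W y s\<bar> \<le> dist x y * exp (k * s)"
        using dist_bounded[of x s y] by (simp add: abs_mult dist_real_def)
    qed
    hence "exp (- k * u) * (q * \<bar>\<Psi> (W x) u - \<Psi> (W y) u\<bar>)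
        \<le> exp (- k * u) * (q * (C / k * dist x y * exp (k * u)))"
      using q by (intro mult_left_mono) auto
    also have "\<dots> = (2 * (q * C)) / k * (dist x y / 2)" by (simp add: exp_minus field_simps)
    also have "\<dots> \<le> 1 * (dist x y / 2)" using k by (intro mult_right_mono) auto
    finally have "exp (- k * u) * (q * \<bar>\<Psi> (W x) u - \<Psi> (W y) u\<bar>) \<le> dist x y / 2" by simp
    moreover have "F x t - F y t = exp (- k * u) * (q * (\<Psi> (W x) u - \<Psi> (W y) u))"
      unfolding F h_def u_def by (simp add: algebra_simps)
    ultimately show "dist (F x t) (F y t) \<le> 1/2 * dist x y"
      using q by (simp add: dist_real_def abs_mult)
  qed
  have "\<exists>!x. F x = x" by (rule banach_fix_type[of "1/2"]) (use lip in auto)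
  then obtain x where x: "F x = x" by auto
  have "W x t = q * \<Psi> (W x) t" if "t \<in> {0..T}" for t
  proof -
    have "x t = h x t" using F[of x t] x that by simp
    thus ?thesis by (simp add: W_def h_def exp_minus field_simps)
  qed
  with Wc show ?thesis by blast
qed

lemma volterra_fixpoint:
  fixes \<Psi> :: "(real \<Rightarrow> real) \<Rightarrow> real \<Rightarrow> real"
  assumes cont: "\<And>T z. T > 0 \<Longrightarrow> continuous_on {0..T} z \<Longrightarrow> continuous_on {0..T} (\<Psi> z)"
    and vb: "\<And>T. T > 0 \<Longrightarrow> \<exists>C\<ge>0. volterra_bound \<Psi> T C" and q: "q \<ge> 0"
  shows "\<exists>z. continuous_on {0..} z \<and> (\<forall>t\<ge>0. z t = q * \<Psi> z t)"
proof -
  have "\<exists>z. continuous_on {0..T} z \<and> (\<forall>t\<in>{0..T}. z t = q * \<Psi> z t)" if T: "T > 0" for T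
  proof -
    obtain C where "C \<ge> 0" "volterra_bound \<Psi> T C" using vb[OF T] by auto
    from volterra_fixpoint_compact[OF cont[OF T] this(2,1) T q] show ?thesis by blast
  qed
  then obtain Z where Z: "\<And>T. T > 0 \<Longrightarrow> continuous_on {0..T} (Z T)"
      "\<And>T t. T > 0 \<Longrightarrow> t \<in> {0..T} \<Longrightarrow> Z T t = q * \<Psi> (Z T) t" by metis
  have Zeq: "Z T t = Z T' t" if T: "0 < T" "T \<le> T'" and t: "t \<in> {0..T}" for T T' t
  proof -
    obtain C where C: "C \<ge> 0" "volterra_bound \<Psi> T C" using vb[OF T(1)] by auto
    have c': "continuous_on {0..T} (Z T')" using Z(1)[of T'] T by (auto intro: continuous_on_subset)
    have "bounded (\<Psi> (Z T') ` {0..T})"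
      by (intro compact_imp_bounded compact_continuous_image cont T c' compact_Icc)
    then obtain B where "\<forall>x\<in>\<Psi> (Z T') ` {0..T}. norm x \<le> B" unfolding bounded_iff by blast
    hence B: "\<bar>\<Psi> (Z T') t\<bar> \<le> B" if "t \<in> {0..T}" for t using that by auto
    have "\<bar>Z T t - Z T' t\<bar> \<le> 2 * B * exp ((1 + 2 * q * C) * T) * \<bar>q - q\<bar>"
      using q T by (intro volterra_fixpoint_dependence[OF C(2,1) T(1)] Z c' B t) auto
    thus ?thesis by simp
  qed
  define z where "z t = Z (t + 1) t" for t
  have z: "z t = Z T t" if "T > 0" "t \<in> {0..T}" for T t
  proof (cases "t + 1 \<le> T")
    case True
    show ?thesis unfolding z_def by (rule Zeq) (use True that in auto)
  next
    case False
    show ?thesis unfolding z_def by (rule Zeq[symmetric]) (use False that in auto)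
  qed
  have zc: "continuous_on {0..T} z" if "T > 0" for T
    using Z(1)[OF that] by (rule continuous_on_eq) (use z[OF that] in auto)
  have "z t = q * \<Psi> z t" if t: "t \<ge> 0" for t
  proof -
    define T where "T = t + 1"
    have T: "T > 0" "t \<in> {0..T}" using t by (auto simp: T_def)
    obtain C where C: "C \<ge> 0" "volterra_bound \<Psi> T C" using vb[OF T(1)] by auto
    have "\<bar>\<Psi> z t - \<Psi> (Z T) t\<bar> \<le> C / 1 * 0 * exp (1 * t)"
      by (rule volterra_boundD[OF C(2) zc[OF T(1)] Z(1)[OF T(1)] _ _ _ T(2)]) (simp_all add: z[OF T(1)])
    hence "\<Psi> z t = \<Psi> (Z T) t" by simp
    thus ?thesis unfolding z[OF T] by (metis Z(2)[OF T])
  qed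
  moreover have "continuous_on {0..} z"
    unfolding continuous_on_eq_continuous_within
  proof
    fix x :: real assume x: "x \<in> {0..}"
    have "continuous (at x within {0..x+1}) z"
      using zc[of "x+1"] x by (auto simp: continuous_on_eq_continuous_within)
    moreover have "at x within {0..x+1} = at x within {0..}"
      by (rule at_within_nhd[of _ "{..<x+1}"]) auto
    ultimately show "continuous (at x within {0..}) z" by (simp add: continuous_within)
  qed
  ultimately show ?thesis by blast
qed

section \<open>The birth and death rates\<close>

lemma lipschitz_of_continuous_deriv:
  fixes f f' :: "real \<Rightarrow> real"
  assumes f: "\<And>s. s \<ge> 0 \<Longrightarrow> (f has_real_derivative f' s) (at s within {0..})"
    and f': "continuous_on {0..} f'"
  shows "\<exists>K>0. \<forall>x\<in>{0..S}. \<forall>y\<in>{0..S}. \<bar>f x - f y\<bar> \<le> K * \<bar>x - y\<bar>"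
proof -
  have "bounded (f' ` {0..S})"
    by (intro compact_imp_bounded compact_continuous_image continuous_on_subset[OF f']) auto
  then obtain K where K: "K > 0" "\<And>x. x \<in> {0..S} \<Longrightarrow> \<bar>f' x\<bar> \<le> K"
    unfolding bounded_pos by auto
  have "norm (f x - f y) \<le> K * norm (x - y)" if "x \<in> {0..S}" "y \<in> {0..S}" for x y
    by (rule field_differentiable_bound[of "{0..S}" f f'])
      (use K that in \<open>auto intro: DERIV_subset[OF f]\<close>)
  with K(1) show ?thesis by auto
qed

locale birth_death =
  fixes \<kappa> sM :: real and b d b' d' d'' :: "real \<Rightarrow> real"
  assumes d_deriv: "\<And>s. s \<ge> 0 \<Longrightarrow> (d has_real_derivative d' s) (at s within {0..})"
    and d'_deriv: "\<And>s. s \<ge> 0 \<Longrightarrow> (d' has_real_derivative d'' s) (at s within {0..})"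
    and d0: "d 0 = 0"
    and d'_pos: "\<And>s. s > 0 \<Longrightarrow> d' s > 0"
    and d''_nonneg: "\<And>s. s > 0 \<Longrightarrow> d'' s \<ge> 0"
    and b_deriv: "\<And>s. s \<ge> 0 \<Longrightarrow> (b has_real_derivative b' s) (at s within {0..})"
    and b'_cont: "continuous_on {0..} b'"
    and b_nonneg: "\<And>s. s \<ge> 0 \<Longrightarrow> b s \<ge> 0"
    and sM_ext: "pos_local_extremum b sM"
    and sM_unique: "\<And>s. pos_local_extremum b s \<Longrightarrow> s = sM"
    and sM_max: "\<And>s. s \<ge> 0 \<Longrightarrow> b s \<le> b sM"
    and b0: "b 0 = 0"
    and kappa: "\<kappa> > 0" "b \<kappa> = d \<kappa>"
    and b'0: "b' 0 > d' 0"
    and bd: "\<And>s. 0 < s \<Longrightarrow> s < \<kappa> \<Longrightarrow> d s < b s"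
    and sM_kappa: "sM < \<kappa>"
begin

lemma sM_pos: "sM > 0" using sM_ext by (auto simp: pos_local_extremum_def)

lemma b_cont: "continuous_on {0..} b" using b_deriv by (auto intro!: DERIV_continuous_on)
lemma d_cont: "continuous_on {0..} d" using d_deriv by (auto intro!: DERIV_continuous_on)
lemma d'_cont: "continuous_on {0..} d'" using d'_deriv by (auto intro!: DERIV_continuous_on)

lemma at_pos: "s > 0 \<Longrightarrow> at s within {0..} = at (s::real)"
  by (rule at_within_nhd[of _ "{0<..}"]) auto

lemma d_less: assumes "0 \<le> x" "x < y" shows "d x < d y"
proof (rule DERIV_pos_imp_increasing_open[OF assms(2)])
  fix z assume "x < z" "z < y"
  thus "\<exists>y. DERIV d z :> y \<and> 0 < y" using d_deriv[of z] d'_pos[of z] at_pos[of z] assms by force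
qed (use assms in \<open>auto intro: continuous_on_subset[OF d_cont]\<close>)

lemma d_unbounded: "\<exists>s\<ge>0. d s \<ge> u"
proof -
  have d'mono: "d' 1 \<le> d' z" if "z > 1" for z
  proof (rule DERIV_nonneg_imp_increasing_open[of 1 z])
    fix x assume "1 < x" "x < z"
    thus "\<exists>y. DERIV d' x :> y \<and> 0 \<le> y" using d'_deriv[of x] d''_nonneg[of x] at_pos[of x] by force
  qed (use that in \<open>auto intro: continuous_on_subset[OF d'_cont]\<close>)
  have lin: "d s \<ge> d 1 + d' 1 * (s - 1)" if s: "s > 1" for s
  proof -
    have "(d has_real_derivative d' x) (at x)" if "1 \<le> x" for x
      using d_deriv[of x] at_pos[of x] that by simp
    from MVT2[OF s this] obtain z where z: "1 < z" "z < s" "d s - d 1 = (s - 1) * d' z" by blast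
    have "(s - 1) * d' 1 \<le> (s - 1) * d' z" using d'mono[of z] z s by (intro mult_left_mono) auto
    with z(3) show ?thesis by (simp add: algebra_simps)
  qed
  have "d' 1 > 0" by (rule d'_pos) simp
  define s where "s = 2 + \<bar>u - d 1\<bar> / d' 1"
  have "d' 1 * (s - 1) = d' 1 + \<bar>u - d 1\<bar>" using \<open>d' 1 > 0\<close> by (simp add: s_def field_simps)
  hence "d 1 + d' 1 * (s - 1) \<ge> u" using \<open>d' 1 > 0\<close> by linarith
  moreover have "s > 1" using \<open>d' 1 > 0\<close> unfolding s_def by (simp add: add_pos_nonneg)
  ultimately show ?thesis using lin[of s] by (intro exI[of _ s]) auto
qed

lemma interior_minimum:
  assumes "0 \<le> x" "x < p" "p < y" "\<And>z. z \<in> {x..y} \<Longrightarrow> b p \<le> b z" shows "p = sM"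
proof (rule sM_unique)
  have "b p \<le> b z" if "\<bar>z - p\<bar> < min (p - x) (y - p)" for z
    using assms(2,3) that by (intro assms(4)) auto
  thus "pos_local_extremum b p" unfolding pos_local_extremum_def
    using assms(1-3) by (intro conjI exI[of _ "min (p - x) (y - p)"] disjI2) auto
qed

lemma global_maximum:
  assumes "0 < x" "b sM \<le> b x" shows "x = sM"
proof (rule sM_unique)
  have "b y \<le> b x" if "y > 0" for y using sM_max[of y] assms(2) that by linarith
  thus "pos_local_extremum b x" unfolding pos_local_extremum_def
    using assms(1) by (intro conjI exI[of _ 1] disjI1) auto
qed

lemma bM_pos: "b sM > 0"
  using sM_max[of \<kappa>] kappa d_less[of 0 \<kappa>] d0 by auto

lemma attains_min:
  assumes "0 \<le> x" "x \<le> y" obtains p where "p \<in> {x..y}" "\<And>z. z \<in> {x..y} \<Longrightarrow> b p \<le> b z"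
proof -
  have "continuous_on {x..y} b" using assms by (auto intro: continuous_on_subset[OF b_cont])
  from continuous_attains_inf[OF compact_Icc _ this] assms
  obtain p where "p \<in> {x..y}" "\<forall>z\<in>{x..y}. b p \<le> b z" by auto
  thus ?thesis using that by blast
qed

lemma b_less: assumes "0 \<le> x" "x < y" "y \<le> sM" shows "b x < b y"
proof (rule ccontr)
  assume n: "\<not> b x < b y"
  show False
  proof (cases "y = sM")
    case True
    hence "b sM \<le> b x" using n by simp
    moreover have "x \<noteq> 0" using bM_pos b0 \<open>b sM \<le> b x\<close> by auto
    ultimately have "x = sM" using global_maximum[of x] assms by auto
    thus False using assms by auto
  next
    case False
    obtain p where p: "p \<in> {x..sM}" "\<And>z. z \<in> {x..sM} \<Longrightarrow> b p \<le> b z"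
      using attains_min[of x sM] assms by auto
    have "\<not> (x < p \<and> p < sM)" using interior_minimum[of x p sM] p assms by auto
    hence "p = x \<or> p = sM" using p(1) by auto
    hence "b y \<le> b p" using n sM_max[of y] assms by auto
    hence "\<And>z. z \<in> {x..sM} \<Longrightarrow> b y \<le> b z" using p(2) by force
    hence "y = sM" using interior_minimum[of x y sM] assms False by auto
    thus False using False by simp
  qed
qed

lemma b_greater: assumes "sM \<le> x" "x < y" shows "b y < b x"
proof (rule ccontr)
  assume n: "\<not> b y < b x"
  have s0: "sM > 0" by (rule sM_pos)
  obtain p where p: "p \<in> {sM..y}" "\<And>z. z \<in> {sM..y} \<Longrightarrow> b p \<le> b z"
    using attains_min[of sM y] assms s0 by auto
  have "\<not> (sM < p \<and> p < y)" using interior_minimum[of sM p y] p assms s0 by auto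
  hence p': "p = sM \<or> p = y" using p(1) by auto
  show False
  proof (cases "x = sM")
    case True
    hence "y = sM" using n global_maximum[of y] s0 assms by auto
    thus False using assms True by simp
  next
    case False
    have "b x \<le> b p" using p' n sM_max[of x] assms s0 by auto
    hence "\<And>z. z \<in> {sM..y} \<Longrightarrow> b x \<le> b z" using p(2) by force
    hence "x = sM" using interior_minimum[of sM x y] assms False s0 by auto
    thus False using False by simp
  qed
qed

lemma b_min: assumes "0 \<le> x" "x \<le> y" "y \<le> z" shows "min (b x) (b z) \<le> b y"
proof (cases "y \<le> sM")
  case True
  thus ?thesis using b_less[of x y] assms by (cases "x = y") auto
next
  case False
  thus ?thesis using b_greater[of y z] assms by (cases "y = z") auto
qed

lemma b_pos: assumes "s > 0" shows "b s > 0"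
proof (cases "s \<le> sM")
  case True thus ?thesis using b_less[of 0 s] b0 assms by auto
next
  case False thus ?thesis using b_greater[of s "s+1"] b_nonneg[of "s+1"] assms by auto
qed

lemma zeta2: "zeta2 b d sM > \<kappa>" "d (zeta2 b d sM) = b sM"
proof -
  have dk: "d \<kappa> < b sM" using kappa b_greater[of sM \<kappa>] sM_kappa by auto
  obtain u where u: "u \<ge> 0" "d u \<ge> b sM" using d_unbounded by blast
  have "\<kappa> \<le> u" using d_less[of u \<kappa>] u dk by (cases "u < \<kappa>") auto
  hence "\<exists>s. \<kappa> \<le> s \<and> s \<le> u \<and> d s = b sM"
    using u dk kappa by (intro IVT') (auto intro: continuous_on_subset[OF d_cont])
  then obtain s where s: "\<kappa> \<le> s" "d s = b sM" by auto
  have "zeta2 b d sM = s" unfolding zeta2_def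
  proof (rule the_equality)
    show "0 \<le> s \<and> d s = b sM" using s kappa by auto
    show "s' = s" if "0 \<le> s' \<and> d s' = b sM" for s'
      using that s kappa d_less[of s s'] d_less[of s' s] by (cases s s' rule: linorder_cases) auto
  qed
  moreover have "s \<noteq> \<kappa>" using dk s by auto
  ultimately show "zeta2 b d sM > \<kappa>" "d (zeta2 b d sM) = b sM" using s by auto
qed

lemma zeta1: "0 < zeta1 b d sM" "zeta1 b d sM < sM" "b (zeta1 b d sM) = b (zeta2 b d sM)"
proof -
  let ?t = "b (zeta2 b d sM)"
  have t: "0 < ?t" "?t < b sM"
    using b_pos[of "zeta2 b d sM"] b_greater[of sM "zeta2 b d sM"] zeta2 kappa sM_kappa by auto
  hence "\<exists>s. 0 \<le> s \<and> s \<le> sM \<and> b s = ?t"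
    using b0 sM_pos by (intro IVT') (auto intro: continuous_on_subset[OF b_cont])
  then obtain s where s: "0 \<le> s" "s \<le> sM" "b s = ?t" by auto
  have s': "s \<noteq> 0" "s \<noteq> sM" using s t b0 by auto
  have "zeta1 b d sM = s" unfolding zeta1_def
  proof (rule the_equality)
    show "0 < s \<and> s < sM \<and> b s = ?t" using s s' by auto
    show "u = s" if "0 < u \<and> u < sM \<and> b u = ?t" for u
      using that s b_less[of s u] b_less[of u s] by (cases s u rule: linorder_cases) auto
  qed
  thus "0 < zeta1 b d sM" "zeta1 b d sM < sM" "b (zeta1 b d sM) = b (zeta2 b d sM)" using s s' by auto
qed

lemma linear_bounds:
  "\<exists>\<delta> \<beta> \<sigma>. 0 < \<delta> \<and> \<delta> < \<beta> \<and> 0 < \<sigma> \<and> \<sigma> \<le> \<kappa> \<and> (\<forall>x\<in>{0..\<sigma>}. d x \<le> \<delta> * x \<and> \<beta> * x \<le> b x)"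
proof -
  have lim: "((\<lambda>x. f x / x) \<longlongrightarrow> f') (at_right 0)"
    if "(f has_real_derivative f') (at 0 within {0..})" "f 0 = 0" for f :: "real \<Rightarrow> real" and f'
  proof -
    have "(f has_real_derivative f') (at 0 within {0<..})" by (rule DERIV_subset[OF that(1)]) auto
    thus ?thesis using that(2) by (simp add: has_field_derivative_iff)
  qed
  have d: "((\<lambda>x. d x / x) \<longlongrightarrow> d' 0) (at_right 0)" by (rule lim) (use d_deriv[of 0] d0 in auto)
  have b: "((\<lambda>x. b x / x) \<longlongrightarrow> b' 0) (at_right 0)" by (rule lim) (use b_deriv[of 0] b0 in auto)
  have "eventually (\<lambda>x. 0 \<le> d x / x) (at_right 0)"
    using d_less[of 0] d0 by (auto simp: eventually_at_filter intro!: always_eventually less_imp_le)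
  hence d'0: "d' 0 \<ge> 0" using tendsto_lowerbound[OF d] by (auto simp: trivial_limit_at_right_real)
  define e where "e = (b' 0 - d' 0) / 3"
  have e: "e > 0" using b'0 by (simp add: e_def)
  have "eventually (\<lambda>x. d x / x < d' 0 + e) (at_right 0)" "eventually (\<lambda>x. b' 0 - e < b x / x) (at_right 0)"
    using order_tendstoD(2)[OF d, of "d' 0 + e"] order_tendstoD(1)[OF b, of "b' 0 - e"] e by auto
  hence "eventually (\<lambda>x. d x / x < d' 0 + e \<and> b' 0 - e < b x / x) (at_right 0)" by eventually_elim auto
  then obtain \<sigma> where \<sigma>: "\<sigma> > 0" "\<And>x. 0 < x \<Longrightarrow> x < \<sigma> \<Longrightarrow> d x / x < d' 0 + e \<and> b' 0 - e < b x / x"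
    by (auto simp: eventually_at_right_field)
  show ?thesis
  proof (intro exI conjI ballI)
    show "0 < d' 0 + e" "d' 0 + e < b' 0 - e" using d'0 e by (auto simp: e_def field_simps)
    show "0 < min (\<sigma>/2) \<kappa>" "min (\<sigma>/2) \<kappa> \<le> \<kappa>" using \<sigma> kappa by auto
    fix x assume x: "x \<in> {0..min (\<sigma>/2) \<kappa>}"
    have "d x \<le> (d' 0 + e) * x \<and> (b' 0 - e) * x \<le> b x"
    proof (cases "x = 0")
      case False
      hence "x > 0" "x < \<sigma>" using x \<sigma>(1) by auto
      thus ?thesis using \<sigma>(2)[of x] by (simp add: pos_divide_less_eq pos_less_divide_eq)
    qed (simp add: d0 b0)
    thus "d x \<le> (d' 0 + e) * x" "(b' 0 - e) * x \<le> b x" by auto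
  qed
qed

lemma common_lipschitz:
  "\<exists>K>0. \<forall>x\<in>{0..S}. \<forall>y\<in>{0..S}. \<bar>b x - b y\<bar> \<le> K * \<bar>x - y\<bar> \<and> \<bar>d x - d y\<bar> \<le> K * \<bar>x - y\<bar>"
proof -
  obtain K1 where K1: "K1 > 0" "\<forall>x\<in>{0..S}. \<forall>y\<in>{0..S}. \<bar>b x - b y\<bar> \<le> K1 * \<bar>x - y\<bar>"
    using lipschitz_of_continuous_deriv[OF b_deriv b'_cont] by blast
  obtain K2 where K2: "K2 > 0" "\<forall>x\<in>{0..S}. \<forall>y\<in>{0..S}. \<bar>d x - d y\<bar> \<le> K2 * \<bar>x - y\<bar>"
    using lipschitz_of_continuous_deriv[OF d_deriv d'_cont] by blast
  have le: "K1 * \<bar>x - y\<bar> \<le> (K1 + K2) * \<bar>x - y\<bar>" "K2 * \<bar>x - y\<bar> \<le> (K1 + K2) * \<bar>x - y\<bar>" for x y :: real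
    using K1(1) K2(1) by (auto intro!: mult_right_mono)
  have "\<bar>b x - b y\<bar> \<le> (K1 + K2) * \<bar>x - y\<bar> \<and> \<bar>d x - d y\<bar> \<le> (K1 + K2) * \<bar>x - y\<bar>"
    if "x \<in> {0..S}" "y \<in> {0..S}" for x y
    using K1(2) K2(2) that le[of x y] by (meson order.trans)
  thus ?thesis using K1(1) K2(1) by (intro exI[of _ "K1 + K2"]) auto
qed

end

section \<open>The delayed equation as a first order system\<close>

lemma first_zero:
  fixes g :: "real \<Rightarrow> real"
  assumes "\<alpha> \<le> T" "continuous_on {\<alpha>..T} g" "g \<alpha> > 0" "g T \<le> 0"
  obtains s where "\<alpha> < s" "s \<le> T" "g s = 0" "\<And>t. \<alpha> \<le> t \<Longrightarrow> t < s \<Longrightarrow> g t > 0"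
proof -
  define A where "A = {t\<in>{\<alpha>..T}. g t = 0}"
  have ivt: "\<exists>u. \<alpha> \<le> u \<and> u \<le> t \<and> g u = 0" if "t \<in> {\<alpha>..T}" "g t \<le> 0" for t
    using that assms by (intro IVT2') (auto intro: continuous_on_subset)
  have "closed A" unfolding A_def
    using continuous_closed_preimage_constant[OF assms(2), of 0] by simp
  moreover have "A \<noteq> {}" using ivt[of T] assms by (auto simp: A_def)
  moreover have bb: "bdd_below A" by (auto simp: A_def)
  ultimately have "Inf A \<in> A" by (intro closed_contains_Inf)
  hence s: "\<alpha> \<le> Inf A" "Inf A \<le> T" "g (Inf A) = 0" by (auto simp: A_def)
  have "Inf A \<noteq> \<alpha>" using s assms by auto
  moreover have "g t > 0" if t: "\<alpha> \<le> t" "t < Inf A" for t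
  proof (rule ccontr)
    assume "\<not> g t > 0"
    then obtain u where u: "\<alpha> \<le> u" "u \<le> t" "g u = 0" using ivt[of t] t s by auto
    hence "u \<in> A" using t s by (auto simp: A_def)
    hence "Inf A \<le> u" using bb by (rule cInf_lower)
    thus False using u t by auto
  qed
  ultimately show ?thesis using that[of "Inf A"] s by auto
qed

locale delay_reaction =
  fixes m r S K \<kappa> \<zeta>1 \<zeta>2 :: real and b d :: "real \<Rightarrow> real"
  assumes m: "m > 1" and r: "r \<ge> 0" and K: "K > 0"
    and order: "0 < \<zeta>1" "\<zeta>1 < \<kappa>" "\<kappa> < \<zeta>2" "\<zeta>2 < S"
    and b_lip: "x \<in> {0..S} \<Longrightarrow> y \<in> {0..S} \<Longrightarrow> \<bar>b x - b y\<bar> \<le> K * \<bar>x - y\<bar>"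
    and d_lip: "x \<in> {0..S} \<Longrightarrow> y \<in> {0..S} \<Longrightarrow> \<bar>d x - d y\<bar> \<le> K * \<bar>x - y\<bar>"
    and b0: "b 0 = 0" and d0: "d 0 = 0"
    and b_pos: "x > 0 \<Longrightarrow> b x > 0"
    and d_less: "0 \<le> x \<Longrightarrow> x < y \<Longrightarrow> d x < d y"
    and b_min: "0 \<le> x \<Longrightarrow> x \<le> y \<Longrightarrow> y \<le> z \<Longrightarrow> min (b x) (b z) \<le> b y"
    and b_gt_d: "0 < x \<Longrightarrow> x < \<kappa> \<Longrightarrow> d x < b x" and b_eq_d: "b \<kappa> = d \<kappa>"
    and b_le_top: "0 \<le> x \<Longrightarrow> b x \<le> d \<zeta>2"
    and b_zeta: "b \<zeta>1 = b \<zeta>2" "b \<zeta>1 < b \<kappa>"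
    and b_less_zeta: "0 \<le> x \<Longrightarrow> x < \<zeta>1 \<Longrightarrow> b x < b \<zeta>1"
begin

abbreviation lam :: real where "lam \<equiv> 1 / (m - 1)"
abbreviation vmax :: real where "vmax \<equiv> S powr (m - 1)"
abbreviation warmup :: real where "warmup \<equiv> 1 / (2 * K)"

lemma d_le: "0 \<le> x \<Longrightarrow> x \<le> y \<Longrightarrow> d x \<le> d y"
  using d_less[of x y] by (cases "x = y") auto

lemma b_ge_d: "0 \<le> x \<Longrightarrow> x \<le> \<kappa> \<Longrightarrow> d x \<le> b x"
  using b_gt_d[of x] b_eq_d b0 d0 by (cases "x = 0"; cases "x = \<kappa>") auto

lemma lipschitz_imp_continuous:
  assumes "\<And>x y. x \<in> {0..S} \<Longrightarrow> y \<in> {0..S} \<Longrightarrow> \<bar>g x - g y\<bar> \<le> K * \<bar>x - y\<bar>"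
  shows "continuous_on {0..S} g"
proof (rule uniformly_continuous_imp_continuous, rule lipschitz_on_uniformly_continuous)
  show "K-lipschitz_on {0..S} g" using assms K by (auto simp: lipschitz_on_def dist_real_def)
qed

lemma b_cont: "continuous_on {0..S} b" and d_cont: "continuous_on {0..S} d"
  using lipschitz_imp_continuous b_lip d_lip by auto

definition rate :: "(real \<Rightarrow> real) \<Rightarrow> real \<Rightarrow> real" where
  "rate f t = d (f t) - b (f (t - r))"

definition net :: "(real \<Rightarrow> real) \<Rightarrow> real \<Rightarrow> real" where
  "net f t = integral {0..t} (rate f)"

definition flux :: "(real \<Rightarrow> real) \<Rightarrow> real \<Rightarrow> real" where
  "flux f t = f t + net f t"

definition profile :: "real \<Rightarrow> real \<Rightarrow> (real \<Rightarrow> real) \<Rightarrow> bool" where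
  "profile q T f \<longleftrightarrow> q > 0 \<and> continuous_on UNIV f \<and> (\<forall>t\<le>0. f t = 0) \<and> (\<forall>t\<in>{0<..T}. 0 < f t \<and> f t \<le> S) \<and>
     (\<forall>t\<in>{0<..<T}. ((\<lambda>t. f t powr (m - 1)) has_real_derivative q * (1 + net f t / f t)) (at t))"

lemma rate_cont_aux:
  assumes f: "continuous_on {..T} f" and range: "\<And>t. t \<le> T \<Longrightarrow> 0 \<le> f t \<and> f t \<le> S"
  shows "continuous_on {..T} (rate f)"
  unfolding rate_def
proof (intro continuous_on_diff)
  show "continuous_on {..T} (\<lambda>t. d (f t))"
    using range by (intro continuous_on_compose2[OF d_cont f]) auto
  have "continuous_on {..T} (\<lambda>t. f (t - r))"
    using r by (intro continuous_on_compose2[OF f] continuous_intros) auto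
  thus "continuous_on {..T} (\<lambda>t. b (f (t - r)))"
    using range r by (intro continuous_on_compose2[OF b_cont]) auto
qed

lemma net_deriv_aux:
  assumes f: "continuous_on {..T} f" and range: "\<And>t. t \<le> T \<Longrightarrow> 0 \<le> f t \<and> f t \<le> S"
    and t: "0 < t" "t < T"
  shows "(net f has_real_derivative rate f t) (at t)"
proof -
  have "(net f has_real_derivative rate f t) (at t within {0..T})"
    unfolding net_def using rate_cont_aux[where T = T, OF f range] t
    by (intro integral_has_real_derivative) (auto intro: continuous_on_subset)
  moreover have "at t within {0..T} = at t"
    by (rule at_within_interior) (use t in \<open>auto simp: interior_atLeastAtMost_real\<close>)
  ultimately show ?thesis by simp
qed

lemma net_cont_aux:
  assumes f: "continuous_on {..T} f" and range: "\<And>t. t \<le> T \<Longrightarrow> 0 \<le> f t \<and> f t \<le> S"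
  shows "continuous_on {0..T} (net f)"
  unfolding net_def using rate_cont_aux[where T = T, OF f range]
  by (intro indefinite_integral_continuous_1 integrable_continuous_interval)
     (auto intro: continuous_on_subset)

context
  fixes q T f assumes P: "profile q T f"
begin

lemma q_pos: "q > 0"
  and f_cont: "continuous_on A f"
  and f_past: "t \<le> 0 \<Longrightarrow> f t = 0"
  and f_pos: "0 < t \<Longrightarrow> t \<le> T \<Longrightarrow> 0 < f t"
  and f_le: "0 < t \<Longrightarrow> t \<le> T \<Longrightarrow> f t \<le> S"
  and v_deriv: "0 < t \<Longrightarrow> t < T \<Longrightarrow>
     ((\<lambda>t. f t powr (m - 1)) has_real_derivative q * (1 + net f t / f t)) (at t)"
  using P by (auto simp: profile_def intro: continuous_on_subset)

lemma f_range: "t \<le> T \<Longrightarrow> 0 \<le> f t \<and> f t \<le> S"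
  using f_pos[of t] f_le[of t] f_past[of t] order by (cases "t \<le> 0") (auto intro: less_imp_le)

lemma rate_cont: "continuous_on {..T} (rate f)"
  and net_deriv: "0 < t \<Longrightarrow> t < T \<Longrightarrow> (net f has_real_derivative rate f t) (at t)"
  and net_cont: "continuous_on {0..T} (net f)"
  using rate_cont_aux[OF f_cont f_range, of T] net_deriv_aux[OF f_cont f_range, of T]
    net_cont_aux[OF f_cont f_range, of T] by auto

lemma flux_cont: "continuous_on {0..T} (flux f)"
  unfolding flux_def by (intro continuous_intros f_cont net_cont)

definition mobility :: "real \<Rightarrow> real" where
  "mobility t = q / (m - 1) * f t powr (1 - m)"

lemma mobility_pos: "0 < t \<Longrightarrow> t \<le> T \<Longrightarrow> mobility t > 0"
  using q_pos m f_pos[of t] by (simp add: mobility_def)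

lemma f_deriv:
  assumes t: "0 < t" "t < T"
  shows "(f has_real_derivative mobility t * flux f t) (at t)"
proof -
  have f0: "f t > 0" using f_pos[of t] t by simp
  have "((\<lambda>t. (f t powr (m - 1)) powr lam) has_real_derivative
      lam * (f t powr (m - 1)) powr (lam - 1) * (q * (1 + net f t / f t))) (at t)"
    using f0 by (intro DERIV_chain2[OF has_real_derivative_powr v_deriv[OF t]]) auto
  also have "lam * (f t powr (m - 1)) powr (lam - 1) * (q * (1 + net f t / f t))
      = mobility t * flux f t"
  proof -
    have "(f t powr (m - 1)) powr (lam - 1) = f t * f t powr (1 - m)"
    proof -
      have "(m - 1) * (lam - 1) = 1 + (1 - m)" using m by (simp add: field_simps)
      hence "(f t powr (m - 1)) powr (lam - 1) = f t powr (1 + (1 - m))"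
        by (simp only: powr_powr)
      also have "\<dots> = f t * f t powr (1 - m)" using f0 by (simp only: powr_add powr_one less_imp_le)
      finally show ?thesis .
    qed
    hence "lam * (f t powr (m - 1)) powr (lam - 1) * (q * (1 + net f t / f t))
        = mobility t * (f t * (1 + net f t / f t))" by (simp add: mobility_def)
    also have "f t * (1 + net f t / f t) = flux f t" using f0 by (simp add: flux_def field_simps)
    finally show ?thesis .
  qed
  finally have "((\<lambda>t. (f t powr (m - 1)) powr lam) has_real_derivative mobility t * flux f t) (at t)" .
  moreover have "\<forall>\<^sub>F x in nhds t. (f x powr (m - 1)) powr lam = f x"
  proof -
    have "\<forall>\<^sub>F x in nhds t. x \<in> {0<..<T}" using t by (intro eventually_nhds_in_open) auto
    thus ?thesis
    proof eventually_elim
      case (elim x)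
      hence "f x > 0" using f_pos by simp
      thus ?case using m by (simp add: powr_powr)
    qed
  qed
  ultimately show ?thesis by (subst (asm) DERIV_cong_ev) auto
qed

lemma f_deriv_sign:
  assumes "0 < t" "t < T"
  shows "\<exists>y. DERIV f t :> y \<and> sgn y = sgn (flux f t)"
  using f_deriv[OF assms] mobility_pos[of t] assms
  by (intro exI[of _ "mobility t * flux f t"]) (auto simp: sgn_mult)

lemma f_increasing:
  assumes "0 \<le> x" "x < y" "y \<le> T" "\<And>t. x < t \<Longrightarrow> t < y \<Longrightarrow> flux f t > 0"
  shows "f x < f y"
proof (rule DERIV_pos_imp_increasing_open[OF assms(2)])
  fix t assume "x < t" "t < y"
  thus "\<exists>y. DERIV f t :> y \<and> 0 < y"
    using f_deriv_sign[of t] assms by (auto simp: sgn_1_pos)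
qed (rule f_cont)

lemma f_decreasing:
  assumes "0 \<le> x" "x < y" "y \<le> T" "\<And>t. x < t \<Longrightarrow> t < y \<Longrightarrow> flux f t < 0"
  shows "f y < f x"
proof (rule DERIV_neg_imp_decreasing_open[OF assms(2)])
  fix t assume "x < t" "t < y"
  thus "\<exists>y. DERIV f t :> y \<and> y < 0"
    using f_deriv_sign[of t] assms by (auto simp: sgn_1_neg)
qed (rule f_cont)

lemma f_mono:
  assumes "x \<le> y" "y \<le> T" "\<And>t. 0 < t \<Longrightarrow> x < t \<Longrightarrow> t < y \<Longrightarrow> flux f t \<ge> 0"
  shows "f x \<le> f y"
proof -
  have *: "f x \<le> f y" if "0 \<le> x" "x < y" "y \<le> T" "\<And>t. x < t \<Longrightarrow> t < y \<Longrightarrow> flux f t \<ge> 0" for x y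
  proof (rule DERIV_nonneg_imp_increasing_open[OF less_imp_le[OF that(2)]])
    fix t assume t: "x < t" "t < y"
    thus "\<exists>y. DERIV f t :> y \<and> 0 \<le> y"
      using f_deriv[of t] mobility_pos[of t] that
      by (intro exI[of _ "mobility t * flux f t"]) auto
  qed (rule f_cont)
  show ?thesis
  proof (cases "y \<le> 0 \<or> x = y")
    case True thus ?thesis using f_past assms by auto
  next
    case False
    have "f x \<le> f (max x 0)" using f_past[of x] f_past[of 0] by (cases "x \<le> 0") auto
    also have "\<dots> \<le> f y" using False assms by (cases "max x 0 = y") (auto intro!: *)
    finally show ?thesis .
  qed
qed

lemma f_antimono:
  assumes "0 \<le> x" "x \<le> y" "y \<le> T" "\<And>t. x < t \<Longrightarrow> t < y \<Longrightarrow> flux f t \<le> 0"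
  shows "f y \<le> f x"
proof (rule DERIV_nonpos_imp_decreasing_open[OF assms(2)])
  fix t assume t: "x < t" "t < y"
  have "mobility t * flux f t \<le> 0"
    using mobility_pos[of t] t assms by (intro mult_nonneg_nonpos less_imp_le assms) auto
  thus "\<exists>y. DERIV f t :> y \<and> y \<le> 0" using f_deriv[of t] t assms by auto
qed (rule f_cont)

lemma net_antimono:
  assumes "0 \<le> x" "x \<le> y" "y \<le> T" "\<And>t. x < t \<Longrightarrow> t < y \<Longrightarrow> rate f t \<le> 0"
  shows "net f y \<le> net f x"
proof (rule DERIV_nonpos_imp_decreasing_open[OF assms(2)])
  fix t assume t: "x < t" "t < y"
  thus "\<exists>y. DERIV (net f) t :> y \<and> y \<le> 0" using net_deriv[of t] assms by auto
qed (use net_cont assms in \<open>auto intro: continuous_on_subset\<close>)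

lemma net_mono:
  assumes "0 \<le> x" "x \<le> y" "y \<le> T" "\<And>t. x < t \<Longrightarrow> t < y \<Longrightarrow> rate f t \<ge> 0"
  shows "net f x \<le> net f y"
proof (rule DERIV_nonneg_imp_increasing_open[OF assms(2)])
  fix t assume t: "x < t" "t < y"
  thus "\<exists>y. DERIV (net f) t :> y \<and> 0 \<le> y" using net_deriv[of t] assms by auto
qed (use net_cont assms in \<open>auto intro: continuous_on_subset\<close>)

lemma rate_left_nbhd:
  assumes t: "0 < t" "t \<le> T" "e > 0" and A: "open A" "rate f t \<in> A"
  obtains u where "0 < u" "u < t" "t - e < u" "\<And>s. u < s \<Longrightarrow> s \<le> t \<Longrightarrow> rate f s \<in> A"
proof -
  have "(rate f \<longlongrightarrow> rate f t) (at t within {..T})"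
    using rate_cont t by (auto simp: continuous_on_def)
  hence "eventually (\<lambda>s. rate f s \<in> A) (at t within {..T})" using A by (rule topological_tendstoD)
  then obtain e' where e': "e' > 0" "\<And>s. s \<le> T \<Longrightarrow> s \<noteq> t \<Longrightarrow> \<bar>s - t\<bar> < e' \<Longrightarrow> rate f s \<in> A"
    by (auto simp: eventually_at dist_real_def)
  define u where "u = Max {t/2, t - e/2, t - e'/2}"
  show ?thesis
  proof (rule that[of u])
    show "0 < u" "u < t" "t - e < u" using t e' by (auto simp: u_def)
    fix s assume "u < s" "s \<le> t"
    thus "rate f s \<in> A" using e'(2)[of s] e'(1) A(2) t by (cases "s = t") (auto simp: u_def)
  qed
qed

text \<open>At a first passage through a level the flux cannot vanish, because the net production is
  strictly monotone there and would force the profile to turn before reaching the level.\<close>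

lemma first_passage_down:
  assumes t: "0 < t" "t \<le> T" and e: "e > 0" "\<And>s. t - e < s \<Longrightarrow> s < t \<Longrightarrow> f t < f s"
    and neg: "rate f t < 0"
  shows "flux f t < 0"
proof (rule ccontr)
  assume p: "\<not> flux f t < 0"
  obtain u where u: "0 < u" "u < t" "t - e < u" "\<And>s. u < s \<Longrightarrow> s \<le> t \<Longrightarrow> rate f s \<in> {..<0}"
    using rate_left_nbhd[OF t e(1), of "{..<0}"] neg by auto
  define w where "w = (u + t) / 2"
  have w: "u < w" "w < t" using u by (auto simp: w_def)
  have "flux f s > 0" if s: "w < s" "s < t" for s
  proof -
    have "net f t \<le> net f s" using s w u t by (intro net_antimono) (auto intro: less_imp_le)
    moreover have "f t < f s" using e(2)[of s] s w u by auto
    ultimately show ?thesis using p by (simp add: flux_def)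
  qed
  hence "f w < f t" using w u t by (intro f_increasing) auto
  thus False using e(2)[of w] w u by auto
qed

lemma first_passage_up:
  assumes t: "0 < t" "t \<le> T" and e: "e > 0" "\<And>s. t - e < s \<Longrightarrow> s < t \<Longrightarrow> f s < f t"
    and pos: "rate f t > 0"
  shows "flux f t > 0"
proof (rule ccontr)
  assume p: "\<not> flux f t > 0"
  obtain u where u: "0 < u" "u < t" "t - e < u" "\<And>s. u < s \<Longrightarrow> s \<le> t \<Longrightarrow> rate f s \<in> {0<..}"
    using rate_left_nbhd[OF t e(1), of "{0<..}"] pos by auto
  define w where "w = (u + t) / 2"
  have w: "u < w" "w < t" using u by (auto simp: w_def)
  have "flux f s < 0" if s: "w < s" "s < t" for s
  proof -
    have "net f s \<le> net f t" using s w u t by (intro net_mono) (auto intro: less_imp_le)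
    moreover have "f s < f t" using e(2)[of s] s w u by auto
    ultimately show ?thesis using p by (simp add: flux_def)
  qed
  hence "f t < f w" using w u t by (intro f_decreasing) auto
  thus False using e(2)[of w] w u by auto
qed

text \<open>While the profile moves in the direction of its flux and the net production pushes the same way,
  the flux cannot return to zero.\<close>

lemma flux_stays_negative:
  assumes s: "0 < s" "flux f s < 0"
    and rate: "\<And>t. s < t \<Longrightarrow> t < T \<Longrightarrow> (\<And>u. s \<le> u \<Longrightarrow> u < t \<Longrightarrow> flux f u < 0) \<Longrightarrow> rate f t \<le> 0"
    and t: "s \<le> t" "t \<le> T"
  shows "flux f t \<le> flux f s"
proof -
  have fall: "flux f t \<le> flux f s"
    if "s \<le> t" "t \<le> T" "\<And>u. s \<le> u \<Longrightarrow> u < t \<Longrightarrow> flux f u < 0" for t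
  proof -
    have "net f t \<le> net f s" using that s by (intro net_antimono rate) auto
    moreover have "f t \<le> f s" using that s by (intro f_antimono) (auto intro: less_imp_le)
    ultimately show ?thesis by (simp add: flux_def)
  qed
  have "flux f u < 0" if u: "s \<le> u" "u \<le> T" for u
  proof (rule ccontr)
    assume n: "\<not> flux f u < 0"
    have "continuous_on {s..u} (\<lambda>x. - flux f x)"
      using s u by (intro continuous_on_minus continuous_on_subset[OF flux_cont]) auto
    then obtain x where x: "s < x" "x \<le> u" "- flux f x = 0" "\<And>y. s \<le> y \<Longrightarrow> y < x \<Longrightarrow> - flux f y > 0"
      by (rule first_zero[OF u(1)]) (use n s in auto)
    with fall[of x] u s show False by auto
  qed
  with fall[of t] t show ?thesis by auto
qed

lemma flux_stays_positive:
  assumes s: "0 < s" "flux f s > 0"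
    and rate: "\<And>t. s < t \<Longrightarrow> t < T \<Longrightarrow> (\<And>u. s \<le> u \<Longrightarrow> u < t \<Longrightarrow> flux f u > 0) \<Longrightarrow> rate f t \<ge> 0"
    and t: "s \<le> t" "t \<le> T"
  shows "flux f t \<ge> flux f s"
proof -
  have rise: "flux f t \<ge> flux f s"
    if "s \<le> t" "t \<le> T" "\<And>u. s \<le> u \<Longrightarrow> u < t \<Longrightarrow> flux f u > 0" for t
  proof -
    have "net f s \<le> net f t" using that s by (intro net_mono rate) auto
    moreover have "f s \<le> f t" using that s by (intro f_mono) (auto intro: less_imp_le)
    ultimately show ?thesis by (simp add: flux_def)
  qed
  have "flux f u > 0" if u: "s \<le> u" "u \<le> T" for u
  proof (rule ccontr)
    assume n: "\<not> flux f u > 0"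
    have "continuous_on {s..u} (flux f)"
      using s u by (intro continuous_on_subset[OF flux_cont]) auto
    then obtain x where x: "s < x" "x \<le> u" "flux f x = 0" "\<And>y. s \<le> y \<Longrightarrow> y < x \<Longrightarrow> flux f y > 0"
      by (rule first_zero[OF u(1)]) (use n s in auto)
    with rise[of x] u s show False by auto
  qed
  with rise[of t] t show ?thesis by auto
qed

end

definition turning :: "(real \<Rightarrow> real) \<Rightarrow> real \<Rightarrow> bool" where
  "turning f s \<longleftrightarrow> 0 < s \<and> (\<forall>t. 0 < t \<longrightarrow> t < s \<longrightarrow> flux f t \<ge> 0) \<and>
     (\<forall>e>0. \<exists>t. s < t \<and> t < s + e \<and> flux f t < 0)"

context
  fixes q T f assumes P: "profile q T f"
begin

lemma flux_isCont:
  assumes "0 < t" "t < T" shows "isCont (flux f) t"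
  using flux_cont[OF P] continuous_on_interior[of "{0..T}" "flux f" t] assms
  by (auto simp: interior_atLeastAtMost_real)

lemma turning_flux:
  assumes s: "turning f s" "s < T" shows "flux f s = 0"
proof -
  have s0: "0 < s" using s by (simp add: turning_def)
  note lim = flux_isCont[OF s0 s(2), unfolded isCont_def]
  have "\<not> flux f s < 0"
  proof
    assume "flux f s < 0"
    hence "eventually (\<lambda>t. flux f t < 0) (at s)" using order_tendstoD(2)[OF lim] by auto
    then obtain e where e: "e > 0" "\<And>t. t \<noteq> s \<Longrightarrow> \<bar>t - s\<bar> < e \<Longrightarrow> flux f t < 0"
      by (auto simp: eventually_at dist_real_def)
    define t where "t = max (s/2) (s - e/2)"
    have "0 < t" "t < s" "\<bar>t - s\<bar> < e" using s0 e(1) by (auto simp: t_def)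
    thus False using e(2)[of t] s(1) by (force simp: turning_def)
  qed
  moreover have "\<not> flux f s > 0"
  proof
    assume "flux f s > 0"
    hence "eventually (\<lambda>t. flux f t > 0) (at s)" using order_tendstoD(1)[OF lim] by auto
    then obtain e where e: "e > 0" "\<And>t. t \<noteq> s \<Longrightarrow> \<bar>t - s\<bar> < e \<Longrightarrow> flux f t > 0"
      by (auto simp: eventually_at dist_real_def)
    from s(1) e(1) obtain t where t: "s < t" "t < s + e" "flux f t < 0" by (auto simp: turning_def)
    thus False using e(2)[of t] by auto
  qed
  ultimately show ?thesis by simp
qed

lemma turning_rate:
  assumes s: "turning f s" "s < T" shows "rate f s \<le> 0"
proof (rule ccontr)
  assume n: "\<not> rate f s \<le> 0"
  have s0: "0 < s" using s by (simp add: turning_def)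
  have "(flux f has_real_derivative (mobility q f s * flux f s + rate f s)) (at s)"
    unfolding flux_def[abs_def] using f_deriv[OF P s0 s(2)] net_deriv[OF P s0 s(2)]
    by (intro DERIV_add) (auto simp: flux_def[abs_def])
  hence "(flux f has_real_derivative rate f s) (at s)" by (simp add: turning_flux[OF s])
  from DERIV_pos_inc_right[OF this] n obtain e where
    e: "e > 0" "\<And>h. h > 0 \<Longrightarrow> h < e \<Longrightarrow> flux f s < flux f (s + h)" by auto
  from s(1) e(1) obtain t where t: "s < t" "t < s + e" "flux f t < 0" by (auto simp: turning_def)
  thus False using e(2)[of "t - s"] turning_flux[OF s] by auto
qed

lemma before_turning:
  assumes "turning f s" "s < T" "x \<le> y" "y \<le> s" shows "f x \<le> f y"
  using assms by (intro f_mono[OF P]) (auto simp: turning_def)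

text \<open>Up to the turning point the delayed profile lies between \<open>f (s - r)\<close> and \<open>f s\<close>; since \<open>b\<close> is
  unimodal, the birth term cannot fall below \<open>d (f s)\<close> there.\<close>

lemma birth_before_turning:
  assumes s: "turning f s" "s < T" "f s \<le> \<kappa>" and u: "s - r \<le> u" "u \<le> s"
  shows "d (f s) \<le> b (f u)"
proof -
  have "min (b (f (s - r))) (b (f s)) \<le> b (f u)"
    using u r s(2) f_range[OF P, of "s - r"] before_turning[OF s(1,2)] by (intro b_min) auto
  moreover have "d (f s) \<le> b (f (s - r))" using turning_rate[OF s(1,2)] by (simp add: rate_def)
  moreover have "d (f s) \<le> b (f s)" using f_range[OF P, of s] s by (intro b_ge_d) auto
  ultimately show ?thesis by auto
qed

lemma rate_after_turning:
  assumes s: "turning f s" "s < T" "f s \<le> \<kappa>" and t: "s < t" "t < T" "r > 0 \<longrightarrow> t \<le> s + r"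
    and U: "U \<ge> 0" "f t - f s \<le> U"
  shows "rate f t \<le> 2 * K * U"
proof (cases "r > 0")
  case True
  have "d (f s) \<le> b (f (t - r))" using t True by (intro birth_before_turning[OF s]) auto
  moreover have "d (f t) - d (f s) \<le> K * U"
  proof (cases "f t \<le> f s")
    case True
    hence "d (f t) \<le> d (f s)" using f_range[OF P, of t] t by (intro d_le) auto
    moreover have "0 \<le> K * U" using K U by simp
    ultimately show ?thesis by simp
  next
    case False
    have "\<bar>d (f t) - d (f s)\<bar> \<le> K * \<bar>f t - f s\<bar>"
      using f_range[OF P, of t] f_range[OF P, of s] t s by (intro d_lip) auto
    also have "\<dots> \<le> K * U" using False U K by (intro mult_left_mono) auto
    finally show ?thesis by simp
  qed
  moreover have "0 \<le> K * U" using K U by simp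
  ultimately show ?thesis by (simp add: rate_def)
next
  case False
  hence r0: "r = 0" using r by simp
  show ?thesis
  proof (cases "f t \<le> f s")
    case True
    hence "d (f t) \<le> b (f t)" using f_range[OF P, of t] t s by (intro b_ge_d) auto
    moreover have "0 \<le> K * U" using K U by simp
    ultimately show ?thesis unfolding rate_def by (simp add: r0)
  next
    case False
    have "\<bar>d (f t) - d (f s)\<bar> \<le> K * \<bar>f t - f s\<bar>" "\<bar>b (f t) - b (f s)\<bar> \<le> K * \<bar>f t - f s\<bar>"
      using f_range[OF P, of t] f_range[OF P, of s] t s by (auto intro!: d_lip b_lip)
    moreover have "K * \<bar>f t - f s\<bar> \<le> K * U" using False U K by (intro mult_left_mono) auto
    moreover have "d (f s) \<le> b (f s)" using f_range[OF P, of s] s by (intro b_ge_d) auto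
    ultimately show ?thesis unfolding rate_def by (simp add: r0)
  qed
qed

lemma no_rise_after_turning:
  assumes s: "turning f s" "s < T" "f s \<le> \<kappa>"
  shows "\<exists>e>0. s + e < T \<and> (r > 0 \<longrightarrow> e \<le> r) \<and> (\<forall>t\<in>{s..s+e}. f t \<le> f s)"
proof -
  have s0: "0 < s" using s by (simp add: turning_def)
  define T' where "T' = (s + T) / 2"
  have T': "s < T'" "T' < T" using s by (auto simp: T'_def)
  have "f x \<noteq> 0" if "x \<in> {s..T'}" for x using f_pos[OF P, of x] that s0 T' by auto
  hence "continuous_on {s..T'} (mobility q f)" unfolding mobility_def[OF P]
    by (intro continuous_intros f_cont[OF P]) auto
  hence "bounded (mobility q f ` {s..T'})" by (intro compact_imp_bounded compact_continuous_image) auto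
  then obtain B where B: "B > 0" "\<And>x. x \<in> {s..T'} \<Longrightarrow> \<bar>mobility q f x\<bar> \<le> B"
    unfolding bounded_pos by auto
  define e where "e = Min {T' - s, if r > 0 then r else 1, 1, 1 / (2 * B * (1 + 2 * K))}"
  have e: "e > 0" "e \<le> T' - s" "r > 0 \<longrightarrow> e \<le> r" "e \<le> 1" "e \<le> 1 / (2 * B * (1 + 2 * K))"
    using T' B K unfolding e_def by (auto simp: Min_le_iff)
  have eB: "e * B * (1 + 2 * K) \<le> 1/2"
  proof -
    have "e * (2 * B * (1 + 2 * K)) \<le> 1" using e(5) B K by (subst (asm) pos_le_divide_eq) auto
    thus ?thesis by (simp add: algebra_simps)
  qed
  obtain t1 where t1: "t1 \<in> {s..s+e}" "\<And>t. t \<in> {s..s+e} \<Longrightarrow> f t \<le> f t1"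
    using continuous_attains_sup[OF compact_Icc _ f_cont[OF P], of s "s + e"] e by auto
  define U where "U = f t1 - f s"
  have U0: "U \<ge> 0" using t1(2)[of s] e by (auto simp: U_def)
  have U: "f t - f s \<le> U" if "t \<in> {s..s+e}" for t using t1(2)[OF that] by (simp add: U_def)
  have "U = 0"
  proof (rule ccontr)
    assume "U \<noteq> 0"
    hence Up: "U > 0" using U0 by simp
    hence st1: "s < t1" using t1(1) by (cases "t1 = s") (auto simp: U_def)
    have df: "DERIV f x :> mobility q f x * flux f x" if "s \<le> x" "x \<le> t1" for x
      using that s0 t1 e T' by (intro f_deriv[OF P]) auto
    from MVT2[OF st1 df] obtain x where x: "s < x" "x < t1"
      "f t1 - f s = (t1 - s) * (mobility q f x * flux f x)" by auto
    have dn: "DERIV (net f) y :> rate f y" if "s \<le> y" "y \<le> x" for y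
      using that s0 t1 e T' x by (intro net_deriv[OF P]) auto
    from MVT2[OF x(1) dn] obtain y where y: "s < y" "y < x" "net f x - net f s = (x - s) * rate f y" by auto
    have "rate f y \<le> 2 * K * U"
      using y x t1 e T' by (intro rate_after_turning[OF s] U0 U) auto
    hence "(x - s) * rate f y \<le> e * (2 * K * U)"
      using x t1 U0 K e
      by (intro order.trans[OF mult_left_mono mult_right_mono]) auto
    moreover have "e * (2 * K * U) \<le> 1 * (2 * K * U)" using e K U0 by (intro mult_right_mono) auto
    moreover have "f x - f s \<le> U" using x t1 by (intro U) auto
    ultimately have fx: "flux f x \<le> (1 + 2 * K) * U"
      using y(3) turning_flux[OF s(1,2)] by (simp add: flux_def algebra_simps)
    have mob: "0 < mobility q f x" using s0 x t1 e T' by (intro mobility_pos[OF P]) auto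
    have mB: "mobility q f x \<le> B" using B(2)[of x] x t1 e by auto
    have "0 < (t1 - s) * (mobility q f x * flux f x)" using Up x(3) by (simp add: U_def)
    hence fx0: "flux f x > 0" using mob st1 by (simp add: zero_less_mult_iff)
    have "U = (t1 - s) * (mobility q f x * flux f x)" using x(3) by (simp add: U_def)
    also have "\<dots> \<le> e * (B * ((1 + 2 * K) * U))"
      using fx fx0 mob mB t1 st1 e B(1) by (intro mult_mono mult_nonneg_nonneg) auto
    also have "\<dots> = (e * B * (1 + 2 * K)) * U" by simp
    also have "\<dots> \<le> 1/2 * U" using eB U0 by (rule mult_right_mono)
    finally show False using Up by simp
  qed
  hence "\<forall>t\<in>{s..s+e}. f t \<le> f s" using U by auto
  with e T' show ?thesis by (intro exI[of _ e]) auto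
qed

lemma decay_starts:
  assumes s: "turning f s" "s < T" "f s \<le> \<kappa>"
  shows "\<exists>s1>s. s1 < T \<and> flux f s1 < 0 \<and> (\<forall>t\<in>{s..s1}. flux f t \<le> 0)"
proof -
  have s0: "0 < s" using s by (simp add: turning_def)
  obtain e where e: "e > 0" "s + e < T" "r > 0 \<longrightarrow> e \<le> r" "\<And>t. t \<in> {s..s+e} \<Longrightarrow> f t \<le> f s"
    using no_rise_after_turning[OF s] by auto
  have early: "flux f t \<le> 0" if t: "s \<le> t" "t \<le> s + e" for t
  proof -
    have "rate f u \<le> 0" if u: "s < u" "u < t" for u
      using rate_after_turning[OF s u(1), of 0] e(2,3) e(4)[of u] u t by auto
    hence "net f t \<le> net f s" using t e s0 by (intro net_antimono[OF P]) auto
    thus ?thesis using turning_flux[OF s(1,2)] e(4)[of t] t by (simp add: flux_def)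
  qed
  obtain s1 where s1: "s < s1" "s1 < s + e" "flux f s1 < 0" using s(1) e(1) unfolding turning_def by blast
  show ?thesis using s1 e early by (intro exI[of _ s1]) auto
qed

lemma decay_continues:
  assumes s: "turning f s" "s < T" "f s \<le> \<kappa>"
    and s1: "s < s1" "s1 < T" "flux f s1 < 0" "\<And>t. s \<le> t \<Longrightarrow> t \<le> s1 \<Longrightarrow> flux f t \<le> 0"
  shows "\<And>t. s1 \<le> t \<Longrightarrow> t \<le> T \<Longrightarrow> flux f t \<le> flux f s1" "\<And>t. s \<le> t \<Longrightarrow> t \<le> T \<Longrightarrow> f t \<le> f s"
proof -
  have s0: "0 < s" using s by (simp add: turning_def)
  have anti: "f y \<le> f x"
    if "s \<le> x" "x \<le> y" "y \<le> T" "\<And>u. s1 \<le> u \<Longrightarrow> u < y \<Longrightarrow> flux f u \<le> 0" for x y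
  proof (rule f_antimono[OF P])
    show "0 \<le> x" "x \<le> y" "y \<le> T" using that s0 by auto
    fix u assume u: "x < u" "u < y"
    show "flux f u \<le> 0"
    proof (cases "u \<le> s1")
      case True thus ?thesis using u that by (intro s1(4)) auto
    next
      case False thus ?thesis using u that s1 by (intro that(4)) auto
    qed
  qed
  have stay: "flux f t \<le> flux f s1" if "s1 \<le> t" "t \<le> T" for t
  proof (rule flux_stays_negative[OF P])
    show "0 < s1" "flux f s1 < 0" using s1 s0 by auto
    show "s1 \<le> t" "t \<le> T" using that by auto
    fix u assume u: "s1 < u" "u < T" "\<And>w. s1 \<le> w \<Longrightarrow> w < u \<Longrightarrow> flux f w < 0"
    have u': "flux f w \<le> 0" if "s1 \<le> w" "w < u" for w using u(3)[OF that] by simp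
    have du: "d (f u) \<le> d (f w)" if "s \<le> w" "w \<le> u" for w
      using u that f_range[OF P, of u] by (intro d_le anti u') auto
    show "rate f u \<le> 0"
    proof (cases "u - r \<le> s")
      case True
      hence "d (f s) \<le> b (f (u - r))" using u s1 by (intro birth_before_turning[OF s]) auto
      thus ?thesis using du[of s] u s1 by (simp add: rate_def)
    next
      case False
      have "f (u - r) \<le> f s" using u False r by (intro anti u') auto
      hence "f (u - r) \<le> \<kappa>" using s by simp
      hence "d (f (u - r)) \<le> b (f (u - r))" using u r f_range[OF P, of "u - r"] by (intro b_ge_d) auto
      thus ?thesis using du[of "u - r"] False r by (simp add: rate_def)
    qed
  qed
  have "f t \<le> f s" if "s \<le> t" "t \<le> T" for t
  proof (rule anti)
    fix u assume "s1 \<le> u" "u < t"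
    hence "flux f u \<le> flux f s1" using that by (intro stay) auto
    thus "flux f u \<le> 0" using s1 by simp
  qed (use that in auto)
  with stay show "\<And>t. s1 \<le> t \<Longrightarrow> t \<le> T \<Longrightarrow> flux f t \<le> flux f s1"
    "\<And>t. s \<le> t \<Longrightarrow> t \<le> T \<Longrightarrow> f t \<le> f s" by auto
qed

lemma decay_after_turning:
  assumes s: "turning f s" "s < T" "f s \<le> \<kappa>" and t: "s \<le> t" "t \<le> T"
  shows "f t \<le> f s"
proof -
  obtain s1 where "s1 > s" "s1 < T" "flux f s1 < 0" "\<forall>t\<in>{s..s1}. flux f t \<le> 0"
    using decay_starts[OF s] by auto
  thus ?thesis using decay_continues(2)[OF s _ _ _ _ t, of s1] by auto
qed

lemma turning_exists:
  assumes t: "0 < t" "t \<le> T" "flux f t < 0" and pos: "0 < a" "\<And>u. 0 < u \<Longrightarrow> u \<le> a \<Longrightarrow> flux f u \<ge> 0"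
  shows "\<exists>s. turning f s \<and> a \<le> s \<and> s < t"
proof -
  define A where "A = {u. 0 < u \<and> flux f u < 0}"
  have tA: "t \<in> A" using t by (simp add: A_def)
  have low: "a \<le> u" if "u \<in> A" for u using pos(2)[of u] that by (force simp: A_def)
  have bb: "bdd_below A" by (rule bdd_belowI[of _ a]) (rule low)
  define s where "s = Inf A"
  have as: "a \<le> s" unfolding s_def using tA low by (intro cInf_greatest) auto
  have st: "s \<le> t" unfolding s_def by (rule cInf_lower[OF tA bb])
  have before: "flux f u \<ge> 0" if "0 < u" "u < s" for u
    using cInf_lower[OF _ bb, of u] that by (force simp: A_def s_def)
  have Ts: "s \<noteq> t"
  proof
    assume eq: "s = t"
    have c: "continuous_on {0..t} (flux f)" using t by (intro continuous_on_subset[OF flux_cont[OF P]]) auto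
    hence "(flux f \<longlongrightarrow> flux f t) (at t within {0..t})" using t by (auto simp: continuous_on_def)
    hence "eventually (\<lambda>u. flux f u < 0) (at t within {0..t})" using t by (intro order_tendstoD(2)) auto
    then obtain e where e: "e > 0" "\<And>u. 0 \<le> u \<Longrightarrow> u \<le> t \<Longrightarrow> u \<noteq> t \<Longrightarrow> \<bar>u - t\<bar> < e \<Longrightarrow> flux f u < 0"
      by (auto simp: eventually_at dist_real_def)
    define u where "u = max (t/2) (t - e/2)"
    have "0 < u" "u < t" "\<bar>u - t\<bar> < e" using t e(1) by (auto simp: u_def)
    thus False using e(2)[of u] before[of u] eq by auto
  qed
  have after: "\<exists>u. s < u \<and> u < s + e \<and> flux f u < 0" if "e > 0" for e
  proof -
    have "Inf A < s + min e (t - s)" using that Ts st by (simp add: s_def)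
    then obtain u where u: "u \<in> A" "u < s + min e (t - s)" using cInf_lessD[of A] tA by auto
    have "s \<le> u" unfolding s_def by (rule cInf_lower[OF u(1) bb])
    show ?thesis
    proof (cases "u = s")
      case False thus ?thesis using u \<open>s \<le> u\<close> by (intro exI[of _ u]) (auto simp: A_def)
    next
      case True
      have "isCont (flux f) s" using as pos st t Ts by (intro flux_isCont) auto
      hence "eventually (\<lambda>u. flux f u < 0) (at s)"
        using u True by (intro order_tendstoD(2)[of "flux f" "flux f s"]) (auto simp: isCont_def A_def)
      then obtain e' where e': "e' > 0" "\<And>u. u \<noteq> s \<Longrightarrow> \<bar>u - s\<bar> < e' \<Longrightarrow> flux f u < 0"
        by (auto simp: eventually_at dist_real_def)
      show ?thesis using e'(1) that by (intro exI[of _ "s + min e e' / 2"] conjI e'(2)) auto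
    qed
  qed
  show ?thesis unfolding turning_def using as pos before after st Ts by (intro exI[of _ s]) auto
qed

end
definition entire_profile :: "real \<Rightarrow> (real \<Rightarrow> real) \<Rightarrow> bool" where
  "entire_profile q f \<longleftrightarrow> (\<forall>T. profile q T f)"

context
  fixes q f assumes E: "entire_profile q f"
begin

lemma entire_at: "profile q T f" using E by (simp add: entire_profile_def)

lemma entire_pos: "t > 0 \<Longrightarrow> f t > 0" using f_pos[OF entire_at[of t]] by simp
lemma entire_range: "0 \<le> f t" "f t \<le> S" using f_range[OF entire_at[of t], of t] by auto

lemma entire_v_increment:
  assumes "0 < s" "s < t"
  obtains x where "s < x" "x < t"
    "f t powr (m - 1) - f s powr (m - 1) = (t - s) * (q * (flux f x / f x))"
proof -
  have "DERIV (\<lambda>t. f t powr (m - 1)) x :> q * (flux f x / f x)" if "s \<le> x" "x \<le> t" for x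
  proof -
    have "1 + net f x / f x = flux f x / f x"
      using entire_pos[of x] that assms by (simp add: flux_def add_divide_distrib)
    thus ?thesis using v_deriv[OF entire_at[of "t + 1"], of x] that assms by simp
  qed
  from MVT2[OF assms(2) this] that show ?thesis by blast
qed

lemma entire_v_range: "0 \<le> f t powr (m - 1)" "f t powr (m - 1) \<le> vmax"
  using entire_range[of t] m by (auto intro: powr_mono2)

lemma no_persistent_flux:
  assumes s: "0 < s" and e: "e > 0" "\<And>t. t \<ge> s \<Longrightarrow> flux f t \<le> - e \<or> flux f t \<ge> e"
  shows False
proof -
  have q: "q > 0" and S: "S > 0" using q_pos[OF entire_at] order by auto
  define t where "t = s + (vmax + 1) * S / (q * e)"
  have st: "s < t" using q S e by (simp add: t_def add_nonneg_pos)
  obtain x where x: "s < x" "x < t" "f t powr (m - 1) - f s powr (m - 1) = (t - s) * (q * (flux f x / f x))"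
    using entire_v_increment[OF s st] by blast
  have fx: "0 < f x" "f x \<le> S" using entire_pos[of x] entire_range(2) x s by auto
  have "e \<le> \<bar>flux f x\<bar>" using e(2)[of x] x by linarith
  hence "e / S \<le> \<bar>flux f x\<bar> / f x" using e(1) fx by (intro frac_le) auto
  hence "(t - s) * (q * (e / S)) \<le> (t - s) * (q * (\<bar>flux f x\<bar> / f x))"
    using st q by (intro mult_left_mono) auto
  also have "\<dots> = \<bar>f t powr (m - 1) - f s powr (m - 1)\<bar>"
    unfolding x(3) using st q fx by (simp add: abs_mult)
  finally have "vmax + 1 \<le> \<bar>f t powr (m - 1) - f s powr (m - 1)\<bar>"
    using q e(1) S by (simp add: t_def)
  thus False using entire_v_range[of t] entire_v_range[of s] by linarith
qed

lemma turning_above_kappa: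
  assumes s: "turning f s" shows "f s > \<kappa>"
proof (rule ccontr)
  assume n: "\<not> f s > \<kappa>"
  have s0: "0 < s" using s by (simp add: turning_def)
  obtain s1 where s1: "s1 > s" "s1 < s + 1" "flux f s1 < 0" "\<forall>t\<in>{s..s1}. flux f t \<le> 0"
    using decay_starts[OF entire_at s, of "s + 1"] n by auto
  have "flux f t \<le> flux f s1" if "s1 \<le> t" for t
    using that s1 n by (intro decay_continues(1)[OF entire_at[of "t + 1"] s]) auto
  thus False using no_persistent_flux[of s1 "- flux f s1"] s1 s0 by auto
qed

lemma entire_le_zeta2: "f t \<le> \<zeta>2"
proof (rule ccontr)
  assume n: "\<not> f t \<le> \<zeta>2"
  then obtain l where l: "\<zeta>2 < l" "l < f t" using dense[of "\<zeta>2" "f t"] by auto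
  have l0: "0 < l" using l order by simp
  have t0: "0 < t" using n order f_past[OF entire_at, of t] by (cases "t \<le> 0") auto
  have dl: "b x < d l" if "0 \<le> x" for x using b_le_top[OF that] d_less[of \<zeta>2 l] l order by simp
  have "continuous_on {0..t} (\<lambda>s. l - f s)" by (intro continuous_intros f_cont[OF entire_at])
  then obtain s where s: "0 < s" "s \<le> t" "l - f s = 0" "\<And>u. 0 \<le> u \<Longrightarrow> u < s \<Longrightarrow> l - f u > 0"
    by (rule first_zero[OF less_imp_le[OF t0]]) (use l l0 f_past[OF entire_at, of 0] in auto)
  have ps: "flux f s > 0"
    using s dl[OF entire_range(1)] by (intro first_passage_up[OF entire_at s(1) order_refl s(1)]) (auto simp: rate_def)
  have "flux f u \<ge> flux f s" if u: "s \<le> u" for u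
  proof (rule flux_stays_positive[OF entire_at[of "u + 1"] s(1) ps])
    fix w assume w: "s < w" "w < u + 1" "\<And>x. s \<le> x \<Longrightarrow> x < w \<Longrightarrow> flux f x > 0"
    have "f s \<le> f w" using w s by (intro f_mono[OF entire_at[of w]]) (auto intro: less_imp_le)
    hence "d l \<le> d (f w)" using s l0 by (intro d_le) auto
    thus "rate f w \<ge> 0" using dl[OF entire_range(1), of "w - r"] by (simp add: rate_def)
  qed (use u in auto)
  thus False using no_persistent_flux[OF s(1) ps] by auto
qed

lemma monotone_reaches_zeta1:
  assumes mono: "\<And>t. 0 < t \<Longrightarrow> flux f t \<ge> 0" shows "\<exists>t>0. f t \<ge> \<zeta>1"
proof (rule ccontr)
  assume n: "\<not> (\<exists>t>0. f t \<ge> \<zeta>1)"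
  have inc: "f x \<le> f y" if "x \<le> y" for x y
    by (rule f_mono[OF entire_at that order_refl]) (use mono in auto)
  define l where "l = (SUP t. f t)"
  have bdd: "bdd_above (range f)" using entire_range(2) by (auto intro!: bdd_aboveI)
  have le: "f t \<le> l" for t unfolding l_def by (rule cSUP_upper[OF _ bdd]) simp
  have l1: "l \<le> \<zeta>1" unfolding l_def
  proof (rule cSUP_least)
    fix t show "f t \<le> \<zeta>1" using n f_past[OF entire_at, of t] order by (cases "t > 0") force+
  qed simp
  have l0: "0 < l" using le[of 1] entire_pos[of 1] by simp
  define e where "e = (b l - d l) / 2"
  have e: "e > 0" using b_gt_d[of l] l0 l1 order by (simp add: e_def)
  have "\<exists>u. l - e / K < f u"
    using less_cSUP_iff[OF _ bdd, of "l - e / K"] e K by (auto simp: l_def)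
  then obtain u where u: "l - e / K < f u" by blast
  define s where "s = max u 0 + r + 1"
  have s0: "s > 0" "s - r \<ge> u" using r by (auto simp: s_def)
  have rate: "rate f t \<le> - e" if "t \<ge> s" for t
  proof -
    have "l - e / K < f (t - r)" using u inc[of u "t - r"] s0 that by simp
    hence "K * (l - f (t - r)) \<le> e" using K by (simp add: field_simps)
    moreover have "\<bar>b l - b (f (t - r))\<bar> \<le> K * \<bar>l - f (t - r)\<bar>"
      using entire_range[of "t - r"] l0 l1 order by (intro b_lip) auto
    ultimately have "b l - e \<le> b (f (t - r))" using le[of "t - r"] by simp
    moreover have "d (f t) \<le> d l" using le[of t] entire_range[of t] by (intro d_le)
    ultimately have "rate f t \<le> d l - (b l - e)" by (simp add: rate_def)
    thus ?thesis by (simp add: e_def field_simps)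
  qed
  define t where "t = s + (\<bar>net f s\<bar> + l + 1) / e"
  have st: "s < t" using e l0 by (simp add: t_def add_nonneg_pos)
  have dn: "DERIV (net f) x :> rate f x" if "s \<le> x" "x \<le> t" for x
    using that s0 by (intro net_deriv[OF entire_at[of "t + 1"]]) auto
  from MVT2[OF st dn] obtain x where x: "s < x" "x < t" "net f t - net f s = (t - s) * rate f x" by auto
  have "(t - s) * rate f x \<le> (t - s) * - e" using rate[of x] x st by (intro mult_left_mono) auto
  also have "\<dots> = - (\<bar>net f s\<bar> + l + 1)" using e by (simp add: t_def)
  finally have "net f t \<le> - l - 1" using x(3) by linarith
  hence "flux f t < 0" using le[of t] by (simp add: flux_def)
  thus False using mono[of t] st s0 by simp
qed

lemma above_zeta1_after_turning:
  assumes s: "turning f s" and t: "s \<le> t" shows "\<zeta>1 \<le> f t"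
proof (rule ccontr)
  assume n: "\<not> \<zeta>1 \<le> f t"
  have s0: "0 < s" using s by (simp add: turning_def)
  have fs: "f s > \<kappa>" by (rule turning_above_kappa[OF s])
  have "rate f s \<le> 0" by (rule turning_rate[OF entire_at[of "s + 1"] s]) simp
  hence "d (f s) \<le> b (f (s - r))" by (simp add: rate_def)
  moreover have "d \<kappa> < d (f s)" using fs order by (intro d_less) auto
  ultimately have "b \<zeta>1 < b (f (s - r))" using b_eq_d b_zeta by simp
  hence "\<zeta>1 \<le> f (s - r)" using b_less_zeta[OF entire_range(1), of "s - r"] by force
  hence early: "\<zeta>1 \<le> f u" if "s - r \<le> u" "u \<le> s" for u
    using before_turning[OF entire_at[of "s + 1"] s _ that] by simp
  have st: "s < t" using t n fs order by (cases "s = t") auto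
  obtain l where l: "f t < l" "l < \<zeta>1" using n dense[of "f t" \<zeta>1] by auto
  have l0: "0 < l" using l entire_range(1)[of t] by simp
  have bl: "d l < b l" "b l < b \<zeta>1" using l0 l order by (auto intro: b_gt_d b_less_zeta)
  have birth: "b l \<le> b x" if "l \<le> x" "x \<le> \<zeta>2" for x
    using b_min[of l x \<zeta>2] that l0 bl b_zeta by auto
  have "continuous_on {s..t} (\<lambda>u. f u - l)" by (intro continuous_intros f_cont[OF entire_at])
  then obtain u where u: "s < u" "u \<le> t" "f u - l = 0" "\<And>w. s \<le> w \<Longrightarrow> w < u \<Longrightarrow> f w - l > 0"
    by (rule first_zero[OF less_imp_le[OF st]]) (use l fs order in auto)
  have past: "l \<le> f w" if "s - r \<le> w" "w \<le> u" for w
    using early[of w] u(3) u(4)[of w] that l by (cases "w \<le> s"; cases "w = u") auto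
  have pu: "flux f u < 0"
  proof (rule first_passage_down[OF entire_at[of u]])
    show "0 < u - s" using u by simp
    show "f u < f w" if "u - (u - s) < w" "w < u" for w using u(3) u(4)[of w] that by auto
    have "b l \<le> b (f (u - r))" using u r by (intro birth past entire_le_zeta2) auto
    thus "rate f u < 0" using u(3) bl by (simp add: rate_def)
  qed (use u s0 in auto)
  have "flux f w \<le> flux f u" if w: "u \<le> w" for w
  proof (rule flux_stays_negative[OF entire_at[of "w + 1"] _ pu])
    fix x assume x: "u < x" "x < w + 1" "\<And>y. u \<le> y \<Longrightarrow> y < x \<Longrightarrow> flux f y < 0"
    have x': "flux f y \<le> 0" if "u \<le> y" "y < x" for y using x(3)[OF that] by simp
    have anti: "f z \<le> f y" if "u \<le> y" "y \<le> z" "z \<le> x" for y z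
      using that u s0 by (intro f_antimono[OF entire_at[of z]] x') auto
    show "rate f x \<le> 0"
    proof (cases "x - r \<le> u")
      case True
      have "b l \<le> b (f (x - r))" using True x u by (intro birth past entire_le_zeta2) auto
      moreover have "d (f x) \<le> d l" using anti[of u x] u x entire_range[of x] by (intro d_le) auto
      ultimately show ?thesis using bl by (simp add: rate_def)
    next
      case False
      have "f (x - r) \<le> f u" using False r by (intro anti) auto
      hence "d (f (x - r)) \<le> b (f (x - r))" using u l order entire_range[of "x - r"] by (intro b_ge_d) auto
      moreover have "d (f x) \<le> d (f (x - r))" using False r entire_range[of x] by (intro d_le anti) auto
      ultimately show ?thesis by (simp add: rate_def)
    qed
  qed (use w u s0 in auto)
  thus False using no_persistent_flux[of u "- flux f u"] pu u s0 by auto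
qed

end
end

section \<open>The clipped flow\<close>

lemma powr_lipschitz:
  fixes p :: real
  assumes "0 < x0"
  shows "\<exists>C\<ge>0. \<forall>x\<in>{x0..x1}. \<forall>y\<in>{x0..x1}. \<bar>x powr p - y powr p\<bar> \<le> C * \<bar>x - y\<bar>"
proof -
  have "continuous_on {x0..x1} (\<lambda>x. p * x powr (p - 1))" using assms by (auto intro!: continuous_intros)
  hence "bounded ((\<lambda>x. p * x powr (p - 1)) ` {x0..x1})"
    by (intro compact_imp_bounded compact_continuous_image) auto
  then obtain C where C: "C > 0" "\<And>x. x \<in> {x0..x1} \<Longrightarrow> \<bar>p * x powr (p - 1)\<bar> \<le> C"
    unfolding bounded_pos by auto
  have "norm (x powr p - y powr p) \<le> C * norm (x - y)" if "x \<in> {x0..x1}" "y \<in> {x0..x1}" for x y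
  proof (rule field_differentiable_bound[of "{x0..x1}" "\<lambda>x. x powr p" "\<lambda>x. p * x powr (p - 1)"])
    fix z assume z: "z \<in> {x0..x1}"
    thus "((\<lambda>x. x powr p) has_real_derivative p * z powr (p - 1)) (at z within {x0..x1})"
      using assms by (intro DERIV_subset[OF has_real_derivative_powr]) auto
    show "norm (p * z powr (p - 1)) \<le> C" using C(2)[OF z] by simp
  qed (use that in auto)
  with C(1) show ?thesis by (intro exI[of _ C]) auto
qed

lemma continuous_on_linear_at_0:
  fixes g :: "real \<Rightarrow> real"
  assumes "continuous_on {0<..T} g" "\<And>t. 0 < t \<Longrightarrow> t \<le> T \<Longrightarrow> \<bar>g t - g 0\<bar> \<le> C * t"
  shows "continuous_on {0..T} g"
  unfolding continuous_on_eq_continuous_within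
proof
  fix x assume x: "x \<in> {0..T}"
  show "continuous (at x within {0..T}) g"
  proof (cases "x = 0")
    case False
    have "at x within {0..T} = at x within {0<..T}"
      by (rule at_within_nhd[of _ "{0<..}"]) (use x False in auto)
    thus ?thesis using assms(1) x False by (auto simp: continuous_on_eq_continuous_within)
  next
    case True
    have "((\<lambda>t. g t - g 0) \<longlongrightarrow> 0) (at 0 within {0..T})"
    proof (rule Lim_null_comparison)
      show "eventually (\<lambda>t. norm (g t - g 0) \<le> C * t) (at 0 within {0..T})"
        using assms(2) by (auto simp: eventually_at_filter intro!: always_eventually)
      show "((\<lambda>t. C * t) \<longlongrightarrow> 0) (at 0 within {0..T})" by (auto intro!: tendsto_eq_intros)
    qed
    thus ?thesis using True by (simp add: continuous_within LIM_zero_iff)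
  qed
qed

locale clipped_reaction = delay_reaction +
  fixes a A w :: real
  assumes a: "0 < a" "a \<le> A" and w: "0 < w" "w \<le> vmax"
begin

text \<open>The linear levels keep \<open>v\<close> comparable to \<open>t\<close> near \<open>0\<close>, where the power is not Lipschitz.\<close>

definition clip :: "real \<Rightarrow> real \<Rightarrow> real" where
  "clip t x = max (min (a * t) w) (min (min (A * t) vmax) x)"

definition trunc :: "(real \<Rightarrow> real) \<Rightarrow> real \<Rightarrow> real" where
  "trunc v t = (if t \<le> 0 then 0 else clip t (v t) powr lam)"

lemma S_pos: "S > 0" using order by simp
lemma lam_pos: "lam > 0" using m by simp

lemma bounds_le: "t \<ge> 0 \<Longrightarrow> min (a * t) w \<le> min (A * t) vmax"
  using a w by (auto simp: min_def mult_right_mono intro: order.trans mult_right_mono)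

lemma clip_le: "t \<ge> 0 \<Longrightarrow> clip t x \<le> A * t" "t \<ge> 0 \<Longrightarrow> clip t x \<le> vmax"
  using bounds_le[of t] by (auto simp: clip_def)

lemma clip_ge: assumes "0 < t" "t \<le> T" shows "min a (w / T) * t \<le> clip t x"
proof -
  have "min a (w / T) * t \<le> a * t" using assms by (intro mult_right_mono) auto
  moreover have "min a (w / T) * t \<le> w / T * t" using assms by (intro mult_right_mono) auto
  moreover have "w / T * t \<le> w" using assms w by (simp add: divide_le_eq mult_left_mono)
  ultimately show ?thesis by (simp add: clip_def)
qed

lemma clip_pos: "t > 0 \<Longrightarrow> clip t x > 0" using a w by (simp add: clip_def less_max_iff_disj)

lemma clip_nonneg: "t \<ge> 0 \<Longrightarrow> clip t x \<ge> 0" using a w by (simp add: clip_def le_max_iff_disj)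

lemma clip_nonexpansive: "\<bar>clip t x - clip t y\<bar> \<le> \<bar>x - y\<bar>"
  by (simp add: clip_def max_def min_def)

lemma clip_mono: "0 \<le> s \<Longrightarrow> s \<le> t \<Longrightarrow> x \<le> y \<Longrightarrow> clip s x \<le> clip t y"
  unfolding clip_def using a by (intro max.mono min.mono mult_left_mono) auto

lemma clip_exact:
  assumes "min (a * t) w \<le> x" "x \<le> A * t" "x \<le> vmax" shows "clip t x = x"
  using assms by (simp add: clip_def)

lemma trunc_le: "t \<ge> 0 \<Longrightarrow> trunc v t \<le> (A * t) powr lam"
  using clip_le[of t "v t"] clip_nonneg[of t "v t"] m by (auto simp: trunc_def intro!: powr_mono2)

lemma trunc_range: "0 \<le> trunc v t" "trunc v t \<le> S"
proof -
  show "0 \<le> trunc v t" by (simp add: trunc_def)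
  have "clip t (v t) powr lam \<le> vmax powr lam" if "t > 0"
    using clip_le[of t "v t"] clip_nonneg[of t "v t"] m that by (intro powr_mono2) auto
  thus "trunc v t \<le> S" using S_pos m by (simp add: trunc_def powr_powr)
qed

lemma trunc_ge:
  assumes "0 < t" "t \<le> T" shows "(min a (w / T) * t) powr lam \<le> trunc v t"
  using clip_ge[OF assms, of "v t"] assms a w m by (auto simp: trunc_def intro!: powr_mono2 mult_nonneg_nonneg)

lemma trunc_pos: "t > 0 \<Longrightarrow> trunc v t > 0" using clip_pos[of t "v t"] by (simp add: trunc_def)

lemma trunc_cont:
  assumes "continuous_on {0..T} v" shows "continuous_on {..T} (trunc v)"
proof -
  have eq: "trunc v t = clip (max t 0) (v (max t 0)) powr lam" for t
    using a w m by (auto simp: trunc_def clip_def max_def min_def)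
  have "continuous_on {..T} (\<lambda>t. v (max t 0))" if "T \<ge> 0"
    using that by (intro continuous_on_compose2[OF assms] continuous_intros) auto
  hence "continuous_on {..T} (\<lambda>t. v (max t 0))"
    by (cases "T \<ge> 0") (auto intro: continuous_on_eq[OF continuous_on_const[of _ "v 0"]] simp: max_def)
  hence "continuous_on {..T} (\<lambda>t. clip (max t 0) (v (max t 0)))"
    unfolding clip_def by (intro continuous_intros)
  thus ?thesis unfolding eq
    using lam_pos by (intro continuous_on_powr' continuous_intros) (auto intro: clip_nonneg)
qed

lemma rate_bound:
  assumes "0 \<le> s" "s \<le> t" shows "\<bar>rate (trunc v) s\<bar> \<le> 2 * K * (A * t) powr lam"
proof -
  let ?B = "(A * t) powr lam"
  have tr: "trunc v u \<le> ?B" if "u \<le> t" for u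
  proof (cases "u \<ge> 0")
    case True
    have "(A * u) powr lam \<le> ?B" using a True that m by (intro powr_mono2) auto
    thus ?thesis using trunc_le[of u v] True by simp
  qed (simp add: trunc_def)
  have "\<bar>d (trunc v s) - d 0\<bar> \<le> K * \<bar>trunc v s - 0\<bar>" "\<bar>b (trunc v (s - r)) - b 0\<bar> \<le> K * \<bar>trunc v (s - r) - 0\<bar>"
    using trunc_range S_pos by (intro d_lip b_lip; force)+
  moreover have "K * trunc v s \<le> K * ?B" "K * trunc v (s - r) \<le> K * ?B"
    using K tr[of s] tr[of "s - r"] assms r by (auto intro!: mult_left_mono)
  ultimately show ?thesis using trunc_range(1)[of v s] trunc_range(1)[of v "s - r"]
    by (simp add: rate_def b0 d0)
qed

lemma rate_trunc_cont: "continuous_on {0..T} v \<Longrightarrow> continuous_on {0..T} (rate (trunc v))"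
  by (rule continuous_on_subset[OF rate_cont_aux[OF trunc_cont]]) (auto intro: trunc_range)

lemma net_bound:
  assumes v: "continuous_on {0..t} v" and t: "0 \<le> t"
  shows "\<bar>net (trunc v) t\<bar> \<le> 2 * K * (A * t) powr lam * t"
  using integral_bound[OF t rate_trunc_cont[OF v], of "2 * K * (A * t) powr lam"]
    rate_bound[of _ t v] by (auto simp: net_def)

definition quot :: "(real \<Rightarrow> real) \<Rightarrow> real \<Rightarrow> real" where
  "quot v t = net (trunc v) t / trunc v t"

lemma quot_bound:
  assumes v: "continuous_on {0..t} v" and t: "0 < t" "t \<le> T"
  shows "\<bar>quot v t\<bar> \<le> 2 * K * (A / min a (w / T)) powr lam * t"
proof -
  define a' where "a' = min a (w / T)"
  have a': "a' > 0" using a w t by (simp add: a'_def)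
  have lo: "0 < (a' * t) powr lam" using a' t by simp
  have "\<bar>quot v t\<bar> = \<bar>net (trunc v) t\<bar> / trunc v t"
    using trunc_range(1)[of v t] by (simp add: quot_def abs_divide)
  also have "\<dots> \<le> (2 * K * (A * t) powr lam * t) / (a' * t) powr lam"
    using net_bound[OF v] t lo trunc_ge[OF t, of v] K a' by (intro frac_le) (auto simp: a'_def)
  also have "\<dots> = 2 * K * ((A * t) / (a' * t)) powr lam * t"
    using a a' t by (simp add: powr_divide powr_mult)
  also have "(A * t) / (a' * t) = A / a'" using t by simp
  finally show ?thesis by (simp add: a'_def)
qed

lemma quot_cont:
  assumes v: "continuous_on {0..T} v" shows "continuous_on {0..T} (quot v)"
proof (rule continuous_on_linear_at_0)
  have n: "continuous_on {0..T} (net (trunc v))"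
    by (rule net_cont_aux[OF trunc_cont[OF v]]) (auto intro: trunc_range)
  show "continuous_on {0<..T} (quot v)"
    unfolding quot_def
    using trunc_pos[of _ v]
    by (intro continuous_on_divide continuous_on_subset[OF n] continuous_on_subset[OF trunc_cont[OF v]]) force+
  fix t assume t: "0 < t" "t \<le> T"
  have "quot v 0 = 0" by (simp add: quot_def net_def)
  thus "\<bar>quot v t - quot v 0\<bar> \<le> 2 * K * (A / min a (w / T)) powr lam * t"
    using quot_bound[OF continuous_on_subset[OF v] t] t by auto
qed

lemma trunc_diff:
  assumes C: "C \<ge> 0" "\<And>x y. x \<in> {min a (w / T)..A} \<Longrightarrow> y \<in> {min a (w / T)..A} \<Longrightarrow>
      \<bar>x powr lam - y powr lam\<bar> \<le> C * \<bar>x - y\<bar>"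
    and t: "0 < t" "t \<le> T"
  shows "\<bar>trunc (\<lambda>s. s * z1 s) t - trunc (\<lambda>s. s * z2 s) t\<bar> \<le> C * t powr lam * \<bar>z1 t - z2 t\<bar>"
proof -
  define X where "X z = clip t (t * z t) / t" for z :: "real \<Rightarrow> real"
  have X: "X z \<in> {min a (w / T)..A}" for z
    using clip_ge[OF t] clip_le[of t] t by (auto simp: X_def pos_le_divide_eq pos_divide_le_eq)
  have tr: "trunc (\<lambda>s. s * z s) t = t powr lam * X z powr lam" for z
    using t clip_nonneg[of t] by (simp add: trunc_def X_def powr_divide)
  have "\<bar>clip t (t * z1 t) - clip t (t * z2 t)\<bar> \<le> \<bar>t * z1 t - t * z2 t\<bar>" by (rule clip_nonexpansive)
  also have "\<dots> = t * \<bar>z1 t - z2 t\<bar>" using t by (simp add: abs_mult flip: right_diff_distrib)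
  finally have "\<bar>clip t (t * z1 t) - clip t (t * z2 t)\<bar> \<le> t * \<bar>z1 t - z2 t\<bar>" .
  moreover have "\<bar>X z1 - X z2\<bar> = \<bar>clip t (t * z1 t) - clip t (t * z2 t)\<bar> / t"
    using t by (simp add: X_def flip: diff_divide_distrib)
  ultimately have XX: "\<bar>X z1 - X z2\<bar> \<le> \<bar>z1 t - z2 t\<bar>" using t by (simp add: pos_divide_le_eq mult.commute)
  have "\<bar>X z1 powr lam - X z2 powr lam\<bar> \<le> C * \<bar>X z1 - X z2\<bar>" by (rule C(2)[OF X X])
  also have "\<dots> \<le> C * \<bar>z1 t - z2 t\<bar>" using XX C(1) by (rule mult_left_mono)
  finally have "t powr lam * \<bar>X z1 powr lam - X z2 powr lam\<bar>
      \<le> t powr lam * (C * \<bar>z1 t - z2 t\<bar>)" by (intro mult_left_mono) auto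
  thus ?thesis unfolding tr by (simp add: abs_mult mult_ac flip: right_diff_distrib)
qed

lemma quot_diff:
  assumes T: "T > 0"
  shows "\<exists>C\<ge>0. \<forall>z1 z2 M t. continuous_on {0..T} z1 \<longrightarrow> continuous_on {0..T} z2 \<longrightarrow> 0 < t \<longrightarrow> t \<le> T \<longrightarrow>
     (\<forall>s\<in>{0..t}. \<bar>z1 s - z2 s\<bar> \<le> M) \<longrightarrow> \<bar>quot (\<lambda>s. s * z1 s) t - quot (\<lambda>s. s * z2 s) t\<bar> \<le> C * t * M"
proof -
  define a' where "a' = min a (w / T)"
  have a': "a' > 0" using a w T by (simp add: a'_def)
  define l where "l = lam"
  have l: "l > 0" using lam_pos by (simp add: l_def)
  obtain C where C: "C \<ge> 0" "\<And>x y. x \<in> {a'..A} \<Longrightarrow> y \<in> {a'..A} \<Longrightarrow> \<bar>x powr l - y powr l\<bar> \<le> C * \<bar>x - y\<bar>"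
    using powr_lipschitz[OF a', of A l] by blast
  define C2 where "C2 = 2 * K * C / a' powr l + 2 * K * A powr l * C / (a' powr l * a' powr l)"
  have "\<bar>quot (\<lambda>s. s * z1 s) t - quot (\<lambda>s. s * z2 s) t\<bar> \<le> C2 * t * M"
    if z1: "continuous_on {0..T} z1" and z2: "continuous_on {0..T} z2" and t: "0 < t" "t \<le> T"
      and M: "\<And>s. s \<in> {0..t} \<Longrightarrow> \<bar>z1 s - z2 s\<bar> \<le> M" for z1 z2 M t
  proof -
    define f1 where "f1 = trunc (\<lambda>s. s * z1 s)"
    define f2 where "f2 = trunc (\<lambda>s. s * z2 s)"
    have M0: "M \<ge> 0" using M[of 0] t by auto
    have v: "continuous_on {0..t} (\<lambda>s. s * z1 s)" "continuous_on {0..t} (\<lambda>s. s * z2 s)"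
      using t by (auto intro!: continuous_on_mult continuous_on_id
          continuous_on_subset[OF z1] continuous_on_subset[OF z2])
    have df: "\<bar>f1 s - f2 s\<bar> \<le> C * t powr l * M" if "s \<le> t" for s
    proof (cases "s > 0")
      case True
      have "\<bar>f1 s - f2 s\<bar> \<le> C * s powr l * \<bar>z1 s - z2 s\<bar>"
        unfolding f1_def f2_def l_def using True that t C by (intro trunc_diff[of C T]) (auto simp: a'_def l_def)
      also have "\<dots> \<le> C * t powr l * M"
        using True that C(1) l M[of s] by (intro mult_mono powr_mono2) auto
      finally show ?thesis .
    next
      case False thus ?thesis using C(1) M0 by (simp add: f1_def f2_def trunc_def)
    qed
    have range: "f1 s \<in> {0..S}" "f2 s \<in> {0..S}" for s using trunc_range by (auto simp: f1_def f2_def)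
    have dr: "\<bar>rate f1 s - rate f2 s\<bar> \<le> 2 * K * (C * t powr l * M)" if s: "s \<in> {0..t}" for s
    proof -
      have "\<bar>d (f1 s) - d (f2 s)\<bar> \<le> K * \<bar>f1 s - f2 s\<bar>"
        "\<bar>b (f1 (s - r)) - b (f2 (s - r))\<bar> \<le> K * \<bar>f1 (s - r) - f2 (s - r)\<bar>"
        by (intro d_lip b_lip range)+
      moreover have "K * \<bar>f1 s - f2 s\<bar> \<le> K * (C * t powr l * M)"
        "K * \<bar>f1 (s - r) - f2 (s - r)\<bar> \<le> K * (C * t powr l * M)"
        using K s r by (intro mult_left_mono df; simp)+
      ultimately show ?thesis unfolding rate_def by simp
    qed
    have cr: "continuous_on {0..t} (rate f1)" "continuous_on {0..t} (rate f2)"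
      unfolding f1_def f2_def by (intro rate_trunc_cont v)+
    have "net f1 t - net f2 t = integral {0..t} (\<lambda>s. rate f1 s - rate f2 s)"
      unfolding net_def using cr by (intro integral_diff[symmetric] integrable_continuous_interval)
    hence dn: "\<bar>net f1 t - net f2 t\<bar> \<le> 2 * K * (C * t powr l * M) * t"
      using integral_bound[OF _ continuous_on_diff[OF cr], of "2 * K * (C * t powr l * M)"] dr t by auto
    have lo: "a' powr l * t powr l \<le> f1 t" "a' powr l * t powr l \<le> f2 t"
      using trunc_ge[OF t] a' t by (simp_all add: f1_def f2_def a'_def l_def powr_mult)
    have lo0: "a' powr l * t powr l > 0" using a' t by simp
    have n2: "\<bar>net f2 t\<bar> \<le> 2 * K * (A powr l * t powr l) * t"
      using net_bound[OF v(2)] t a by (simp add: f2_def l_def powr_mult)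
    have f0: "f1 t > 0" "f2 t > 0" using lo lo0 by linarith+
    have split: "net f1 t / f1 t - net f2 t / f2 t = (net f1 t - net f2 t) / f1 t + net f2 t * (f2 t - f1 t) / (f1 t * f2 t)"
      using f0 by (simp add: field_simps)
    have "\<bar>(net f1 t - net f2 t) / f1 t\<bar> \<le> (2 * K * (C * t powr l * M) * t) / (a' powr l * t powr l)"
    proof -
      have "0 \<le> 2 * K * (C * t powr l * M) * t" using K C(1) M0 t
        by (intro mult_nonneg_nonneg) auto
      from frac_le[OF this dn lo0 lo(1)] show ?thesis using f0 by (simp only: abs_divide abs_of_pos)
    qed
    also have "\<dots> = 2 * K * C / a' powr l * t * M" using t by simp
    finally have first: "\<bar>(net f1 t - net f2 t) / f1 t\<bar> \<le> 2 * K * C / a' powr l * t * M" .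
    have "\<bar>net f2 t * (f2 t - f1 t) / (f1 t * f2 t)\<bar> \<le>
        ((2 * K * (A powr l * t powr l) * t) * (C * t powr l * M)) / ((a' powr l * t powr l) * (a' powr l * t powr l))"
    proof -
      have num: "\<bar>net f2 t\<bar> * \<bar>f2 t - f1 t\<bar> \<le> (2 * K * (A powr l * t powr l) * t) * (C * t powr l * M)"
        using n2 df[of t] K t by (intro mult_mono) (auto simp: abs_minus_commute)
      have den: "(a' powr l * t powr l) * (a' powr l * t powr l) \<le> f1 t * f2 t"
        using lo lo0 f0 by (intro mult_mono) auto
      have nn: "0 \<le> (2 * K * (A powr l * t powr l) * t) * (C * t powr l * M)" using K C(1) M0 t a
        by (intro mult_nonneg_nonneg) auto
      have "0 < (a' powr l * t powr l) * (a' powr l * t powr l)" using lo0 by simp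
      from frac_le[OF nn num this den] show ?thesis using f0 by (simp only: abs_divide abs_mult abs_of_pos)
    qed
    also have "\<dots> = 2 * K * A powr l * C / (a' powr l * a' powr l) * t * M"
    proof -
      define x where "x = t powr l"
      define y where "y = a' powr l"
      have "x > 0" "y > 0" using t a' by (auto simp: x_def y_def)
      thus ?thesis unfolding x_def[symmetric] y_def[symmetric] by (simp add: field_simps)
    qed
    finally have "\<bar>net f1 t / f1 t - net f2 t / f2 t\<bar> \<le> 2 * K * C / a' powr l * t * M
        + 2 * K * A powr l * C / (a' powr l * a' powr l) * t * M"
      unfolding split using first by linarith
    also have "\<dots> = C2 * t * M" by (simp only: C2_def distrib_right)
    finally show ?thesis by (simp only: quot_def f1_def f2_def)
  qed
  moreover have "C2 \<ge> 0" using K C(1) by (simp add: C2_def)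
  ultimately show ?thesis by blast
qed

definition Psi :: "(real \<Rightarrow> real) \<Rightarrow> real \<Rightarrow> real" where
  "Psi z t = 1 + 1 / t * integral {0..t} (quot (\<lambda>s. s * z s))"

lemma scaled_cont:
  assumes "continuous_on {0..T} z" "t \<le> T" shows "continuous_on {0..t} (\<lambda>s::real. s * z s :: real)"
  using assms(2) by (intro continuous_on_mult continuous_on_id continuous_on_subset[OF assms(1)]) auto

lemma integral_quot_bound:
  assumes z: "continuous_on {0..T} z" and t: "0 \<le> t" "t \<le> T"
  shows "\<bar>1 / t * integral {0..t} (quot (\<lambda>s. s * z s))\<bar> \<le> 2 * K * (A / min a (w / T)) powr lam * t"
proof (cases "t = 0")
  case False
  define C where "C = 2 * K * (A / min a (w / T)) powr lam"
  have C: "C \<ge> 0" using K by (simp add: C_def)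
  have qb: "\<bar>quot (\<lambda>s. s * z s) s\<bar> \<le> C * t" if "s \<in> {0..t}" for s
  proof (cases "s = 0")
    case False
    have "\<bar>quot (\<lambda>s. s * z s) s\<bar> \<le> C * s"
      unfolding C_def using False that t by (intro quot_bound scaled_cont[OF z]) auto
    also have "\<dots> \<le> C * t" using that C by (intro mult_left_mono) auto
    finally show ?thesis .
  qed (use C t in \<open>simp add: quot_def net_def\<close>)
  have "\<bar>integral {0..t} (quot (\<lambda>s. s * z s))\<bar> \<le> C * t * (t - 0)"
    using integral_bound[OF t(1) quot_cont[OF scaled_cont[OF z t(2)]], of "C * t"] qb by simp
  thus ?thesis using False t by (simp add: C_def abs_mult field_simps)
qed simp

lemma Psi_bound:
  assumes z: "continuous_on {0..T} z" and t: "t \<in> {0..T}"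
  shows "\<bar>Psi z t\<bar> \<le> 1 + 2 * K * (A / min a (w / T)) powr lam * T"
proof -
  have "2 * K * (A / min a (w / T)) powr lam * t \<le> 2 * K * (A / min a (w / T)) powr lam * T"
    using K t by (intro mult_left_mono) auto
  moreover have "\<bar>1 / t * integral {0..t} (quot (\<lambda>s. s * z s))\<bar> \<le> 2 * K * (A / min a (w / T)) powr lam * t"
    using t by (intro integral_quot_bound[OF z]) auto
  ultimately show ?thesis unfolding Psi_def by linarith
qed

lemma Psi_cont:
  assumes z: "continuous_on {0..T} z" shows "continuous_on {0..T} (Psi z)"
proof (rule continuous_on_linear_at_0)
  have "continuous_on {0..T} (\<lambda>t. integral {0..t} (quot (\<lambda>s. s * z s)))"
    using quot_cont[OF scaled_cont[OF z order_refl]]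
    by (intro indefinite_integral_continuous_1 integrable_continuous_interval)
  hence "continuous_on {0<..T} (\<lambda>t. integral {0..t} (quot (\<lambda>s. s * z s)))"
    by (rule continuous_on_subset) auto
  thus "continuous_on {0<..T} (Psi z)" unfolding Psi_def by (intro continuous_intros) auto
  fix t assume "0 < t" "t \<le> T"
  thus "\<bar>Psi z t - Psi z 0\<bar> \<le> 2 * K * (A / min a (w / T)) powr lam * t"
    using integral_quot_bound[OF z, of t] by (simp add: Psi_def)
qed

lemma Psi_volterra: assumes T: "T > 0" shows "\<exists>C\<ge>0. volterra_bound Psi T C"
proof -
  obtain C where C: "C \<ge> 0" and D: "\<forall>z1 z2 M t. continuous_on {0..T} z1 \<longrightarrow> continuous_on {0..T} z2 \<longrightarrow>
     0 < t \<longrightarrow> t \<le> T \<longrightarrow> (\<forall>s\<in>{0..t}. \<bar>z1 s - z2 s\<bar> \<le> M) \<longrightarrow>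
     \<bar>quot (\<lambda>s. s * z1 s) t - quot (\<lambda>s. s * z2 s) t\<bar> \<le> C * t * M"
    using quot_diff[OF T] by blast
  have "volterra_bound Psi T C"
    unfolding volterra_bound_def
  proof (intro allI impI ballI)
    fix z1 z2 N k t
    assume z1: "continuous_on {0..T} z1" and z2: "continuous_on {0..T} z2" and N: "0 \<le> (N::real)" and k: "1 \<le> (k::real)"
      and le: "\<forall>t\<in>{0..T}. \<bar>z1 t - z2 t\<bar> \<le> N * exp (k * t)" and t: "t \<in> {0..T}"
    show "\<bar>Psi z1 t - Psi z2 t\<bar> \<le> C / k * N * exp (k * t)"
    proof (cases "t = 0")
      case True
      thus ?thesis using C N k by (simp add: Psi_def)
    next
      case False
      hence t0: "0 < t" using t by simp
      let ?q1 = "quot (\<lambda>s. s * z1 s)" and ?q2 = "quot (\<lambda>s. s * z2 s)"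
      have int: "?q1 integrable_on {0..t}" "?q2 integrable_on {0..t}"
        using t by (auto intro!: integrable_continuous_interval quot_cont scaled_cont[OF z1] scaled_cont[OF z2])
      have "((\<lambda>s. C * t * N * exp (k * s)) has_integral
          (C * t * N * exp (k * t) / k - C * t * N * exp (k * 0) / k)) {0..t}"
        using t0 k by (intro fundamental_theorem_of_calculus)
          (auto intro!: derivative_eq_intros simp flip: has_real_derivative_iff_has_vector_derivative)
      hence E: "((\<lambda>s. C * t * N * exp (k * s)) has_integral (C * t * N * (exp (k * t) - 1) / k)) {0..t}"
        by (simp add: right_diff_distrib diff_divide_distrib)
      have "norm (integral {0..t} (\<lambda>s. ?q1 s - ?q2 s)) \<le> integral {0..t} (\<lambda>s. C * t * N * exp (k * s))"
      proof (rule integral_norm_bound_integral)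
        show "(\<lambda>s. ?q1 s - ?q2 s) integrable_on {0..t}" using int by (rule integrable_diff)
        show "(\<lambda>s. C * t * N * exp (k * s)) integrable_on {0..t}" using E by blast
        fix s assume s: "s \<in> {0..t}"
        show "norm (?q1 s - ?q2 s) \<le> C * t * N * exp (k * s)"
        proof (cases "s = 0")
          case True thus ?thesis using C N t0 by (simp add: quot_def net_def)
        next
          case False
          have "\<bar>z1 u - z2 u\<bar> \<le> N * exp (k * s)" if "u \<in> {0..s}" for u
          proof -
            have "\<bar>z1 u - z2 u\<bar> \<le> N * exp (k * u)" using le that s t by auto
            also have "\<dots> \<le> N * exp (k * s)" using that N k by (intro mult_left_mono) auto
            finally show ?thesis .
          qed
          hence "\<bar>?q1 s - ?q2 s\<bar> \<le> C * s * (N * exp (k * s))"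
            using D z1 z2 s t False by auto
          also have "\<dots> \<le> C * t * (N * exp (k * s))" using s C N by (intro mult_right_mono mult_left_mono) auto
          finally show ?thesis by (simp add: mult.assoc)
        qed
      qed
      hence "\<bar>integral {0..t} ?q1 - integral {0..t} ?q2\<bar> \<le> C * t * N * (exp (k * t) - 1) / k"
        using integral_unique[OF E] integral_diff[OF int] by simp
      moreover have "Psi z1 t - Psi z2 t = 1 / t * (integral {0..t} ?q1 - integral {0..t} ?q2)"
        by (simp add: Psi_def right_diff_distrib)
      ultimately have "\<bar>Psi z1 t - Psi z2 t\<bar> \<le> 1 / t * (C * t * N * (exp (k * t) - 1) / k)"
        using t0 by (simp only: abs_mult) (intro mult_mono, auto)
      also have "\<dots> = C / k * N * (exp (k * t) - 1)" using t0 by simp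
      also have "\<dots> \<le> C / k * N * exp (k * t)" using C N k by (intro mult_left_mono) auto
      finally show ?thesis .
    qed
  qed
  with C show ?thesis by blast
qed

theorem clip_flow:
  "\<exists>v. (\<forall>q\<ge>0. continuous_on {0..} (v q) \<and> v q 0 = 0 \<and>
        (\<forall>t>0. (v q has_real_derivative q * (1 + quot (v q) t)) (at t))) \<and>
      (\<forall>T>0. \<forall>Q\<ge>0. \<exists>C\<ge>0. \<forall>q\<in>{0..Q}. \<forall>q'\<in>{0..Q}. \<forall>t\<in>{0..T}. \<bar>v q t - v q' t\<bar> \<le> C * \<bar>q - q'\<bar>)"
proof -
  have "\<forall>q. \<exists>z. q \<ge> 0 \<longrightarrow> continuous_on {0..} z \<and> (\<forall>t\<ge>0. z t = q * Psi z t)"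
    using volterra_fixpoint[OF Psi_cont Psi_volterra] by blast
  from choice[OF this] obtain z where z: "\<And>q. q \<ge> 0 \<Longrightarrow> continuous_on {0..} (z q)"
    "\<And>q t. q \<ge> 0 \<Longrightarrow> t \<ge> 0 \<Longrightarrow> z q t = q * Psi (z q) t" by blast
  define v where "v q t = t * z q t" for q t :: real
  have zT: "continuous_on {0..T} (z q)" if "q \<ge> 0" for q T
    using z(1)[OF that] by (rule continuous_on_subset) auto
  have "continuous_on {0..} (v q)" if "q \<ge> 0" for q
    unfolding v_def by (intro continuous_intros z(1) that)
  moreover have "v q 0 = 0" for q by (simp add: v_def)
  moreover have "(v q has_real_derivative q * (1 + quot (v q) t)) (at t)" if q: "q \<ge> 0" and t: "t > 0" for q t
  proof -
    have veq: "v q s = q * (s + integral {0..s} (quot (v q)))" if "s > 0" for s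
      using z(2)[OF q, of s] that by (simp add: v_def[abs_def] Psi_def field_simps)
    have "continuous_on {0..t+1} (quot (v q))"
      unfolding v_def[abs_def] using zT[OF q] by (intro quot_cont scaled_cont) auto
    hence "((\<lambda>s. integral {0..s} (quot (v q))) has_real_derivative quot (v q) t) (at t within {0..t+1})"
      using t by (intro integral_has_real_derivative) auto
    moreover have "at t within {0..t+1} = at t" using t by (intro at_within_interior) (auto simp: interior_atLeastAtMost_real)
    ultimately have "((\<lambda>s. q * (s + integral {0..s} (quot (v q)))) has_real_derivative q * (1 + quot (v q) t)) (at t)"
      by (auto intro!: derivative_eq_intros)
    moreover have "\<forall>\<^sub>F s in nhds t. q * (s + integral {0..s} (quot (v q))) = v q s"
      using eventually_nhds_in_open[of "{0<..}" t] t by (auto elim!: eventually_mono simp: veq)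
    ultimately show ?thesis by (subst (asm) DERIV_cong_ev) auto
  qed
  moreover have "\<exists>C\<ge>0. \<forall>q\<in>{0..Q}. \<forall>q'\<in>{0..Q}. \<forall>t\<in>{0..T}. \<bar>v q t - v q' t\<bar> \<le> C * \<bar>q - q'\<bar>"
    if T: "T > 0" and Q: "Q \<ge> 0" for T Q
  proof -
    obtain C where C: "C \<ge> 0" "volterra_bound Psi T C" using Psi_volterra[OF T] by auto
    define B where "B = 1 + 2 * K * (A / min a (w / T)) powr lam * T"
    define C' where "C' = 2 * B * exp ((1 + 2 * Q * C) * T)"
    have B: "B \<ge> 0" using K T by (simp add: B_def)
    have "\<bar>v q t - v q' t\<bar> \<le> T * C' * \<bar>q - q'\<bar>" if q: "q \<in> {0..Q}" "q' \<in> {0..Q}" and t: "t \<in> {0..T}" for q q' t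
    proof -
      have "\<bar>z q t - z q' t\<bar> \<le> C' * \<bar>q - q'\<bar>" unfolding C'_def
      proof (rule volterra_fixpoint_dependence[OF C(2,1) T q zT _ zT _ _ t])
        show "\<And>s. s \<in> {0..T} \<Longrightarrow> z q s = q * Psi (z q) s" using q z(2) by auto
        show "\<And>s. s \<in> {0..T} \<Longrightarrow> z q' s = q' * Psi (z q') s" using q z(2) by auto
        show "\<And>s. s \<in> {0..T} \<Longrightarrow> \<bar>Psi (z q') s\<bar> \<le> B" unfolding B_def using q by (intro Psi_bound zT) auto
      qed (use q in auto)
      hence "t * \<bar>z q t - z q' t\<bar> \<le> T * (C' * \<bar>q - q'\<bar>)"
        using t T by (intro mult_mono) auto
      moreover have "\<bar>v q t - v q' t\<bar> = t * \<bar>z q t - z q' t\<bar>"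
        using t by (simp add: v_def abs_mult flip: right_diff_distrib)
      ultimately show ?thesis by simp
    qed
    moreover have "T * C' \<ge> 0" using T B by (simp add: C'_def)
    ultimately show ?thesis by blast
  qed
  ultimately show ?thesis by (intro exI[of _ v]) blast
qed

lemma b_nonneg: "0 \<le> x \<Longrightarrow> 0 \<le> b x"
  using b_pos[of x] b0 by (cases "x = 0") auto

context
  fixes q v
  assumes q: "q > 0" and v_cont: "continuous_on {0..} v" and v0: "v 0 = 0"
    and v_deriv: "\<And>t. t > 0 \<Longrightarrow> (v has_real_derivative q * (1 + quot v t)) (at t)"
begin

lemma v_cont_on: "0 \<le> x \<Longrightarrow> continuous_on {x..y} v"
  by (rule continuous_on_subset[OF v_cont]) auto

lemma trunc_cont_UNIV: "continuous_on X (trunc v)"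
proof -
  have "continuous (at t) (trunc v)" for t
    using trunc_cont[OF v_cont_on[OF order_refl], of "t + 1"]
    by (intro continuous_on_interior[of "{..t + 1}"]) auto
  thus ?thesis by (auto simp: continuous_on_eq_continuous_at intro: continuous_at_imp_continuous_on)
qed

lemma flux_trunc: "t > 0 \<Longrightarrow> flux (trunc v) t = trunc v t * (1 + quot v t)"
  using trunc_pos[of t v] by (simp add: flux_def quot_def field_simps)

lemma flux_trunc_sign: assumes "t > 0"
  shows "flux (trunc v) t < 0 \<longleftrightarrow> 1 + quot v t < 0" "flux (trunc v) t > 0 \<longleftrightarrow> 1 + quot v t > 0"
    "flux (trunc v) t \<ge> 0 \<longleftrightarrow> 1 + quot v t \<ge> 0"
  using trunc_pos[OF assms, of v]
  by (auto simp: flux_trunc[OF assms] mult_less_0_iff zero_less_mult_iff zero_le_mult_iff)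

lemma v_mono:
  assumes "\<And>t. x < t \<Longrightarrow> t < y \<Longrightarrow> 1 + quot v t \<ge> 0" "0 \<le> x" "x \<le> y" shows "v x \<le> v y"
proof (rule DERIV_nonneg_imp_increasing_open[OF assms(3)])
  fix t assume t: "x < t" "t < y"
  thus "\<exists>y. DERIV v t :> y \<and> 0 \<le> y"
    using v_deriv[of t] assms q by (intro exI[of _ "q * (1 + quot v t)"]) auto
qed (use v_cont_on assms in auto)

lemma trunc_mono:
  assumes "\<And>t. 0 < t \<Longrightarrow> t < s \<Longrightarrow> 1 + quot v t \<ge> 0" "x \<le> y" "y \<le> s"
  shows "trunc v x \<le> trunc v y"
proof (cases "x \<le> 0")
  case True thus ?thesis using trunc_range(1)[of v y] by (simp add: trunc_def)
next
  case False
  have "v x \<le> v y" using assms False by (intro v_mono) auto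
  hence "clip x (v x) \<le> clip y (v y)" using False assms by (intro clip_mono) auto
  thus ?thesis using False assms clip_nonneg[of x "v x"] m by (auto simp: trunc_def intro!: powr_mono2)
qed

lemma rate_trunc_integrable: "0 \<le> x \<Longrightarrow> rate (trunc v) integrable_on {x..y}"
  by (rule integrable_continuous_interval, rule continuous_on_subset[OF rate_trunc_cont[of y v]])
    (auto intro: v_cont_on)

lemma birth_le: "b (trunc v u) \<le> K * trunc v u"
  using b_lip[of "trunc v u" 0] trunc_range[of v u] S_pos b0 by auto

lemma death_le: "d (trunc v u) \<le> K * trunc v u"
  using d_lip[of "trunc v u" 0] trunc_range[of v u] S_pos d0 by auto

lemma death_nonneg: "0 \<le> d (trunc v u)"
  using d_le[of 0 "trunc v u"] trunc_range[of v u] d0 by auto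

lemma quot_lower:
  assumes mono: "\<And>t. 0 < t \<Longrightarrow> t < s \<Longrightarrow> 1 + quot v t \<ge> 0" and s: "s > 0"
  shows "quot v s \<ge> - K * max 0 (s - r)"
proof -
  let ?f = "trunc v"
  define x where "x = min r s"
  have x: "0 \<le> x" "x \<le> s" using r s by (auto simp: x_def)
  have "0 \<le> rate ?f u" if "u \<in> {0..x}" for u
  proof -
    have "?f (u - r) = 0" using that by (simp add: trunc_def x_def)
    thus ?thesis using death_nonneg[of u] by (simp add: rate_def b0)
  qed
  hence 1: "0 \<le> integral {0..x} (rate ?f)" by (intro integral_nonneg rate_trunc_integrable) auto
  have "- (K * ?f s) \<le> rate ?f u" if "u \<in> {x..s}" for u
  proof -
    have "?f (u - r) \<le> ?f s" using mono by (rule trunc_mono) (use that r in auto)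
    hence "K * ?f (u - r) \<le> K * ?f s" using K by simp
    thus ?thesis using death_nonneg[of u] birth_le[of "u - r"] by (simp add: rate_def)
  qed
  hence "integral {x..s} (\<lambda>_. - (K * ?f s)) \<le> integral {x..s} (rate ?f)"
    using x by (intro integral_le rate_trunc_integrable) auto
  hence 2: "- (K * ?f s) * (s - x) \<le> integral {x..s} (rate ?f)" using x by (simp add: mult_ac)
  have "net ?f s = integral {0..x} (rate ?f) + integral {x..s} (rate ?f)"
    unfolding net_def
    by (rule Henstock_Kurzweil_Integration.integral_combine[symmetric, OF x rate_trunc_integrable[OF order_refl]])
  hence "net ?f s \<ge> - (K * ?f s) * (s - x)" using 1 2 by simp
  moreover have "s - x = max 0 (s - r)" by (simp add: x_def)
  ultimately have "net ?f s \<ge> (- K * max 0 (s - r)) * ?f s" by (simp add: mult_ac)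
  thus ?thesis using trunc_pos[OF s, of v] by (simp add: quot_def pos_le_divide_eq)
qed

lemma quot_upper:
  assumes mono: "\<And>t. 0 < t \<Longrightarrow> t < s \<Longrightarrow> 1 + quot v t \<ge> 0" and s: "s > 0"
  shows "quot v s \<le> K * s"
proof -
  let ?f = "trunc v"
  have "rate ?f u \<le> K * ?f s" if "u \<in> {0..s}" for u
  proof -
    have "?f u \<le> ?f s" using mono by (rule trunc_mono) (use that in auto)
    hence "K * ?f u \<le> K * ?f s" using K by simp
    thus ?thesis using death_le[of u] b_nonneg[of "?f (u - r)"] trunc_range(1)[of v "u - r"]
      by (simp add: rate_def)
  qed
  hence "integral {0..s} (rate ?f) \<le> integral {0..s} (\<lambda>_. K * ?f s)"
    using s by (intro integral_le rate_trunc_integrable) auto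
  hence "net ?f s \<le> K * s * ?f s" using s by (simp add: net_def mult_ac)
  thus ?thesis using trunc_pos[OF s, of v] by (simp add: quot_def pos_divide_le_eq)
qed

lemma v_upper:
  assumes mono: "\<And>t. 0 < t \<Longrightarrow> t < s \<Longrightarrow> 1 + quot v t \<ge> 0" and s: "s > 0"
  shows "v s \<le> q * (1 + K * s) * s"
proof -
  have "v s - q * (1 + K * s) * s \<le> v 0 - q * (1 + K * s) * 0"
  proof (rule DERIV_nonpos_imp_decreasing_open[of 0 s "\<lambda>t. v t - q * (1 + K * s) * t"])
    fix t assume t: "0 < t" "t < s"
    have "quot v t \<le> K * t" using mono t by (intro quot_upper) auto
    also have "\<dots> \<le> K * s" using K t by simp
    finally have "q * (1 + quot v t) - q * (1 + K * s) \<le> 0" using q by simp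
    moreover have "DERIV (\<lambda>t. v t - q * (1 + K * s) * t) t :> q * (1 + quot v t) - q * (1 + K * s)"
      using t by (auto intro!: derivative_eq_intros v_deriv)
    ultimately show "\<exists>y. DERIV (\<lambda>t. v t - q * (1 + K * s) * t) t :> y \<and> y \<le> 0" by blast
  qed (use s in \<open>auto intro!: continuous_intros v_cont_on\<close>)
  thus ?thesis by (simp add: v0)
qed

lemma quot_early:
  assumes s: "0 < s" "s \<le> warmup + r" shows "1 + quot v s \<ge> 1 / 2"
proof -
  have half: "1 + quot v x \<ge> 1 / 2"
    if x: "0 < x" "x \<le> warmup + r" and pos: "\<And>t. 0 < t \<Longrightarrow> t < x \<Longrightarrow> 1 + quot v t \<ge> 0" for x
  proof -
    have "K * max 0 (x - r) \<le> K * warmup" using x K by (intro mult_left_mono) auto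
    also have "\<dots> = 1 / 2" using K by simp
    finally show ?thesis using quot_lower[OF pos x(1)] by auto
  qed
  have pos: "1 + quot v x > 0" if x: "0 < x" "x \<le> warmup + r" for x
  proof (rule ccontr)
    assume n: "\<not> 1 + quot v x > 0"
    have "continuous_on {0..x} (\<lambda>t. 1 + quot v t)"
      by (intro continuous_intros quot_cont v_cont_on) auto
    then obtain y where y: "0 < y" "y \<le> x" "1 + quot v y = 0" "\<And>t. 0 \<le> t \<Longrightarrow> t < y \<Longrightarrow> 1 + quot v t > 0"
      by (rule first_zero[OF less_imp_le[OF x(1)]]) (use n in \<open>auto simp: quot_def net_def\<close>)
    have "1 + quot v y \<ge> 1 / 2" using y x by (intro half) (auto intro: less_imp_le)
    thus False using y(3) by simp
  qed
  show ?thesis using s by (intro half less_imp_le[OF pos]) auto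
qed

lemma v_lower:
  assumes s: "0 \<le> s" "s \<le> warmup + r" shows "v s \<ge> q / 2 * s"
proof -
  have "v 0 - q / 2 * 0 \<le> v s - q / 2 * s"
  proof (rule DERIV_nonneg_imp_increasing_open[OF s(1)])
    fix t assume t: "0 < t" "t < s"
    have "q * (1 / 2) \<le> q * (1 + quot v t)" using quot_early[of t] t s q by (intro mult_left_mono) auto
    moreover have "DERIV (\<lambda>t. v t - q / 2 * t) t :> q * (1 + quot v t) - q / 2"
      using t by (auto intro!: derivative_eq_intros v_deriv)
    ultimately show "\<exists>y. DERIV (\<lambda>t. v t - q / 2 * t) t :> y \<and> 0 \<le> y" by fastforce
  qed (auto intro!: continuous_intros v_cont_on)
  thus ?thesis by (simp add: v0)
qed

lemma v_early_bounds:
  assumes s: "0 < s" "s \<le> warmup" shows "\<bar>v s - q * s\<bar> \<le> q * K * s\<^sup>2"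
proof -
  have e: "1 + quot v t \<ge> 0" if "0 < t" "t < s" for t using quot_early[of t] that s r by simp
  have up: "v s \<le> q * (1 + K * s) * s" by (rule v_upper[OF e s(1)])
  have "v 0 - q * (1 - K * s) * 0 \<le> v s - q * (1 - K * s) * s"
  proof (rule DERIV_nonneg_imp_increasing_open[OF less_imp_le[OF s(1)]])
    fix t assume t: "0 < t" "t < s"
    have "quot v t \<ge> - K * max 0 (t - r)" using e t by (intro quot_lower) auto
    moreover have "K * max 0 (t - r) \<le> K * s" using K t r by (intro mult_left_mono) auto
    ultimately have "q * (1 - K * s) \<le> q * (1 + quot v t)" using q by (intro mult_left_mono) auto
    moreover have "DERIV (\<lambda>t. v t - q * (1 - K * s) * t) t :> q * (1 + quot v t) - q * (1 - K * s)"
      using t by (auto intro!: derivative_eq_intros v_deriv)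
    ultimately show "\<exists>y. DERIV (\<lambda>t. v t - q * (1 - K * s) * t) t :> y \<and> 0 \<le> y" by fastforce
  qed (auto intro!: continuous_intros v_cont_on)
  with up show ?thesis by (simp add: v0 abs_le_iff algebra_simps power2_eq_square)
qed

context
  fixes T
  assumes A: "q * (1 + K * warmup) \<le> A" "vmax \<le> A * warmup" and aq: "a \<le> q / 2"
    and hi: "\<And>t. 0 < t \<Longrightarrow> t \<le> T \<Longrightarrow> v t \<le> vmax"
    and lo: "\<And>t. warmup \<le> t \<Longrightarrow> t \<le> T \<Longrightarrow> w \<le> v t"
begin

lemma clip_inactive:
  assumes t: "0 < t" "t \<le> T" shows "clip t (v t) = v t"
proof (cases "t \<le> warmup")
  case True
  have e: "1 + quot v u \<ge> 0" if "0 < u" "u < t" for u using quot_early[of u] that True r by simp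
  show ?thesis
  proof (rule clip_exact)
    have "a * t \<le> q / 2 * t" using aq t by (intro mult_right_mono) auto
    moreover have "q / 2 * t \<le> v t" using True r t by (intro v_lower) auto
    ultimately show "min (a * t) w \<le> v t" by linarith
    have "v t \<le> q * (1 + K * t) * t" by (rule v_upper[OF e t(1)])
    also have "\<dots> \<le> q * (1 + K * warmup) * t"
      using True K t q by (intro mult_right_mono mult_left_mono add_left_mono) auto
    also have "\<dots> \<le> A * t" using A(1) t by (intro mult_right_mono) auto
    finally show "v t \<le> A * t" .
  qed (use hi t in auto)
next
  case False
  have "A > 0" using a by simp
  hence "A * warmup \<le> A * t" using False by (intro mult_left_mono) auto
  thus ?thesis using A(2) hi[OF t] lo[of t] False t by (intro clip_exact) auto
qed

lemma trunc_profile: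
  shows "profile q T (trunc v)"
    and "\<And>t. 0 < t \<Longrightarrow> t \<le> T \<Longrightarrow> v t > 0 \<and> trunc v t = v t powr lam \<and> trunc v t powr (m - 1) = v t"
proof -
  show *: "v t > 0 \<and> trunc v t = v t powr lam \<and> trunc v t powr (m - 1) = v t"
    if "0 < t" "t \<le> T" for t
  proof -
    have c: "clip t (v t) = v t" using clip_inactive[OF that] by simp
    hence "v t > 0" using clip_pos[of t "v t"] that by simp
    thus ?thesis using c that m by (simp add: trunc_def powr_powr)
  qed
  show "profile q T (trunc v)" unfolding profile_def
  proof (intro conjI ballI allI impI)
    fix t assume t: "t \<in> {0<..<T}"
    have eq: "v s = trunc v s powr (m - 1)" if "s \<in> {0<..<T}" for s using *[of s] that
      by (elim greaterThanLessThan_iff[THEN iffD1, elim_format] conjE) (metis less_imp_le)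
    have "\<forall>\<^sub>F s in nhds t. v s = trunc v s powr (m - 1)"
      using eventually_nhds_in_open[OF _ t] by (auto elim!: eventually_mono intro: eq)
    moreover have "(v has_real_derivative q * (1 + net (trunc v) t / trunc v t)) (at t)"
      using v_deriv[of t] t by (simp add: quot_def)
    ultimately show "((\<lambda>t. trunc v t powr (m - 1)) has_real_derivative q * (1 + net (trunc v) t / trunc v t)) (at t)"
      by (subst (asm) DERIV_cong_ev) auto
  next
    fix t :: real assume "t \<le> 0" thus "trunc v t = 0" by (simp add: trunc_def)
  qed (use q trunc_cont_UNIV trunc_pos trunc_range in auto)
qed

end

end
end

section \<open>Slow profiles\<close>

lemma polynomial_less_geometric:
  fixes p \<rho> c C H :: real
  assumes "\<rho> > 1" "p > 0" "c > 0" "H > 0" "C > 0" "K > 0"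
  shows "\<exists>n::nat. (c + real n * H) * ((1 + K * (c + real n * H)) * (c + real n * H)) powr p < \<rho> ^ n * C"
proof -
  have "filterlim (\<lambda>n::nat. (c + real n * H) * ((1 + K * (c + real n * H)) * (c + real n * H)) powr p / (\<rho> powr real n * C)) (nhds 0) sequentially"
    using assms by real_asymp
  hence "eventually (\<lambda>n::nat. (c + real n * H) * ((1 + K * (c + real n * H)) * (c + real n * H)) powr p / (\<rho> powr real n * C) < 1) sequentially"
    by (rule order_tendstoD) simp
  then obtain n :: nat where "(c + real n * H) * ((1 + K * (c + real n * H)) * (c + real n * H)) powr p / (\<rho> powr real n * C) < 1"
    by (auto simp: eventually_sequentially)
  hence "(c + real n * H) * ((1 + K * (c + real n * H)) * (c + real n * H)) powr p < \<rho> ^ n * C"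
    using assms by (simp add: divide_less_eq powr_realpow)
  thus ?thesis by blast
qed

context delay_reaction
begin

context
  fixes f T \<sigma> \<delta> \<beta>
  assumes f: "continuous_on UNIV f" and mono: "\<And>x y. x \<le> y \<Longrightarrow> y \<le> T \<Longrightarrow> f x \<le> f y"
    and past: "\<And>t. t \<le> 0 \<Longrightarrow> f t = 0" and le: "\<And>t. t \<le> T \<Longrightarrow> f t \<le> \<sigma>" and \<sigma>: "\<sigma> \<le> S"
    and \<delta>\<beta>: "0 < \<delta>" "\<delta> < \<beta>" and lin: "\<And>x. x \<in> {0..\<sigma>} \<Longrightarrow> d x \<le> \<delta> * x \<and> \<beta> * x \<le> b x"
    and flux: "\<And>t. 0 < t \<Longrightarrow> t \<le> T \<Longrightarrow> flux f t \<ge> 0"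
begin

lemma delayed_growth:
  assumes x: "x > 0" "x + r + 2 / (\<beta> - \<delta>) \<le> T"
  shows "(2 + \<delta> * (2 / (\<beta> - \<delta>))) * integral {0..x} f
    \<le> (1 + \<delta> * (2 / (\<beta> - \<delta>))) * integral {0..x + r + 2 / (\<beta> - \<delta>)} f"
proof -
  define h where "h = 2 / (\<beta> - \<delta>)"
  have h: "h > 0" "h * \<beta> = 2 + \<delta> * h" using \<delta>\<beta> by (auto simp: h_def field_simps)
  define X where "X = x + r + h"
  have X: "X \<le> T" "x + r \<le> X" using x h by (auto simp: X_def h_def)
  have f0: "0 \<le> f t" if "t \<le> T" for t
    using mono[of "min t 0" t] past[of "min t 0"] that by simp
  have int: "f integrable_on {u..v}" for u v
    by (intro integrable_continuous_interval continuous_on_subset[OF f]) auto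
  have cs: "continuous_on {u..v} (\<lambda>s. f (s - r))" for u v
    by (intro continuous_on_compose2[OF f] continuous_intros) auto
  have Imono: "integral {0..u} f \<le> integral {0..v} f" if "u \<le> v" "v \<le> T" for u v
    using that by (intro integral_subset_le int) (auto intro: f0)
  have ft: "\<beta> * integral {0..x} f - \<delta> * integral {0..X} f \<le> f t" if t: "t \<in> {x + r..X}" for t
  proof -
    have t': "0 < t" "t \<le> T" using t x r X by auto
    have range: "0 \<le> f s \<and> f s \<le> S" if "s \<le> t" for s using f0[of s] le[of s] \<sigma> that t' by auto
    have "net f t \<le> integral {0..t} (\<lambda>s. \<delta> * f s - \<beta> * f (s - r))"
      unfolding net_def
    proof (rule integral_le)
      show "rate f integrable_on {0..t}"
        by (intro integrable_continuous_interval
            continuous_on_subset[OF rate_cont_aux[where T = t, OF continuous_on_subset[OF f] range]]) auto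
      show "(\<lambda>s. \<delta> * f s - \<beta> * f (s - r)) integrable_on {0..t}"
        by (intro integrable_continuous_interval continuous_intros cs continuous_on_subset[OF f]) auto
      fix s assume s: "s \<in> {0..t}"
      have "f s \<in> {0..\<sigma>}" "f (s - r) \<in> {0..\<sigma>}" using f0 le s t' r by auto
      from lin[OF this(1)] lin[OF this(2)] show "rate f s \<le> \<delta> * f s - \<beta> * f (s - r)"
        by (simp add: rate_def)
    qed
    also have "\<dots> = \<delta> * integral {0..t} f - \<beta> * integral {0..t} (\<lambda>s. f (s - r))"
      using int[of 0 t] integrable_continuous_interval[OF cs[of 0 t]]
      by (subst integral_diff) (auto intro: integrable_on_mult_right)
    finally have net: "net f t \<le> \<delta> * integral {0..t} f - \<beta> * integral {0..t} (\<lambda>s. f (s - r))" .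
    have "integral {0..t} (\<lambda>s. f (s - r)) = integral {- r..t - r} f"
      using integral_shift_Icc_real[of 0 t f "- r"] by (simp add: o_def)
    moreover have "integral {- r..t - r} f = integral {- r..0} f + integral {0..t - r} f"
      using r t x by (intro Henstock_Kurzweil_Integration.integral_combine[symmetric] int) auto
    moreover have "integral {- r..0} f = integral {- r..0} (\<lambda>_. 0)"
      using past by (intro integral_cong) auto
    ultimately have "net f t \<le> \<delta> * integral {0..t} f - \<beta> * integral {0..t - r} f" using net by simp
    moreover have "\<delta> * integral {0..t} f \<le> \<delta> * integral {0..X} f"
      using Imono[of t X] t X \<delta>\<beta> by auto
    moreover have "\<beta> * integral {0..x} f \<le> \<beta> * integral {0..t - r} f"
      using Imono[of x "t - r"] t t' r \<delta>\<beta> by auto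
    ultimately show ?thesis using flux[OF t'] by (simp add: flux_def)
  qed
  have "integral {x + r..X} (\<lambda>_. \<beta> * integral {0..x} f - \<delta> * integral {0..X} f) \<le> integral {x + r..X} f"
    using ft int by (intro integral_le) auto
  hence "h * (\<beta> * integral {0..x} f - \<delta> * integral {0..X} f) \<le> integral {x + r..X} f"
    using h by (simp add: X_def)
  moreover have "integral {0..X} f = integral {0..x + r} f + integral {x + r..X} f"
    using x r h by (intro Henstock_Kurzweil_Integration.integral_combine[symmetric] int) (auto simp: X_def)
  moreover have "integral {0..x + r} f \<ge> 0" using X by (intro integral_nonneg int f0) auto
  ultimately have "h * \<beta> * integral {0..x} f \<le> (1 + \<delta> * h) * integral {0..X} f"
    by (simp add: algebra_simps)
  thus ?thesis unfolding h(2) by (simp add: X_def h_def)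
qed

lemma delayed_growth_iterated:
  assumes x: "x > 0" "x + real n * (r + 2 / (\<beta> - \<delta>)) \<le> T"
    and \<rho>: "\<rho> = (2 + \<delta> * (2 / (\<beta> - \<delta>))) / (1 + \<delta> * (2 / (\<beta> - \<delta>)))"
  shows "\<rho> ^ n * integral {0..x} f \<le> integral {0..x + real n * (r + 2 / (\<beta> - \<delta>))} f"
  using x(2)
proof (induction n)
  case (Suc n)
  define h where "h = 2 / (\<beta> - \<delta>)"
  have h: "h > 0" using \<delta>\<beta> by (simp add: h_def)
  let ?y = "x + real n * (r + h)"
  have e: "x + real (Suc n) * (r + h) = ?y + r + h" by (simp add: algebra_simps)
  have le': "?y + r + h \<le> T" using Suc.prems e by (simp add: h_def)
  have "?y \<le> T" using le' r h by linarith
  hence "\<rho> ^ n * integral {0..x} f \<le> integral {0..?y} f" using Suc.IH by (simp add: h_def)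
  moreover have D: "1 + \<delta> * h > 0" using \<delta>\<beta> h by (simp add: add_pos_pos)
  moreover have "(2 + \<delta> * h) * integral {0..?y} f \<le> (1 + \<delta> * h) * integral {0..?y + r + h} f"
    unfolding h_def using x(1) r h le'
    by (intro delayed_growth) (auto simp: h_def add_pos_nonneg)
  hence "\<rho> * integral {0..?y} f \<le> integral {0..?y + r + h} f"
    using D by (simp add: \<rho> flip: h_def) (simp add: pos_divide_le_eq mult.commute)
  moreover have "\<rho> \<ge> 0" using \<delta>\<beta> h D by (simp add: \<rho> flip: h_def)
  ultimately have "\<rho> * (\<rho> ^ n * integral {0..x} f) \<le> integral {0..?y + r + h} f"
    by (meson mult_left_mono order.trans)
  thus ?case using e unfolding h_def by (simp only: power_Suc mult.assoc)
qed simp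

end

end

section \<open>Shooting\<close>

lemma clopen_interval_propagate:
  fixes P :: "real \<Rightarrow> bool"
  assumes "p \<le> q" and P: "\<And>x. x \<in> {p..q} \<Longrightarrow> P x \<Longrightarrow> \<exists>e>0. \<forall>y\<in>{p..q}. \<bar>y - x\<bar> < e \<longrightarrow> P y"
    and nP: "\<And>x. x \<in> {p..q} \<Longrightarrow> \<not> P x \<Longrightarrow> \<exists>e>0. \<forall>y\<in>{p..q}. \<bar>y - x\<bar> < e \<longrightarrow> \<not> P y"
    and "P q"
  shows "P p"
proof (rule ccontr)
  assume n: "\<not> P p"
  define g :: "real \<Rightarrow> real" where "g x = (if P x then 1 else 0)" for x
  have "continuous_on {p..q} g" unfolding continuous_on_iff
  proof (intro ballI allI impI)
    fix x e :: real assume x: "x \<in> {p..q}" and e: "e > 0"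
    obtain e' where "e' > 0" "\<forall>y\<in>{p..q}. \<bar>y - x\<bar> < e' \<longrightarrow> P y = P x"
      using P[OF x] nP[OF x] by (cases "P x") auto
    thus "\<exists>d>0. \<forall>x'\<in>{p..q}. dist x' x < d \<longrightarrow> dist (g x') (g x) < e"
      using e by (intro exI[of _ e']) (auto simp: g_def dist_real_def)
  qed
  hence "\<exists>x. p \<le> x \<and> x \<le> q \<and> g x = 1 / 2" using assms n by (intro IVT') (auto simp: g_def)
  thus False by (auto simp: g_def split: if_splits)
qed

context clipped_reaction
begin

context
  fixes v :: "real \<Rightarrow> real \<Rightarrow> real" and q1 q2 :: real
  assumes q1: "0 < q1" and q2: "q1 < q2"
    and v_cont: "\<And>q. q \<in> {q1..q2} \<Longrightarrow> continuous_on {0..} (v q)"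
    and v0: "\<And>q. q \<in> {q1..q2} \<Longrightarrow> v q 0 = 0"
    and v_deriv: "\<And>q t. q \<in> {q1..q2} \<Longrightarrow> t > 0 \<Longrightarrow> (v q has_real_derivative q * (1 + quot (v q) t)) (at t)"
    and v_dep: "\<And>T. T > 0 \<Longrightarrow> \<exists>C\<ge>0. \<forall>q\<in>{q1..q2}. \<forall>q'\<in>{q1..q2}. \<forall>t\<in>{0..T}. \<bar>v q t - v q' t\<bar> \<le> C * \<bar>q - q'\<bar>"
    and A: "q2 * (1 + K * warmup) \<le> A" "vmax \<le> A * warmup"
    and aq: "a \<le> q1 / 2" and wa: "w < q1 / 2 * warmup" and wS: "w < vmax"
    and w_small: "d (w powr lam) < b (w powr lam)" "d (w powr lam) < b S"
begin

definition overshoots :: "real \<Rightarrow> bool" where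
  "overshoots q \<longleftrightarrow> (\<exists>t\<ge>warmup. v q t > vmax \<and> (\<forall>s\<in>{warmup..t}. v q s > w))"

definition undershoots :: "real \<Rightarrow> bool" where
  "undershoots q \<longleftrightarrow> (\<exists>t\<ge>warmup. v q t < w \<and> (\<forall>s\<in>{warmup..t}. v q s < vmax))"

lemma t0_pos: "warmup > 0" using K by simp

lemma q_pos: "q \<in> {q1..q2} \<Longrightarrow> q > 0" using q1 by simp

lemma v_cont': "q \<in> {q1..q2} \<Longrightarrow> 0 \<le> x \<Longrightarrow> continuous_on {x..y} (v q)"
  by (rule continuous_on_subset[OF v_cont]) auto

lemmas flow = q_pos v_cont v0 v_deriv

lemma A_le: "q \<in> {q1..q2} \<Longrightarrow> q * (1 + K * warmup) \<le> A"
  using A(1) K mult_right_mono[of q q2 "1 + K * warmup"] by auto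

lemma a_le: "q \<in> {q1..q2} \<Longrightarrow> a \<le> q / 2" using aq by auto

lemma flow_close:
  assumes q: "q \<in> {q1..q2}" and t: "t \<ge> warmup" and \<eta>: "\<eta> > 0"
  shows "\<exists>e>0. \<forall>q'\<in>{q1..q2}. \<bar>q' - q\<bar> < e \<longrightarrow> (\<forall>s\<in>{warmup..t}. \<bar>v q' s - v q s\<bar> < \<eta>)"
proof -
  have tpos: "t > 0" using t t0_pos by linarith
  obtain C where C: "C \<ge> 0" "\<forall>q\<in>{q1..q2}. \<forall>q'\<in>{q1..q2}. \<forall>t\<in>{0..t}. \<bar>v q t - v q' t\<bar> \<le> C * \<bar>q - q'\<bar>"
    using v_dep[OF tpos] by blast
  show ?thesis
  proof (intro exI[of _ "\<eta> / (C + 1)"] conjI ballI impI)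
    show "\<eta> / (C + 1) > 0" using \<eta> C(1) by simp
    fix q' s assume q': "q' \<in> {q1..q2}" "\<bar>q' - q\<bar> < \<eta> / (C + 1)" and s: "s \<in> {warmup..t}"
    have "s \<in> {0..t}" using s t0_pos unfolding atLeastAtMost_iff by linarith
    hence "\<bar>v q' s - v q s\<bar> \<le> C * \<bar>q' - q\<bar>" using C(2) q q'(1) by blast
    also have "\<dots> \<le> (C + 1) * \<bar>q' - q\<bar>" by (simp add: distrib_right)
    also have "\<dots> < \<eta>" using q'(2) C(1) by (simp add: pos_less_divide_eq mult.commute)
    finally show "\<bar>v q' s - v q s\<bar> < \<eta>" .
  qed
qed

lemma overshoots_open:
  assumes q: "q \<in> {q1..q2}" and o: "overshoots q"
  shows "\<exists>e>0. \<forall>q'\<in>{q1..q2}. \<bar>q' - q\<bar> < e \<longrightarrow> overshoots q'"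
proof -
  obtain t where t: "t \<ge> warmup" "v q t > vmax" "\<And>s. s \<in> {warmup..t} \<Longrightarrow> v q s > w"
    using o by (auto simp: overshoots_def)
  obtain s0 where s0: "s0 \<in> {warmup..t}" "\<And>s. s \<in> {warmup..t} \<Longrightarrow> v q s0 \<le> v q s"
    using continuous_attains_inf[OF compact_Icc _ v_cont'[OF q less_imp_le[OF t0_pos]], of t] t(1) by auto
  define \<eta> where "\<eta> = min (v q t - vmax) (v q s0 - w)"
  have \<eta>: "\<eta> > 0" using t(2) t(3)[OF s0(1)] by (simp add: \<eta>_def)
  have "overshoots q'" if close: "\<forall>s\<in>{warmup..t}. \<bar>v q' s - v q s\<bar> < \<eta>" for q'
    unfolding overshoots_def
  proof (intro exI[of _ t] conjI ballI)
    show "v q' t > vmax" using bspec[OF close, of t] t(1) by (auto simp: \<eta>_def)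
    fix s assume "s \<in> {warmup..t}"
    thus "v q' s > w" using bspec[OF close, of s] s0(2)[of s] by (auto simp: \<eta>_def)
  qed (use t in auto)
  with flow_close[OF q t(1) \<eta>] show ?thesis by blast
qed

lemma undershoots_open:
  assumes q: "q \<in> {q1..q2}" and o: "undershoots q"
  shows "\<exists>e>0. \<forall>q'\<in>{q1..q2}. \<bar>q' - q\<bar> < e \<longrightarrow> undershoots q'"
proof -
  obtain t where t: "t \<ge> warmup" "v q t < w" "\<And>s. s \<in> {warmup..t} \<Longrightarrow> v q s < vmax"
    using o by (auto simp: undershoots_def)
  obtain s0 where s0: "s0 \<in> {warmup..t}" "\<And>s. s \<in> {warmup..t} \<Longrightarrow> v q s \<le> v q s0"
    using continuous_attains_sup[OF compact_Icc _ v_cont'[OF q less_imp_le[OF t0_pos]], of t] t(1) by auto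
  define \<eta> where "\<eta> = min (w - v q t) (vmax - v q s0)"
  have \<eta>: "\<eta> > 0" using t(2) t(3)[OF s0(1)] by (simp add: \<eta>_def)
  have "undershoots q'" if close: "\<forall>s\<in>{warmup..t}. \<bar>v q' s - v q s\<bar> < \<eta>" for q'
    unfolding undershoots_def
  proof (intro exI[of _ t] conjI ballI)
    show "v q' t < w" using bspec[OF close, of t] t(1) by (auto simp: \<eta>_def)
    fix s assume "s \<in> {warmup..t}"
    thus "v q' s < vmax" using bspec[OF close, of s] s0(2)[of s] by (auto simp: \<eta>_def)
  qed (use t in auto)
  with flow_close[OF q t(1) \<eta>] show ?thesis by blast
qed

lemma shoots_disjoint: "\<not> (overshoots q \<and> undershoots q)"
proof
  assume "overshoots q \<and> undershoots q"
  then obtain t t' where t: "t \<ge> warmup" "v q t > vmax" "\<forall>s\<in>{warmup..t}. v q s > w"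
    and t': "t' \<ge> warmup" "v q t' < w" "\<forall>s\<in>{warmup..t'}. v q s < vmax"
    unfolding overshoots_def undershoots_def by blast
  show False
  proof (cases "t \<le> t'")
    case True thus False using t t' by (force dest: bspec[of _ _ t])
  next
    case False thus False using t t' by (force dest: bspec[of _ _ t'])
  qed
qed

lemma early_increase:
  assumes q: "q \<in> {q1..q2}" and s: "0 \<le> s" "s \<le> s'" "s' \<le> warmup + r"
  shows "v q s \<le> v q s'"
proof (rule v_mono[OF flow[OF q]])
  fix t assume "s < t" "t < s'"
  thus "1 + quot (v q) t \<ge> 0"
    using quot_early[OF flow[OF q], of t] s by simp
qed (use s in auto)

lemma above_w_at_t0: assumes q: "q \<in> {q1..q2}" shows "v q warmup > w"
proof -
  have "q1 / 2 * warmup \<le> q / 2 * warmup" using q t0_pos by (intro mult_right_mono) auto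
  also have "\<dots> \<le> v q warmup"
    using t0_pos r by (intro v_lower[OF flow[OF q]]) auto
  finally show ?thesis using wa by simp
qed

lemma shooting_profile:
  assumes q: "q \<in> {q1..q2}"
    and hi: "\<And>t. 0 < t \<Longrightarrow> t \<le> T \<Longrightarrow> v q t \<le> vmax"
    and lo: "\<And>t. warmup \<le> t \<Longrightarrow> t \<le> T \<Longrightarrow> w \<le> v q t"
  shows "profile q T (trunc (v q))"
    and "\<And>t. 0 < t \<Longrightarrow> t \<le> T \<Longrightarrow> v q t > 0 \<and> trunc (v q) t = v q t powr lam \<and> trunc (v q) t powr (m - 1) = v q t"
proof -
  show "profile q T (trunc (v q))"
    by (rule trunc_profile(1)[OF flow[OF q] A_le[OF q] A(2) a_le[OF q] hi lo])
  show "\<And>t. 0 < t \<Longrightarrow> t \<le> T \<Longrightarrow> v q t > 0 \<and> trunc (v q) t = v q t powr lam \<and> trunc (v q) t powr (m - 1) = v q t"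
    by (rule trunc_profile(2)[OF flow[OF q] A_le[OF q] A(2) a_le[OF q] hi lo])
qed

lemma flux_sign:
  assumes q: "q \<in> {q1..q2}" "t > 0"
  shows "flux (trunc (v q)) t < 0 \<longleftrightarrow> 1 + quot (v q) t < 0" "flux (trunc (v q)) t > 0 \<longleftrightarrow> 1 + quot (v q) t > 0"
    "flux (trunc (v q)) t \<ge> 0 \<longleftrightarrow> 1 + quot (v q) t \<ge> 0"
  using flux_trunc_sign[OF flow[OF q(1)] q(2)] by auto

lemma powr_S: "vmax powr lam = S" using S_pos m by (simp add: powr_powr)

lemma neither_shoots:
  assumes q: "q \<in> {q1..q2}" and no: "\<not> overshoots q" and nu: "\<not> undershoots q"
  shows "\<And>t. t \<ge> 0 \<Longrightarrow> v q t \<le> vmax" "\<And>t. t \<ge> warmup \<Longrightarrow> w \<le> v q t"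
proof -
  let ?Z = "vmax" and ?t0 = "warmup"
  note dv = v_deriv[OF q]
  have hi: "v q t \<le> ?Z" if t: "t \<ge> 0" and above: "\<And>s. s \<in> {?t0..t} \<Longrightarrow> v q s > w" for t
  proof (cases "t \<ge> ?t0")
    case True
    thus ?thesis using no above unfolding overshoots_def by force
  next
    case False
    hence "v q t \<le> v q ?t0" using t r by (intro early_increase[OF q]) auto
    also have "\<dots> \<le> ?Z" using no above_w_at_t0[OF q] unfolding overshoots_def by force
    finally show ?thesis .
  qed
  have lo: "v q t > w" if t: "t \<ge> ?t0" for t
  proof (rule ccontr)
    assume n: "\<not> v q t > w"
    have "continuous_on {?t0..t} (\<lambda>t. v q t - w)" using t0_pos by (intro continuous_intros v_cont'[OF q]) auto
    then obtain \<tau> where \<tau>: "?t0 < \<tau>" "\<tau> \<le> t" "v q \<tau> - w = 0" "\<And>s. ?t0 \<le> s \<Longrightarrow> s < \<tau> \<Longrightarrow> v q s - w > 0"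
      by (rule first_zero[OF t]) (use n above_w_at_t0[OF q] in auto)
    have \<tau>0: "\<tau> > 0" using \<tau>(1) t0_pos by linarith
    have late: "\<tau> > ?t0 + r"
    proof (rule ccontr)
      assume "\<not> \<tau> > ?t0 + r"
      hence "v q ?t0 \<le> v q \<tau>" using \<tau>(1) t0_pos by (intro early_increase[OF q]) auto
      thus False using above_w_at_t0[OF q] \<tau>(3) by simp
    qed
    have hi': "v q s \<le> ?Z" if s: "0 < s" "s \<le> \<tau>" for s
    proof (cases "s = \<tau>")
      case True thus ?thesis using \<tau>(3) wS by simp
    next
      case False thus ?thesis using s \<tau>(4) by (intro hi) auto
    qed
    have lo': "w \<le> v q s" if "?t0 \<le> s" "s \<le> \<tau>" for s
      using \<tau>(3) \<tau>(4)[of s] that by (cases "s = \<tau>") auto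
    note prof = shooting_profile(1)[OF q hi' lo', of \<tau>]
    have tr: "v q s > 0" "trunc (v q) s = v q s powr lam" "trunc (v q) s powr (m - 1) = v q s"
      if "0 < s" "s \<le> \<tau>" for s
      using shooting_profile(2)[OF q hi' lo', of \<tau>, OF _ _ _ _ that] by auto
    have less: "v q s < ?Z" if s: "0 < s" "s \<le> \<tau>" for s
    proof (rule ccontr)
      assume "\<not> v q s < ?Z"
      hence sZ: "?Z - v q s \<le> 0" by simp
      have "continuous_on {0..s} (\<lambda>t. ?Z - v q t)" by (intro continuous_intros v_cont'[OF q]) auto
      then obtain u where u: "0 < u" "u \<le> s" "?Z - v q u = 0" "\<And>x. 0 \<le> x \<Longrightarrow> x < u \<Longrightarrow> ?Z - v q x > 0"
        by (rule first_zero[OF less_imp_le[OF s(1)]]) (use sZ S_pos v0[OF q] in auto)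
      have u\<tau>: "u < \<tau>" using u s \<tau>(3) wS by (cases "u = \<tau>") auto
      have fu: "trunc (v q) u = S" using tr(2)[of u] u s powr_S by simp
      have "flux (trunc (v q)) u > 0"
      proof (rule first_passage_up[OF prof u(1) _ u(1)])
        show "u \<le> \<tau>" using u\<tau> by simp
        fix x assume x: "u - u < x" "x < u"
        have "trunc (v q) x = v q x powr lam" using tr(2)[of x] x u\<tau> by simp
        also have "\<dots> < ?Z powr lam"
          using u(4)[of x] x tr(1)[of x] u\<tau> m by (intro powr_less_mono2) auto
        finally show "trunc (v q) x < trunc (v q) u" using fu powr_S by simp
      next
        have "b (trunc (v q) (u - r)) \<le> d \<zeta>2" using trunc_range by (intro b_le_top)
        also have "d \<zeta>2 < d S" using order by (intro d_less) auto
        finally show "rate (trunc (v q)) u > 0" by (simp add: rate_def fu)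
      qed auto
      hence "q * (1 + quot (v q) u) > 0" using flux_sign(2)[OF q u(1)] q_pos[OF q] by simp
      from DERIV_pos_inc_right[OF dv[OF u(1)] this]
      obtain e where e: "e > 0" "\<And>h. 0 < h \<Longrightarrow> h < e \<Longrightarrow> v q u < v q (u + h)" by auto
      define h where "h = min (e / 2) (\<tau> - u)"
      have "0 < h" "h < e" "u + h \<le> \<tau>" using e u\<tau> by (auto simp: h_def)
      thus False using e(2)[of h] hi'[of "u + h"] u by auto
    qed
    have f\<tau>: "trunc (v q) \<tau> = w powr lam" using tr(2)[of \<tau>] \<tau>0 \<tau>(3) by simp
    have "flux (trunc (v q)) \<tau> < 0"
    proof (rule first_passage_down[OF prof \<tau>0 order_refl])
      show "\<tau> - ?t0 > 0" using \<tau> by simp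
      fix x assume x: "\<tau> - (\<tau> - ?t0) < x" "x < \<tau>"
      have x0: "0 < x" using x t0_pos by linarith
      have "w powr lam < v q x powr lam"
        using \<tau>(4)[of x] x w m by (intro powr_less_mono2) auto
      also have "\<dots> = trunc (v q) x" using tr(2)[of x] x x0 by simp
      finally show "trunc (v q) \<tau> < trunc (v q) x" using f\<tau> by simp
    next
      have x0: "0 < \<tau> - r" using late t0_pos by linarith
      have "w powr lam \<le> v q (\<tau> - r) powr lam"
        using lo'[of "\<tau> - r"] late r w m by (intro powr_mono2) auto
      hence "w powr lam \<le> trunc (v q) (\<tau> - r)" using tr(2)[of "\<tau> - r"] x0 r by simp
      hence "min (b (w powr lam)) (b S) \<le> b (trunc (v q) (\<tau> - r))"
        using trunc_range(2) by (intro b_min) auto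
      thus "rate (trunc (v q)) \<tau> < 0" using w_small by (simp add: rate_def f\<tau>)
    qed auto
    hence "q * (1 + quot (v q) \<tau>) < 0" using flux_sign(1)[OF q \<tau>0] q_pos[OF q] by (simp add: mult_less_0_iff)
    from DERIV_neg_dec_right[OF dv[OF \<tau>0] this]
    obtain e where e: "e > 0" "\<And>h. 0 < h \<Longrightarrow> h < e \<Longrightarrow> v q (\<tau> + h) < v q \<tau>" by auto
    have "undershoots q" unfolding undershoots_def
    proof (intro exI[of _ "\<tau> + e / 2"] conjI ballI)
      show "?t0 \<le> \<tau> + e / 2" using \<tau> e by simp
      show "v q (\<tau> + e / 2) < w" using e(2)[of "e / 2"] e(1) \<tau>(3) by simp
      fix s assume s: "s \<in> {?t0..\<tau> + e / 2}"
      show "v q s < ?Z"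
      proof (cases "s \<le> \<tau>")
        case True
        have "0 < s" using s t0_pos unfolding atLeastAtMost_iff by linarith
        thus ?thesis using True by (rule less)
      next
        case False
        thus ?thesis using e(2)[of "s - \<tau>"] e(1) s \<tau>(3) wS by auto
      qed
    qed
    thus False using nu by simp
  qed
  show "\<And>t. t \<ge> 0 \<Longrightarrow> v q t \<le> ?Z" using hi lo by auto
  show "\<And>t. t \<ge> ?t0 \<Longrightarrow> w \<le> v q t" using lo by (auto intro: less_imp_le)
qed

lemma slow_start:
  assumes \<sigma>: "0 < \<sigma>" "\<sigma> \<le> \<kappa>" and \<delta>\<beta>: "0 < \<delta>" "\<delta> < \<beta>"
    and lin: "\<And>x. x \<in> {0..\<sigma>} \<Longrightarrow> d x \<le> \<delta> * x \<and> \<beta> * x \<le> b x"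
    and T: "T = warmup + real n * (r + 2 / (\<beta> - \<delta>))"
    and \<rho>: "\<rho> = (2 + \<delta> * (2 / (\<beta> - \<delta>))) / (1 + \<delta> * (2 / (\<beta> - \<delta>)))"
    and horizon: "T * ((1 + K * T) * T) powr lam
      < \<rho> ^ n * (warmup / 2 * (warmup / 4) powr lam)"
    and small: "q1 * (1 + K * T) * T \<le> \<sigma> powr (m - 1)"
  shows "\<not> overshoots q1"
proof
  let ?Z = "vmax" and ?t0 = "warmup" and ?l = "lam"
  let ?v = "v q1" and ?f = "trunc (v q1)"
  assume "overshoots q1"
  then obtain t where t: "t \<ge> ?t0" "?v t > ?Z" "\<And>s. s \<in> {?t0..t} \<Longrightarrow> ?v s > w"
    by (auto simp: overshoots_def)
  have q: "q1 \<in> {q1..q2}" using q2 by simp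
  note flow = flow[OF q]
  have Tt0: "?t0 \<le> T" using \<delta>\<beta> r by (simp add: T)
  have T0: "T > 0" using Tt0 t0_pos by linarith
  have \<sigma>Z: "\<sigma> powr (m - 1) < ?Z" using \<sigma> order m by (intro powr_less_mono2) auto
  have slow: "?v s \<le> \<sigma> powr (m - 1)"
    if "0 < s" "s \<le> T" "\<And>u. 0 < u \<Longrightarrow> u < s \<Longrightarrow> 1 + quot ?v u \<ge> 0" for s
  proof -
    have "?v s \<le> q1 * (1 + K * s) * s" by (rule v_upper[OF flow that(3,1)])
    also have "\<dots> \<le> q1 * (1 + K * T) * T"
      using that q1 K by (intro mult_mono mult_left_mono add_left_mono) auto
    finally show ?thesis using small by simp
  qed
  have c: "continuous_on {0..t} (\<lambda>t. ?Z - ?v t)" by (intro continuous_intros v_cont'[OF q]) auto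
  have t0': "0 \<le> t" using t(1) t0_pos by linarith
  obtain \<tau> where \<tau>: "0 < \<tau>" "\<tau> \<le> t" "?Z - ?v \<tau> = 0" "\<And>x. 0 \<le> x \<Longrightarrow> x < \<tau> \<Longrightarrow> ?Z - ?v x > 0"
    by (rule first_zero[OF t0' c]) (use t S_pos v0[OF q] in auto)
  have early: "1 + quot ?v u \<ge> 0" if "0 < u" "u \<le> ?t0" for u
    using quot_early[OF flow that(1)] that r by simp
  have hi: "?v s \<le> ?Z" if "0 < s" "s \<le> \<tau>" for s
    using \<tau>(3) \<tau>(4)[of s] that by (cases "s = \<tau>") auto
  have lo: "w \<le> ?v s" if "?t0 \<le> s" "s \<le> \<tau>" for s using t(3)[of s] that \<tau> by auto
  note prof = shooting_profile(1)[OF q hi lo, of \<tau>]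
  have tr: "?v s > 0" "?f s = ?v s powr ?l" if "0 < s" "s \<le> \<tau>" for s
    using shooting_profile(2)[OF q hi lo, of \<tau>, OF _ _ _ _ that] by auto
  have f\<tau>: "?f \<tau> = S" using tr(2)[of \<tau>] \<tau> powr_S by simp
  have f\<sigma>: "?f s \<le> \<sigma>"
    if "0 < s" "s \<le> T" "s \<le> \<tau>" "\<And>u. 0 < u \<Longrightarrow> u < s \<Longrightarrow> 1 + quot ?v u \<ge> 0" for s
  proof -
    have "?v s powr ?l \<le> (\<sigma> powr (m - 1)) powr ?l"
      using slow[OF that(1,2,4)] tr(1)[of s] that m by (intro powr_mono2) auto
    thus ?thesis using tr(2)[of s] that \<sigma> m by (simp add: powr_powr)
  qed
  show False
  proof (cases "\<exists>u. 0 < u \<and> u < \<tau> \<and> u \<le> T \<and> flux ?f u < 0")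
    case True
    then obtain u where u: "0 < u" "u < \<tau>" "u \<le> T" "flux ?f u < 0" by blast
    have "\<exists>s. turning ?f s \<and> ?t0 \<le> s \<and> s < u"
      by (rule turning_exists[OF prof u(1) less_imp_le[OF u(2)] u(4) t0_pos])
        (use early flux_sign(3)[OF q] in auto)
    then obtain s where s: "turning ?f s" "?t0 \<le> s" "s < u" by blast
    have s0: "0 < s" using s(2) t0_pos by linarith
    have "1 + quot ?v x \<ge> 0" if "0 < x" "x < s" for x
      using s(1) that flux_sign(3)[OF q that(1)] by (auto simp: turning_def)
    hence "?f s \<le> \<sigma>" using s0 s u by (intro f\<sigma>) auto
    hence "?f \<tau> \<le> ?f s" using s u \<sigma> \<tau> by (intro decay_after_turning[OF prof]) auto
    thus False using \<open>?f s \<le> \<sigma>\<close> \<sigma> f\<tau> order by simp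
  next
    case False
    have nonneg: "flux ?f u \<ge> 0" if "0 < u" "u < \<tau>" "u \<le> T" for u
    proof (rule ccontr)
      assume "\<not> flux ?f u \<ge> 0"
      hence "flux ?f u < 0" by simp
      with False that show False by blast
    qed
    have T\<tau>: "T < \<tau>"
    proof (rule ccontr)
      assume "\<not> T < \<tau>"
      hence "flux ?f u \<ge> 0" if "0 < u" "u < \<tau>" for u using that by (intro nonneg) auto
      hence "1 + quot ?v u \<ge> 0" if "0 < u" "u < \<tau>" for u using flux_sign(3)[OF q that(1)] that by simp
      hence "?v \<tau> \<le> \<sigma> powr (m - 1)" using \<open>\<not> T < \<tau>\<close> \<tau>(1) by (intro slow) auto
      thus False using \<tau>(3) \<sigma>Z by simp
    qed
    have pos: "flux ?f u \<ge> 0" if "0 < u" "u \<le> T" for u using that T\<tau> by (intro nonneg) auto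
    have quot: "1 + quot ?v u \<ge> 0" if "0 < u" "u < T" for u using flux_sign(3)[OF q that(1)] pos[of u] that by simp
    have mono: "?f x \<le> ?f y" if "x \<le> y" "y \<le> T" for x y
      using that by (intro trunc_mono[OF flow, of T] quot) auto
    have fT: "?f T \<le> \<sigma>" using T\<tau> T0 quot by (intro f\<sigma>) auto
    have cont: "continuous_on UNIV ?f" by (rule trunc_cont_UNIV[OF flow])
    have int: "?f integrable_on {x..y}" for x y
      by (intro integrable_continuous_interval continuous_on_subset[OF cont]) auto
    have "\<rho> ^ n * integral {0..?t0} ?f \<le> integral {0..?t0 + real n * (r + 2 / (\<beta> - \<delta>))} ?f"
    proof (rule delayed_growth_iterated[OF cont mono _ _ _ \<delta>\<beta> lin pos t0_pos _ \<rho>])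
      show "?f t = 0" if "t \<le> 0" for t using that by (simp add: trunc_def)
      show "?f t \<le> \<sigma>" if "t \<le> T" for t using mono[OF that order_refl] fT by simp
      show "\<sigma> \<le> S" using \<sigma> order by simp
      show "?t0 + real n * (r + 2 / (\<beta> - \<delta>)) \<le> T" by (simp add: T)
    qed auto
    hence grow: "\<rho> ^ n * integral {0..?t0} ?f \<le> integral {0..T} ?f" by (simp add: T)
    have "integral {0..T} ?f \<le> integral {0..T} (\<lambda>_. ?f T)" using int mono by (intro integral_le) auto
    hence I1: "integral {0..T} ?f \<le> T * ?f T" using T0 by simp
    have "?f T = ?v T powr ?l" using tr(2)[of T] T0 T\<tau> by simp
    also have "\<dots> \<le> (q1 * (1 + K * T) * T) powr ?l"
      using v_upper[OF flow quot T0] tr(1)[of T] T0 T\<tau> m by (intro powr_mono2) auto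
    also have "\<dots> = q1 powr ?l * ((1 + K * T) * T) powr ?l"
      using q1 K T0 by (simp add: powr_mult mult.assoc)
    finally have "T * ?f T \<le> q1 powr ?l * (T * ((1 + K * T) * T) powr ?l)"
      using T0 by (simp add: mult.left_commute)
    hence up: "integral {0..T} ?f \<le> q1 powr ?l * (T * ((1 + K * T) * T) powr ?l)" using I1 by simp
    define c where "c = (q1 * (?t0 / 4)) powr ?l"
    have "c \<le> ?f s" if s: "s \<in> {?t0 / 2..?t0}" for s
    proof -
      have "0 < ?t0 / 2" using t0_pos by simp
      also have "\<dots> \<le> s" using s by simp
      finally have "0 < s" .
      with s have s0: "0 < s" "s \<le> ?t0" by simp_all
      have "q1 * (?t0 / 4) = q1 / 2 * (?t0 / 2)" by simp
      also have "\<dots> \<le> q1 / 2 * s" using s q1 by (intro mult_left_mono) auto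
      also have "\<dots> \<le> ?v s" using s0 r by (intro v_lower[OF flow]) auto
      finally have "c \<le> ?v s powr ?l" unfolding c_def using q1 t0_pos m by (intro powr_mono2) auto
      also have "\<dots> = ?f s" using tr(2)[of s] s0 Tt0 T\<tau> by simp
      finally show ?thesis .
    qed
    hence "integral {?t0 / 2..?t0} (\<lambda>_. c) \<le> integral {?t0 / 2..?t0} ?f" using int by (intro integral_le) auto
    also have "\<dots> \<le> integral {0..?t0} ?f"
      using int trunc_range t0_pos by (intro integral_subset_le) auto
    finally have "?t0 / 2 * c \<le> integral {0..?t0} ?f" using t0_pos by simp
    moreover have "\<rho> \<ge> 0" using \<delta>\<beta> by (simp add: \<rho>)
    ultimately have "\<rho> ^ n * (?t0 / 2 * c) \<le> \<rho> ^ n * integral {0..?t0} ?f"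
      by (intro mult_left_mono) auto
    also have "\<dots> \<le> q1 powr ?l * (T * ((1 + K * T) * T) powr ?l)" using grow up by simp
    finally have up': "\<rho> ^ n * (?t0 / 2 * c) \<le> q1 powr ?l * (T * ((1 + K * T) * T) powr ?l)" .
    have "q1 powr ?l * (T * ((1 + K * T) * T) powr ?l) < q1 powr ?l * (\<rho> ^ n * (?t0 / 2 * (?t0 / 4) powr ?l))"
      using horizon q1 by (intro mult_strict_left_mono) auto
    also have "\<dots> = \<rho> ^ n * (?t0 / 2 * c)"
    proof -
      have "c = q1 powr ?l * (?t0 / 4) powr ?l" unfolding c_def by (rule powr_mult)
      thus ?thesis by (simp add: mult_ac)
    qed
    finally show False using up' by simp
  qed
qed

lemma shooting:
  assumes slow: "\<not> overshoots q1" and fast: "q2 / 2 * warmup > vmax"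
  shows "\<exists>q\<in>{q1..q2}. \<not> overshoots q \<and> \<not> undershoots q"
proof (rule ccontr)
  assume n: "\<not> (\<exists>q\<in>{q1..q2}. \<not> overshoots q \<and> \<not> undershoots q)"
  have q: "q2 \<in> {q1..q2}" using q2 by simp
  have "q2 / 2 * warmup \<le> v q2 warmup"
    using t0_pos r by (intro v_lower[OF flow[OF q]]) auto
  hence "overshoots q2" unfolding overshoots_def
    using fast above_w_at_t0[OF q] by (intro exI[of _ "warmup"]) auto
  have "overshoots q1"
  proof (rule clopen_interval_propagate[of q1 q2 overshoots, OF less_imp_le[OF q2] overshoots_open _ \<open>overshoots q2\<close>])
    fix x assume x: "x \<in> {q1..q2}" "\<not> overshoots x"
    hence "undershoots x" using n by blast
    from undershoots_open[OF x(1) this] shoots_disjoint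
    show "\<exists>e>0. \<forall>y\<in>{q1..q2}. \<bar>y - x\<bar> < e \<longrightarrow> \<not> overshoots y" by blast
  qed auto
  with slow show False by simp
qed

lemma critical_profile:
  assumes slow: "\<not> overshoots q1" and fast: "q2 / 2 * warmup > vmax"
  shows "\<exists>q>0. \<exists>f. entire_profile q f \<and>
    (\<forall>t. 0 < t \<longrightarrow> t \<le> warmup \<longrightarrow> \<bar>f t powr (m - 1) - q * t\<bar> \<le> q * K * t\<^sup>2 \<and> flux f t \<ge> 0)"
proof -
  obtain q where q: "q \<in> {q1..q2}" "\<not> overshoots q" "\<not> undershoots q" using shooting[OF slow fast] by blast
  note bounds = neither_shoots[OF q]
  note flow = flow[OF q(1)]
  have prof: "profile q T (trunc (v q))" for T
    by (rule shooting_profile(1)[OF q(1) bounds(1)[OF less_imp_le] bounds(2)])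
  have v: "trunc (v q) t powr (m - 1) = v q t" if "0 < t" for t
  proof -
    have "v q t > 0 \<and> trunc (v q) t = v q t powr lam \<and> trunc (v q) t powr (m - 1) = v q t"
      by (rule shooting_profile(2)[OF q(1), of t]) (use bounds that in auto)
    thus ?thesis by (elim conjE)
  qed
  have "\<bar>trunc (v q) t powr (m - 1) - q * t\<bar> \<le> q * K * t\<^sup>2 \<and> flux (trunc (v q)) t \<ge> 0"
    if t: "0 < t" "t \<le> warmup" for t
    using v_early_bounds[OF flow t] v[OF t(1)] quot_early[OF flow t(1)] flux_sign(3)[OF q(1) t(1)] t r by simp
  thus ?thesis using prof flow(1) by (intro exI[of _ q] exI[of _ "trunc (v q)"] conjI) (auto simp: entire_profile_def)
qed

end
end

context delay_reaction
begin

theorem entire_profile_exists: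
  assumes \<sigma>: "0 < \<sigma>" "\<sigma> \<le> \<kappa>" and \<delta>\<beta>: "0 < \<delta>" "\<delta> < \<beta>"
    and lin: "\<And>x. x \<in> {0..\<sigma>} \<Longrightarrow> d x \<le> \<delta> * x \<and> \<beta> * x \<le> b x"
  shows "\<exists>q>0. \<exists>f. entire_profile q f \<and>
    (\<forall>t. 0 < t \<longrightarrow> t \<le> warmup \<longrightarrow> \<bar>f t powr (m - 1) - q * t\<bar> \<le> q * K * t\<^sup>2 \<and> flux f t \<ge> 0)"
proof -
  let ?t0 = "warmup" and ?l = "lam" and ?Z = "vmax"
  have t0: "?t0 > 0" and l: "?l > 0" using K m by auto
  have S0: "S > 0" using order by simp
  have Z: "?Z > 0" using S0 by simp
  define \<rho> where "\<rho> = (2 + \<delta> * (2 / (\<beta> - \<delta>))) / (1 + \<delta> * (2 / (\<beta> - \<delta>)))"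
  have h: "\<delta> * (2 / (\<beta> - \<delta>)) > 0" "2 / (\<beta> - \<delta>) > 0" using \<delta>\<beta> by auto
  have \<rho>: "\<rho> > 1"
  proof -
    have "(2 + x) / (1 + x) > 1" if "x > 0" for x :: real using that by simp
    from this[OF h(1)] show ?thesis by (simp only: \<rho>_def)
  qed
  have H: "r + 2 / (\<beta> - \<delta>) > 0" using r h(2) by linarith
  have C: "?t0 / 2 * (?t0 / 4) powr ?l > 0" using t0 by simp
  obtain n :: nat where "(?t0 + real n * (r + 2 / (\<beta> - \<delta>))) *
      ((1 + K * (?t0 + real n * (r + 2 / (\<beta> - \<delta>)))) * (?t0 + real n * (r + 2 / (\<beta> - \<delta>)))) powr ?l
      < \<rho> ^ n * (?t0 / 2 * (?t0 / 4) powr ?l)"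
    using polynomial_less_geometric[OF \<rho> l t0 H C K] by blast
  moreover define T where "T = ?t0 + real n * (r + 2 / (\<beta> - \<delta>))"
  ultimately have horizon: "T * ((1 + K * T) * T) powr ?l < \<rho> ^ n * (?t0 / 2 * (?t0 / 4) powr ?l)" by simp
  have T0: "T > 0" using t0 H unfolding T_def by (simp add: add_pos_nonneg)
  define q1 where "q1 = \<sigma> powr (m - 1) / ((1 + K * T) * T)"
  have KT: "(1 + K * T) * T > 0" using K T0 by (simp add: add_pos_pos)
  have q1: "q1 > 0" using \<sigma> KT by (simp add: q1_def)
  have small: "q1 * (1 + K * T) * T \<le> \<sigma> powr (m - 1)" using KT by (simp add: q1_def mult.assoc)
  define q2 where "q2 = q1 + 2 * ?Z / ?t0"
  have q2: "q1 < q2" using Z t0 unfolding q2_def by (simp add: add_pos_pos)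
  have fast: "q2 / 2 * ?t0 > ?Z" using K q1 by (simp add: q2_def field_simps)
  define a where "a = q1 / 2"
  define A where "A = q2 * (1 + K * ?t0) + ?Z / ?t0"
  have A: "q2 * (1 + K * ?t0) \<le> A" "?Z \<le> A * ?t0"
  proof -
    show "q2 * (1 + K * ?t0) \<le> A" using Z t0 by (simp add: A_def)
    have "0 \<le> q2 * (1 + K * ?t0) * ?t0" using q1 q2 K by simp
    moreover have "(x + z / u) * u = x * u + z" if "u > 0" for x z u :: real
      using that by (simp add: distrib_right)
    from this[OF t0] have "A * ?t0 = q2 * (1 + K * ?t0) * ?t0 + ?Z" by (simp only: A_def)
    ultimately show "?Z \<le> A * ?t0" by linarith
  qed
  have aA: "a \<le> A"
  proof -
    have "a \<le> q2" using q1 q2 by (simp add: a_def)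
    also have "q2 \<le> q2 * (1 + K * ?t0)" using q1 q2 K by simp
    finally show ?thesis using A(1) by simp
  qed
  have half: "x / 2 < x" if "x > 0" for x :: real using that by simp
  define y where "y = min \<kappa> (b S / K) / 2"
  have y: "0 < y" "y < \<kappa>" "K * y < b S" "y \<le> S"
  proof -
    have bS: "b S / K > 0" using K b_pos[OF S0] by simp
    show "0 < y" "y < \<kappa>" "y \<le> S" using order bS by (auto simp: y_def)
    have "y \<le> b S / K / 2" unfolding y_def by (intro divide_right_mono) auto
    also have "\<dots> < b S / K" by (rule half[OF bS])
    finally have "y < b S / K" .
    thus "K * y < b S" using K by (simp add: pos_less_divide_eq mult.commute)
  qed
  define w where "w = min (y powr (m - 1)) (min (a * ?t0) ?Z / 2)"
  have w_bounds: "0 < w" "w \<le> y powr (m - 1)" "w < a * ?t0" "w < ?Z"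
  proof -
    have "0 < a * ?t0" using q1 t0 by (simp add: a_def)
    hence u: "0 < min (a * ?t0) ?Z" using Z by simp
    have "w \<le> min (a * ?t0) ?Z / 2" unfolding w_def by (rule min.cobounded2)
    also have "\<dots> < min (a * ?t0) ?Z" by (rule half[OF u])
    finally have "w < min (a * ?t0) ?Z" .
    thus "w < a * ?t0" "w < ?Z" by (simp_all only: min_less_iff_conj)
    show "w \<le> y powr (m - 1)" unfolding w_def by (rule min.cobounded1)
    have "0 < min (a * ?t0) ?Z / 2" "0 < y powr (m - 1)" using u y by simp_all
    thus "0 < w" unfolding w_def by (simp only: min_less_iff_conj)
  qed
  have wl: "0 < w powr ?l" "w powr ?l \<le> y"
  proof -
    have "w powr ?l \<le> (y powr (m - 1)) powr ?l" using w_bounds m by (intro powr_mono2) auto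
    thus "w powr ?l \<le> y" using y m by (simp add: powr_powr)
  qed (use w_bounds in simp)
  have wd: "d (w powr ?l) < b (w powr ?l)" "d (w powr ?l) < b S"
  proof -
    show "d (w powr ?l) < b (w powr ?l)" using wl y by (intro b_gt_d) auto
    have "\<bar>d (w powr ?l) - d 0\<bar> \<le> K * \<bar>w powr ?l - 0\<bar>" using wl y S0 by (intro d_lip) auto
    hence "d (w powr ?l) \<le> K * w powr ?l" using d0 by simp
    also have "\<dots> \<le> K * y" using wl K by simp
    finally show "d (w powr ?l) < b S" using y by simp
  qed
  interpret clipped_reaction m r S K \<kappa> \<zeta>1 \<zeta>2 b d a A w
    by unfold_locales (use q1 aA w_bounds in \<open>auto simp: a_def\<close>)
  obtain v where v: "\<forall>q\<ge>0. continuous_on {0..} (v q) \<and> v q 0 = 0 \<and>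
        (\<forall>t>0. (v q has_real_derivative q * (1 + quot (v q) t)) (at t))"
     and dep: "\<forall>T>0. \<forall>Q\<ge>0.
       \<exists>C\<ge>0. \<forall>q\<in>{0..Q}. \<forall>q'\<in>{0..Q}. \<forall>t\<in>{0..T}. \<bar>v q t - v q' t\<bar> \<le> C * \<bar>q - q'\<bar>"
    using clip_flow by blast
  have dep': "\<exists>C\<ge>0. \<forall>q\<in>{q1..q2}. \<forall>q'\<in>{q1..q2}. \<forall>t\<in>{0..T}. \<bar>v q t - v q' t\<bar> \<le> C * \<bar>q - q'\<bar>" if T: "T > 0" for T
  proof -
    obtain C where "C \<ge> 0" "\<forall>q\<in>{0..q2}. \<forall>q'\<in>{0..q2}. \<forall>t\<in>{0..T}. \<bar>v q t - v q' t\<bar> \<le> C * \<bar>q - q'\<bar>"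
      using dep T less_imp_le[OF less_trans[OF q1 q2]] by blast
    moreover have "{q1..q2} \<subseteq> {0..q2}" using q1 by auto
    ultimately show ?thesis by blast
  qed
  have v': "continuous_on {0..} (v q)" "v q 0 = 0"
      "\<And>t. t > 0 \<Longrightarrow> (v q has_real_derivative q * (1 + quot (v q) t)) (at t)" if "q \<in> {q1..q2}" for q
  proof -
    have "q \<ge> 0" using that q1 by simp
    with v show "continuous_on {0..} (v q)" "v q 0 = 0"
      "\<And>t. t > 0 \<Longrightarrow> (v q has_real_derivative q * (1 + quot (v q) t)) (at t)" by blast+
  qed
  have aq: "a \<le> q1 / 2" "w < q1 / 2 * ?t0" using w_bounds by (auto simp: a_def)
  have "\<not> overshoots v q1"
    by (rule slow_start[OF q1 q2 v' dep' A aq w_bounds(4) wd \<sigma> \<delta>\<beta> lin T_def \<rho>_def horizon small])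
  from critical_profile[OF q1 q2 v' dep' A aq w_bounds(4) wd this fast] show ?thesis .
qed

end

section \<open>Weak derivatives and test functions\<close>

lemma has_real_derivative_primitive:
  fixes g h :: "real \<Rightarrow> real"
  assumes g: "continuous_on UNIV g" "\<And>t. t \<le> 0 \<Longrightarrow> g t = 0"
    and h: "\<And>t. t \<le> 0 \<Longrightarrow> h t = 0" "\<And>t. t > 0 \<Longrightarrow> h t = integral {0..t} g"
  shows "(h has_real_derivative g t) (at t)"
proof -
  define R where "R = \<bar>t\<bar> + 1"
  have int: "g integrable_on {u..v}" for u v
    by (intro integrable_continuous_interval continuous_on_subset[OF g(1)]) auto
  have zero: "integral {- R..u} g = 0" if "u \<le> 0" for u
  proof -
    have "integral {- R..u} g = integral {- R..u} (\<lambda>_. 0)" using g(2) that by (intro integral_cong) auto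
    thus ?thesis by simp
  qed
  have eq: "h s = integral {- R..s} g" if "s \<in> {- R<..<R}" for s
  proof (cases "s \<le> 0")
    case False
    have "integral {- R..s} g = integral {- R..0} g + integral {0..s} g"
      using False by (intro Henstock_Kurzweil_Integration.integral_combine[symmetric] int) (auto simp: R_def)
    thus ?thesis using False h(2)[of s] zero[of 0] by simp
  qed (use h(1) zero in simp)
  have t: "t \<in> {- R<..<R}" by (auto simp: R_def)
  have "((\<lambda>s. integral {- R..s} g) has_real_derivative g t) (at t within {- R..R})"
    using t by (intro integral_has_real_derivative continuous_on_subset[OF g(1)]) auto
  moreover have "at t within {- R..R} = at t"
    using t by (intro at_within_interior) (auto simp: interior_atLeastAtMost_real)
  moreover have "\<forall>\<^sub>F s in nhds t. integral {- R..s} g = h s"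
    using eventually_nhds_in_open[OF _ t] by (auto elim!: eventually_mono simp: eq)
  ultimately show ?thesis by (simp add: DERIV_cong_ev)
qed

lemma test_fun_DERIV:
  assumes "test_fun \<psi>"
  shows "DERIV \<psi> x :> deriv \<psi> x" "DERIV (deriv \<psi>) x :> deriv (deriv \<psi>) x" "isCont (deriv (deriv \<psi>)) x"
proof -
  have d: "((deriv ^^ k) \<psi>) differentiable (at x)" for k using assms by (simp add: test_fun_def)
  show "DERIV \<psi> x :> deriv \<psi> x" using d[of 0] by (simp add: DERIV_deriv_iff_real_differentiable)
  show "DERIV (deriv \<psi>) x :> deriv (deriv \<psi>) x" using d[of 1] by (simp add: DERIV_deriv_iff_real_differentiable)
  show "isCont (deriv (deriv \<psi>)) x" using d[of 2]
    by (simp add: numeral_2_eq_2 differentiable_imp_continuous_within)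
qed

lemma deriv_eq_0_outside:
  assumes "\<And>x. \<bar>x\<bar> > R \<Longrightarrow> \<psi> x = (0::real)" "\<bar>x\<bar> > R" shows "deriv \<psi> x = 0"
proof -
  have "\<forall>\<^sub>F y in nhds x. \<bar>y\<bar> > R"
    using assms(2) by (intro eventually_nhds_in_open[of "{y. \<bar>y\<bar> > R}", simplified] open_Collect_less continuous_intros) auto
  hence "\<forall>\<^sub>F y in nhds x. 0 = \<psi> y" by eventually_elim (use assms(1) in auto)
  moreover have "DERIV (\<lambda>_. 0) x :> (0::real)" by simp
  ultimately have "DERIV \<psi> x :> 0" by (subst (asm) DERIV_cong_ev) auto
  thus ?thesis by (rule DERIV_imp_deriv)
qed

lemma test_fun_support:
  assumes "test_fun \<psi>"
  obtains R where "R > 0" "\<And>x. \<bar>x\<bar> > R \<Longrightarrow> \<psi> x = 0" "\<And>x. \<bar>x\<bar> > R \<Longrightarrow> deriv \<psi> x = 0"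
    "\<And>x. \<bar>x\<bar> > R \<Longrightarrow> deriv (deriv \<psi>) x = 0"
proof -
  obtain R where R: "\<And>x. \<bar>x\<bar> > R \<Longrightarrow> \<psi> x = 0" using assms by (auto simp: test_fun_def)
  have R': "\<And>x. \<bar>x\<bar> > max R 1 \<Longrightarrow> \<psi> x = 0" using R by simp
  note d1 = deriv_eq_0_outside[of "max R 1" \<psi>, OF R']
  note d2 = deriv_eq_0_outside[of "max R 1" "deriv \<psi>", OF d1]
  show ?thesis by (rule that[of "max R 1"]) (use R' d1 d2 in auto)
qed

lemma integral_compactly_supported_deriv:
  fixes F H :: "real \<Rightarrow> real"
  assumes H: "\<And>x. DERIV H x :> F x" and F: "\<And>x. isCont F x"
    and supp: "\<And>x. \<bar>x\<bar> > R \<Longrightarrow> H x = 0" "\<And>x. \<bar>x\<bar> > R \<Longrightarrow> F x = 0" and R: "R > 0"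
  shows "integrable lborel F" "integral\<^sup>L lborel F = 0"
proof -
  define T where "T = R + 1"
  have eq: "F x * indicator {- T..T} x = F x" for x
    using supp(2)[of x] by (cases "x \<in> {- T..T}") (auto simp: T_def)
  have "integrable lborel (\<lambda>x. indicator {- T..T} x *\<^sub>R F x)"
    by (intro borel_integrable_compact continuous_at_imp_continuous_on) (use F in auto)
  thus "integrable lborel F" using eq by (simp add: mult.commute)
  have "(\<integral>x. F x * indicator {- T..T} x \<partial>lborel) = H T - H (- T)"
    using R H F by (intro integral_FTC_Icc_real) (auto simp: T_def)
  thus "integral\<^sup>L lborel F = 0" using supp(1)[of T] supp(1)[of "- T"] R by (simp only: eq) (simp add: T_def)
qed

lemma loc_integrable_continuous:
  assumes "continuous_on UNIV f" shows "loc_integrable f"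
  unfolding loc_integrable_def set_integrable_def
  by (intro allI borel_integrable_compact continuous_on_subset[OF assms]) auto

text \<open>The derivative \<open>g\<close> may blow up at \<open>0\<close>; its sign near \<open>0\<close> turns the improper integral into a
  Lebesgue integral.\<close>

lemma W11_loc_one_sided:
  fixes g h :: "real \<Rightarrow> real"
  assumes h: "continuous_on UNIV h" "\<And>t. t \<le> 0 \<Longrightarrow> h t = 0"
    and g: "\<And>t. t \<le> 0 \<Longrightarrow> g t = 0" "continuous_on {0<..} g"
    and hg: "\<And>t. t > 0 \<Longrightarrow> (h has_real_derivative g t) (at t)"
    and e: "e > 0" "\<And>t. 0 < t \<Longrightarrow> t \<le> e \<Longrightarrow> g t \<ge> 0"
  shows "W11_loc h"
proof -
  have gm: "g \<in> borel_measurable borel"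
  proof -
    have "(\<lambda>x. indicator {0<..} x *\<^sub>R g x) \<in> borel_measurable borel"
      by (intro borel_measurable_continuous_on_indicator g(2)) auto
    moreover have "(\<lambda>x. indicator {0<..} x *\<^sub>R g x) = g" using g(1) by (auto simp: indicator_def fun_eq_iff)
    ultimately show ?thesis by simp
  qed
  have "(g has_integral (h e - h 0)) {0..e}"
    using e hg continuous_on_subset[OF h(1)]
    by (intro fundamental_theorem_of_calculus_interior)
      (auto simp flip: has_real_derivative_iff_has_vector_derivative)
  hence "g absolutely_integrable_on {0..e}"
    using g(1)[of 0] e by (intro nonnegative_absolutely_integrable_1) (auto simp: le_less)
  hence "integrable (completion lborel) (\<lambda>x. indicator {0..e} x *\<^sub>R g x)" by (simp add: set_integrable_def)
  hence near: "set_integrable lborel {0..e} g"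
    unfolding set_integrable_def using gm by (subst (asm) integrable_completion) auto
  have int: "set_integrable lborel {a..b} g" for a b
  proof -
    have far: "set_integrable lborel {e..b} g"
      unfolding set_integrable_def using e
      by (intro borel_integrable_compact continuous_on_subset[OF g(2)]) auto
    have "set_integrable lborel ({0..e} \<union> {e..b}) g" by (intro set_integrable_Un near far) auto
    hence "set_integrable lborel (({0..e} \<union> {e..b}) \<inter> {a..b}) g" by (rule set_integrable_subset) auto
    hence "integrable lborel (\<lambda>x. indicator (({0..e} \<union> {e..b}) \<inter> {a..b}) x *\<^sub>R g x)"
      by (simp add: set_integrable_def)
    moreover have "(\<lambda>x. indicator (({0..e} \<union> {e..b}) \<inter> {a..b}) x *\<^sub>R g x) = (\<lambda>x. indicator {a..b} x *\<^sub>R g x)"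
      using g(1) by (auto simp: indicator_def fun_eq_iff)
    ultimately show ?thesis by (simp add: set_integrable_def)
  qed
  hence lg: "loc_integrable g" by (simp add: loc_integrable_def)
  have weak: "integral\<^sup>L lborel (\<lambda>t. h t * deriv \<psi> t) = - integral\<^sup>L lborel (\<lambda>t. g t * \<psi> t)" if \<psi>: "test_fun \<psi>" for \<psi>
  proof -
    note D = test_fun_DERIV[OF \<psi>]
    have c: "continuous_on A \<psi>" "continuous_on A (deriv \<psi>)" for A
      using D(1,2) by (auto intro!: continuous_at_imp_continuous_on DERIV_isCont)
    obtain R where R: "R > 0" "\<And>x. \<bar>x\<bar> > R \<Longrightarrow> \<psi> x = 0" "\<And>x. \<bar>x\<bar> > R \<Longrightarrow> deriv \<psi> x = 0"
      using test_fun_support[OF \<psi>] by metis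
    have "bounded (\<psi> ` {0..R + 1})" by (intro compact_imp_bounded compact_continuous_image c) auto
    then obtain B where B: "B > 0" "\<And>x. x \<in> {0..R + 1} \<Longrightarrow> \<bar>\<psi> x\<bar> \<le> B" unfolding bounded_pos by auto
    have "\<psi> \<in> borel_measurable borel" using c(1) by (intro borel_measurable_continuous_onI)
    hence m: "(\<lambda>t. g t * \<psi> t) \<in> borel_measurable lborel" using gm by auto
    have i1: "integrable lborel (\<lambda>t. g t * \<psi> t)"
    proof (rule Bochner_Integration.integrable_bound[OF _ m])
      show "integrable lborel (\<lambda>x. B * (indicator {0..R + 1} x *\<^sub>R g x))"
        using int[of 0 "R + 1"] by (simp add: set_integrable_def)
      have "norm (g x * \<psi> x) \<le> norm (B * (indicator {0..R + 1} x *\<^sub>R g x))" for x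
      proof (cases "x \<in> {0..R + 1}")
        case True
        have "\<bar>g x\<bar> * \<bar>\<psi> x\<bar> \<le> \<bar>g x\<bar> * B" using B(2)[OF True] by (intro mult_left_mono) auto
        thus ?thesis using True B(1) by (simp add: abs_mult mult.commute)
      next
        case False
        hence "g x = 0 \<or> \<psi> x = 0" using g(1)[of x] R(1) R(2)[of x] by (cases "x \<le> 0") auto
        thus ?thesis by auto
      qed
      thus "AE x in lborel. norm (g x * \<psi> x) \<le> norm (B * (indicator {0..R + 1} x *\<^sub>R g x))" by simp
    qed
    have i2': "integrable lborel (\<lambda>x. indicator {0..R + 1} x *\<^sub>R (h x * deriv \<psi> x))"
      by (intro borel_integrable_compact continuous_on_mult c continuous_on_subset[OF h(1)]) auto
    have out: "indicator {0..R + 1} x *\<^sub>R (h x * deriv \<psi> x) = h x * deriv \<psi> x" for x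
      using h(2)[of x] R(1) R(3)[of x] by (cases "x \<le> 0"; cases "x \<le> R + 1"; simp add: indicator_def)
    have i2: "integrable lborel (\<lambda>t. h t * deriv \<psi> t)" using i2' unfolding out .
    have out1: "indicator {0..R + 1} x *\<^sub>R (g x * \<psi> x) = g x * \<psi> x" for x
      using g(1)[of x] R(1) R(2)[of x] by (cases "x \<le> 0"; cases "x \<le> R + 1"; simp add: indicator_def)
    have "((\<lambda>t. g t * \<psi> t + h t * deriv \<psi> t) has_integral (h (R + 1) * \<psi> (R + 1) - h 0 * \<psi> 0)) {0..R + 1}"
    proof (rule fundamental_theorem_of_calculus_interior)
      show "continuous_on {0..R + 1} (\<lambda>t. h t * \<psi> t)"
        by (intro continuous_on_mult c continuous_on_subset[OF h(1)]) auto
      fix x assume "x \<in> {0<..<R + 1}"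
      hence "((\<lambda>t. h t * \<psi> t) has_real_derivative g x * \<psi> x + h x * deriv \<psi> x) (at x)"
        using D(1)[of x] hg[of x] by (auto intro!: derivative_eq_intros)
      thus "((\<lambda>t. h t * \<psi> t) has_vector_derivative g x * \<psi> x + h x * deriv \<psi> x) (at x)"
        by (simp add: has_real_derivative_iff_has_vector_derivative)
    qed (use R in auto)
    hence HK: "integral {0..R + 1} (\<lambda>t. g t * \<psi> t + h t * deriv \<psi> t) = 0"
      using R h(2)[of 0] by (simp add: integral_unique)
    have "(LINT t:{0..R + 1}|lborel. g t * \<psi> t + h t * deriv \<psi> t)
        = integral {0..R + 1} (\<lambda>t. g t * \<psi> t + h t * deriv \<psi> t)"
    proof (rule set_borel_integral_eq_integral(2))
      show "set_integrable lborel {0..R + 1} (\<lambda>t. g t * \<psi> t + h t * deriv \<psi> t)"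
        unfolding set_integrable_def scaleR_add_right out out1 using i1 i2 by (rule Bochner_Integration.integrable_add)
    qed
    hence "integral\<^sup>L lborel (\<lambda>t. g t * \<psi> t + h t * deriv \<psi> t) = 0"
      unfolding set_lebesgue_integral_def scaleR_add_right out out1 HK by simp
    thus ?thesis using i1 i2 by simp
  qed
  show "W11_loc h" unfolding W11_loc_def using loc_integrable_continuous[OF h(1)] lg weak by blast
qed

section \<open>The sharp wave\<close>

context delay_reaction
begin

context
  fixes q f assumes E: "entire_profile q f"
begin

lemmas prof = entire_at[OF E]

lemma entire_cont: "continuous_on X f" by (rule f_cont[OF prof])

lemma entire_past: "t \<le> 0 \<Longrightarrow> f t = 0" by (rule f_past[OF prof])

lemma entire_rate_cont: "continuous_on UNIV (rate f)"
proof -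
  have "isCont (rate f) t" for t
    using rate_cont[OF prof, of "t + 1"] by (intro continuous_on_interior[of "{..t + 1}"]) auto
  thus ?thesis by (auto intro: continuous_at_imp_continuous_on)
qed

lemma entire_net_past: "t \<le> 0 \<Longrightarrow> net f t = 0" by (cases "t = 0") (simp_all add: net_def)

lemma entire_net_deriv: "(net f has_real_derivative rate f t) (at t)"
proof (rule has_real_derivative_primitive[OF entire_rate_cont])
  fix t :: real assume t: "t \<le> 0"
  thus "rate f t = 0" using entire_past[of t] entire_past[of "t - r"] r by (simp add: rate_def b0 d0)
  show "net f t = 0" using t by (rule entire_net_past)
qed (simp add: net_def)

lemma entire_flux_cont: "continuous_on X (flux f)"
  unfolding flux_def
  by (intro continuous_intros entire_cont continuous_at_imp_continuous_on ballI DERIV_isCont[OF entire_net_deriv])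

lemma entire_flux_past: "t \<le> 0 \<Longrightarrow> flux f t = 0"
  by (simp add: flux_def entire_past entire_net_past)

lemma entire_f_deriv: "t > 0 \<Longrightarrow> (f has_real_derivative mobility q f t * flux f t) (at t)"
  using f_deriv[OF prof[of "t + 1"]] by simp

lemma entire_power_deriv: "((\<lambda>t. f t powr m) has_real_derivative m * q / (m - 1) * flux f t) (at t)"
proof (rule has_real_derivative_primitive)
  show "continuous_on UNIV (\<lambda>t. m * q / (m - 1) * flux f t)" by (intro continuous_intros entire_flux_cont)
  show "t \<le> 0 \<Longrightarrow> m * q / (m - 1) * flux f t = 0" for t by (simp add: entire_flux_past)
  show "t \<le> 0 \<Longrightarrow> f t powr m = 0" for t by (simp add: entire_past)
  fix t :: real assume t: "t > 0"
  have "((\<lambda>t. m * q / (m - 1) * flux f t) has_integral (f t powr m - f 0 powr m)) {0..t}"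
  proof (rule fundamental_theorem_of_calculus_interior)
    show "continuous_on {0..t} (\<lambda>t. f t powr m)"
      using entire_range(1)[OF E] m by (intro continuous_on_powr' entire_cont continuous_intros) auto
    fix x assume x: "x \<in> {0<..<t}"
    have fx: "f x > 0" using entire_pos[OF E] x by simp
    have "((\<lambda>t. f t powr m) has_real_derivative m * f x powr (m - 1) * (mobility q f x * flux f x)) (at x)"
      using fx x by (intro DERIV_chain2[OF has_real_derivative_powr entire_f_deriv]) auto
    also have "m * f x powr (m - 1) * (mobility q f x * flux f x) = m * q / (m - 1) * flux f x"
    proof -
      have "f x powr (m - 1) * f x powr (1 - m) = 1" using fx by (simp flip: powr_add)
      moreover have "m * f x powr (m - 1) * (mobility q f x * flux f x)
          = m * q / (m - 1) * flux f x * (f x powr (m - 1) * f x powr (1 - m))"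
        by (simp add: mobility_def[OF prof])
      ultimately show ?thesis by simp
    qed
    finally show "((\<lambda>t. f t powr m) has_vector_derivative m * q / (m - 1) * flux f x) (at x)"
      by (simp add: has_real_derivative_iff_has_vector_derivative)
  qed (use t in simp)
  hence "integral {0..t} (\<lambda>t. m * q / (m - 1) * flux f t) = f t powr m - f 0 powr m" by (rule integral_unique)
  moreover have "f 0 powr m = 0" by (simp add: entire_past)
  ultimately show "f t powr m = integral {0..t} (\<lambda>t. m * q / (m - 1) * flux f t)" by linarith
qed

lemma entire_wave_profile_eq:
  assumes c: "c > 0" "c\<^sup>2 = D * (m * q / (m - 1))"
  shows "wave_profile_eq D m c r b d (\<lambda>t. f (t / c))"
  unfolding wave_profile_eq_def
proof (intro allI impI)
  fix \<psi> assume \<psi>: "test_fun \<psi>"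
  note T = test_fun_DERIV[OF \<psi>]
  define k where "k = m * q / (m - 1)"
  define F where "F t = D * (f (t / c) powr m) * deriv (deriv \<psi>) t + c * f (t / c) * deriv \<psi> t
      - d (f (t / c)) * \<psi> t + b (f ((t - c * r) / c)) * \<psi> t" for t
  define H where "H t = D * f (t / c) powr m * deriv \<psi> t - c * net f (t / c) * \<psi> t" for t
  have shift: "(t - c * r) / c = t / c - r" for t using c by (simp add: field_simps)
  have F: "F t = D * (f (t / c) powr m) * deriv (deriv \<psi>) t + c * f (t / c) * deriv \<psi> t
      - rate f (t / c) * \<psi> t" for t
    by (simp add: F_def rate_def shift algebra_simps)
  have dscale: "((\<lambda>t. t / c) has_real_derivative 1 / c) (at t)" for t
    using c(1) by (auto intro!: derivative_eq_intros)
  have HF: "DERIV H t :> F t" for t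
  proof -
    have u: "((\<lambda>t. f (t / c) powr m) has_real_derivative k * flux f (t / c) * (1 / c)) (at t)"
      unfolding k_def by (rule DERIV_chain2[OF entire_power_deriv dscale])
    have n: "((\<lambda>t. net f (t / c)) has_real_derivative rate f (t / c) * (1 / c)) (at t)"
      by (rule DERIV_chain2[OF entire_net_deriv dscale])
    have DH: "DERIV H t :> (D * (k * flux f (t / c) * (1 / c)) * deriv \<psi> t + deriv (deriv \<psi>) t * (D * f (t / c) powr m))
        - (c * (rate f (t / c) * (1 / c)) * \<psi> t + deriv \<psi> t * (c * net f (t / c)))"
      unfolding H_def by (intro DERIV_diff DERIV_mult DERIV_cmult u n T)
    have e1: "D * (k * flux f (t / c) * (1 / c)) = c * flux f (t / c)"
    proof -
      have "D * (k * flux f (t / c) * (1 / c)) = (D * k) * flux f (t / c) / c" by simp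
      also have "D * k = c * c" using c(2) by (simp add: k_def power2_eq_square)
      finally show ?thesis using c(1) by simp
    qed
    have e2: "c * (rate f (t / c) * (1 / c)) = rate f (t / c)" using c(1) by simp
    have "c * flux f (t / c) * deriv \<psi> t + deriv (deriv \<psi>) t * (D * f (t / c) powr m)
        - (rate f (t / c) * \<psi> t + deriv \<psi> t * (c * net f (t / c))) = F t"
      by (simp add: F flux_def algebra_simps)
    with DH[unfolded e1 e2] show ?thesis by (simp only:)
  qed
  have Fc: "isCont F t" for t
  proof -
    have sc: "continuous_on UNIV (\<lambda>t. t / c)" by (intro continuous_intros) (use c(1) in auto)
    have \<psi>c: "continuous_on UNIV \<psi>" "continuous_on UNIV (deriv \<psi>)" "continuous_on UNIV (deriv (deriv \<psi>))"
      by (auto intro!: continuous_at_imp_continuous_on T DERIV_isCont[OF T(1)] DERIV_isCont[OF T(2)])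
    have fc: "continuous_on UNIV (\<lambda>t. f (t / c))"
      by (rule continuous_on_compose2[OF entire_cont[of UNIV] sc]) simp
    have rc: "continuous_on UNIV (\<lambda>t. rate f (t / c))"
      by (rule continuous_on_compose2[OF entire_rate_cont sc]) simp
    have "continuous_on UNIV (\<lambda>t. f (t / c) powr m)"
      using entire_range(1)[OF E] m by (intro continuous_on_powr' fc continuous_on_const) auto
    with \<psi>c fc rc have "continuous_on UNIV F" unfolding F
      by (intro continuous_on_add continuous_on_diff continuous_on_mult continuous_on_const)
    thus ?thesis by (simp add: continuous_on_eq_continuous_at)
  qed
  obtain R where R: "R > 0" "\<And>x. \<bar>x\<bar> > R \<Longrightarrow> \<psi> x = 0" "\<And>x. \<bar>x\<bar> > R \<Longrightarrow> deriv \<psi> x = 0"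
    "\<And>x. \<bar>x\<bar> > R \<Longrightarrow> deriv (deriv \<psi>) x = 0"
    using test_fun_support[OF \<psi>] by metis
  have "integrable lborel F \<and> integral\<^sup>L lborel F = 0"
    using integral_compactly_supported_deriv[of H F R] HF Fc R by (simp add: H_def F_def)
  thus "let F = \<lambda>t. D * (f (t / c) powr m) * deriv (deriv \<psi>) t + c * f (t / c) * deriv \<psi> t
                     - d (f (t / c)) * \<psi> t + b (f ((t - c * r) / c)) * \<psi> t
         in integrable lborel F \<and> integral\<^sup>L lborel F = 0"
    by (simp add: F_def[abs_def])
qed

lemma entire_W11_loc:
  assumes c: "c > 0" and e: "e > 0" "\<And>t. 0 < t \<Longrightarrow> t \<le> e \<Longrightarrow> flux f t \<ge> 0"
  shows "W11_loc (\<lambda>t. f (t / c))" "W11_loc (\<lambda>t. f (t / c) powr m)"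
proof -
  have dscale: "((\<lambda>t. t / c) has_real_derivative 1 / c) (at t)" for t
    using c by (auto intro!: derivative_eq_intros)
  have sc: "continuous_on X (\<lambda>t. t / c)" for X by (intro continuous_intros) (use c in auto)
  have q: "q > 0" by (rule q_pos[OF prof])
  have early: "flux f (t / c) \<ge> 0" if "0 < t" "t \<le> c * e" for t
    using e(2)[of "t / c"] that c by (simp add: field_simps)
  have mob: "mobility q f t > 0" if "t > 0" for t using mobility_pos[OF prof that order_refl] .
  show "W11_loc (\<lambda>t. f (t / c))"
  proof (rule W11_loc_one_sided)
    let ?g = "\<lambda>t. if t \<le> 0 then 0 else mobility q f (t / c) * flux f (t / c) * (1 / c)"
    show "continuous_on UNIV (\<lambda>t. f (t / c))" by (rule continuous_on_compose2[OF entire_cont sc]) auto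
    show "continuous_on {0<..} ?g"
    proof (rule continuous_on_eq)
      have "f (t / c) \<noteq> 0" if "t > 0" for t using entire_pos[OF E, of "t / c"] that c by simp
      thus "continuous_on {0<..} (\<lambda>t. mobility q f (t / c) * flux f (t / c) * (1 / c))"
        unfolding mobility_def[OF prof] using c
        by (intro continuous_intros continuous_on_compose2[OF entire_cont sc]
            continuous_on_compose2[OF entire_flux_cont sc]) auto
    qed auto
    show "((\<lambda>t. f (t / c)) has_real_derivative ?g t) (at t)" if "t > 0" for t
      using that c DERIV_chain2[of f "mobility q f (t / c) * flux f (t / c)" "\<lambda>t. t / c" t "1 / c" UNIV, OF entire_f_deriv dscale]
      by simp
    show "c * e > 0" using c e by simp
    show "?g t \<ge> 0" if "0 < t" "t \<le> c * e" for t using early[OF that] mob[of "t / c"] that c by simp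
  qed (use entire_past c in \<open>auto simp: divide_le_0_iff\<close>)
  show "W11_loc (\<lambda>t. f (t / c) powr m)"
  proof (rule W11_loc_one_sided)
    let ?g = "\<lambda>t. m * q / (m - 1) * flux f (t / c) * (1 / c)"
    show "continuous_on UNIV (\<lambda>t. f (t / c) powr m)"
      using entire_range(1)[OF E] m
      by (intro continuous_on_powr' continuous_intros continuous_on_compose2[OF entire_cont sc]) auto
    show "continuous_on {0<..} ?g"
      by (intro continuous_intros continuous_on_compose2[OF entire_flux_cont sc]) auto
    show "((\<lambda>t. f (t / c) powr m) has_real_derivative ?g t) (at t)" for t
      by (rule DERIV_chain2[OF entire_power_deriv dscale])
    show "c * e > 0" using c e by simp
    show "?g t \<ge> 0" if "0 < t" "t \<le> c * e" for t using early[OF that] q m c by simp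
  qed (use entire_past entire_flux_past c in \<open>auto simp: divide_le_0_iff\<close>)
qed

lemma entire_mono_until:
  assumes "\<And>t. 0 < t \<Longrightarrow> t < s \<Longrightarrow> flux f t \<ge> 0" "x \<le> y" "y \<le> s"
  shows "f x \<le> f y"
  by (rule f_mono[OF prof[of s]]) (use assms in auto)

lemma entire_lower_bound:
  assumes e: "e > 0" "\<And>t. 0 < t \<Longrightarrow> t \<le> e \<Longrightarrow> flux f t \<ge> 0"
  shows "eventually (\<lambda>t. \<zeta>1 \<le> f t) at_top"
proof (cases "\<exists>t>0. flux f t < 0")
  case True
  then obtain t where t: "t > 0" "flux f t < 0" by auto
  obtain s where "turning f s" using turning_exists[OF prof[of t] t(1) order_refl t(2) e] by auto
  from above_zeta1_after_turning[OF E this] show ?thesis by (rule eventually_at_top_linorderI)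
next
  case False
  hence pos: "flux f t \<ge> 0" if "t > 0" for t using that by force
  obtain t where t: "t > 0" "f t \<ge> \<zeta>1" using monotone_reaches_zeta1[OF E pos] by auto
  show ?thesis
  proof (rule eventually_at_top_linorderI)
    fix x assume "t \<le> x"
    hence "f t \<le> f x" by (intro entire_mono_until[of x] pos) auto
    thus "\<zeta>1 \<le> f x" using t by simp
  qed
qed

lemma entire_maximal_increase:
  assumes c: "c > 0" and e: "e > 0" "\<And>t. 0 < t \<Longrightarrow> t \<le> e \<Longrightarrow> flux f t \<ge> 0"
  shows "\<exists>t0::ereal. mono_on {t. ereal t < t0} (\<lambda>t. f (t / c))
        \<and> (\<forall>t1::ereal. t0 < t1 \<longrightarrow> \<not> mono_on {t. ereal t < t1} (\<lambda>t. f (t / c)))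
        \<and> (\<forall>s. t0 = ereal s \<longrightarrow> f (s / c) > \<kappa>)"
proof (cases "\<exists>t>0. flux f t < 0")
  case True
  then obtain t where t: "t > 0" "flux f t < 0" by auto
  obtain s where s: "turning f s" using turning_exists[OF prof[of t] t(1) order_refl t(2) e] by auto
  have s0: "0 < s" using s by (simp add: turning_def)
  show ?thesis
  proof (intro exI[of _ "ereal (c * s)"] conjI allI impI)
    show "mono_on {t. ereal t < ereal (c * s)} (\<lambda>t. f (t / c))"
    proof (rule mono_onI)
      fix x y assume xy: "x \<in> {t. ereal t < ereal (c * s)}" "y \<in> {t. ereal t < ereal (c * s)}" "x \<le> y"
      show "f (x / c) \<le> f (y / c)"
      proof (rule entire_mono_until[of s])
        show "x / c \<le> y / c" using xy c by (simp add: divide_right_mono)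
        show "y / c \<le> s" using xy c by (simp add: pos_divide_le_eq mult.commute)
      qed (use s in \<open>auto simp: turning_def\<close>)
    qed
    fix t1 :: ereal assume "ereal (c * s) < t1"
    then obtain t2 where t2: "c * s < t2" "ereal t2 < t1"
      using ereal_dense2[of "ereal (c * s)" t1] by auto
    define u where "u = t2 / c"
    have "u - s > 0" using t2 c unfolding u_def by (simp add: pos_less_divide_eq mult.commute)
    then obtain t where t: "s < t" "t < s + (u - s)" "flux f t < 0" using s unfolding turning_def by blast
    have t0: "t > 0" using t s0 by simp
    have "mobility q f t * flux f t < 0"
      using mobility_pos[OF prof t0 order_refl] t(3) by (simp add: mult_pos_neg)
    from DERIV_neg_dec_right[OF entire_f_deriv[OF t0] this]
    obtain h where h: "h > 0" "\<And>x. 0 < x \<Longrightarrow> x < h \<Longrightarrow> f (t + x) < f t" by auto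
    define x where "x = min (h / 2) ((u - t) / 2)"
    have "x \<le> h / 2" "x \<le> (u - t) / 2" by (simp_all only: x_def min.cobounded1 min.cobounded2)
    moreover have "t < u" using t(2) by simp
    ultimately have x: "x < h" "t + x < u" using h(1) by (simp_all add: field_simps)
    have x0: "0 < x" using h(1) \<open>t < u\<close> by (simp add: x_def)
    show "\<not> mono_on {t. ereal t < t1} (\<lambda>t. f (t / c))"
    proof
      assume mono: "mono_on {t. ereal t < t1} (\<lambda>t. f (t / c))"
      have "c * (t + x) < t2" using x(2) c by (simp add: u_def pos_less_divide_eq mult.commute)
      hence "ereal (c * (t + x)) < t1" using t2(2) by (meson less_ereal.simps(1) less_trans)
      moreover have "c * t \<le> c * (t + x)" using c x0 by simp
      moreover from this have "ereal (c * t) < t1" using calculation by (meson ereal_less_eq(3) le_less_trans)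
      ultimately have "f (c * t / c) \<le> f (c * (t + x) / c)" by (intro mono_onD[OF mono]) auto
      thus False using h(2)[OF x0 x(1)] c by simp
    qed
  next
    fix x assume "ereal (c * s) = ereal x"
    thus "f (x / c) > \<kappa>" using turning_above_kappa[OF E s] c by auto
  qed
next
  case False
  hence pos: "flux f t \<ge> 0" if "t > 0" for t using that by force
  have "mono_on {t. ereal t < \<infinity>} (\<lambda>t. f (t / c))"
  proof (rule mono_onI)
    fix x y :: real assume "x \<le> y"
    thus "f (x / c) \<le> f (y / c)"
      using c by (intro entire_mono_until[of "y / c"] pos) (auto intro: divide_right_mono)
  qed
  thus ?thesis by (intro exI[of _ \<infinity>]) auto
qed

lemma entire_expansion:
  assumes c: "c > 0"
    and v: "\<And>t. 0 < t \<Longrightarrow> t \<le> warmup \<Longrightarrow> \<bar>f t powr (m - 1) - q * t\<bar> \<le> q * K * t\<^sup>2"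
  shows "\<exists>\<Lambda> C1 C2. \<Lambda> > lam \<and> C1 > 0 \<and> C2 > 0 \<and>
     (\<forall>t. 0 < t \<and> t < 1 \<longrightarrow> \<bar>f (t / c) - C1 * (max t 0) powr lam\<bar> \<le> C2 * (max t 0) powr \<Lambda>)"
proof -
  define l where "l = lam"
  have l: "l > 0" using m by (simp add: l_def)
  have q: "q > 0" by (rule q_pos[OF prof])
  obtain C where C: "C \<ge> 0" "\<forall>x\<in>{q/2..2*q}. \<forall>y\<in>{q/2..2*q}. \<bar>x powr l - y powr l\<bar> \<le> C * \<bar>x - y\<bar>"
    using powr_lipschitz[of "q/2" "2*q" l] q by auto
  define C1 where "C1 = (q / c) powr l"
  define C2 where "C2 = C * q * K * (1 / c) powr (l + 1) + (S + C1) * (2 * K / c) powr (l + 1)"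
  have C1: "C1 > 0" using q c by (simp add: C1_def)
  have S0: "S > 0" using order by simp
  have first: "0 \<le> C * q * K * (1 / c) powr (l + 1)" using C(1) q K by simp
  have second: "0 < (S + C1) * (2 * K / c) powr (l + 1)" using S0 C1 K c by simp
  have est: "\<bar>f (t / c) - C1 * t powr l\<bar> \<le> C2 * t powr (l + 1)" if t: "0 < t" "t < 1" for t
  proof (cases "t / c \<le> warmup")
    case True
    define y where "y = t / c"
    have y: "0 < y" "y \<le> warmup" using t c True by (auto simp: y_def)
    define x where "x = f y powr (m - 1) / y"
    have Ky: "K * y \<le> 1 / 2" using y K by (simp add: field_simps)
    have "x - q = (f y powr (m - 1) - q * y) / y" using y by (simp add: x_def field_simps)
    hence "\<bar>x - q\<bar> = \<bar>f y powr (m - 1) - q * y\<bar> / y" using y by simp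
    also have "\<dots> \<le> q * K * y\<^sup>2 / y" using v[OF y] y by (intro divide_right_mono) auto
    also have "\<dots> = q * (K * y)" using y by (simp add: power2_eq_square)
    finally have xq: "\<bar>x - q\<bar> \<le> q * (K * y)" .
    also have "\<dots> \<le> q * (1 / 2)" using Ky q by (intro mult_left_mono) auto
    finally have "\<bar>x - q\<bar> \<le> q * (1 / 2)" .
    hence "q / 2 \<le> x" "x \<le> 2 * q" using q by linarith+
    hence "x \<in> {q/2..2*q}" "q \<in> {q/2..2*q}" using q by auto
    hence "\<bar>x powr l - q powr l\<bar> \<le> C * \<bar>x - q\<bar>" using C(2) by blast
    also have "\<dots> \<le> C * (q * (K * y))" using xq C(1) by (rule mult_left_mono)
    finally have X: "\<bar>x powr l - q powr l\<bar> \<le> C * (q * (K * y))" .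
    have fy: "f y = y powr l * x powr l"
    proof -
      have "f y > 0" using entire_pos[OF E y(1)] .
      hence "x powr l = f y / y powr l" using y m by (simp add: x_def powr_divide powr_powr l_def)
      thus ?thesis using y by simp
    qed
    have tl: "C1 * t powr l = y powr l * q powr l"
      using t c q by (simp add: C1_def y_def powr_divide)
    have "f (t / c) - C1 * t powr l = y powr l * (x powr l - q powr l)"
      unfolding tl using fy by (simp add: y_def right_diff_distrib)
    hence "\<bar>f (t / c) - C1 * t powr l\<bar> = y powr l * \<bar>x powr l - q powr l\<bar>" by (simp add: abs_mult)
    also have "\<dots> \<le> y powr l * (C * (q * (K * y)))" using X by (intro mult_left_mono) auto
    also have "\<dots> = C * q * K * y powr (l + 1)" using y by (simp add: powr_add)
    also have "y powr (l + 1) = (1 / c) powr (l + 1) * t powr (l + 1)"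
      by (simp add: y_def flip: powr_mult)
    finally have "\<bar>f (t / c) - C1 * t powr l\<bar> \<le> C * q * K * (1 / c) powr (l + 1) * t powr (l + 1)"
      by (simp add: mult.assoc)
    also have "\<dots> \<le> C2 * t powr (l + 1)" using second by (intro mult_right_mono) (auto simp: C2_def)
    finally show ?thesis .
  next
    case False
    hence "1 \<le> 2 * K / c * t" using K c by (simp add: field_simps)
    hence "1 powr (l + 1) \<le> (2 * K / c * t) powr (l + 1)" using l by (intro powr_mono2) auto
    hence big: "1 \<le> (2 * K / c) powr (l + 1) * t powr (l + 1)" by (simp only: powr_mult powr_one_eq_one)
    have "t powr l \<le> 1" using t l by (simp add: powr_le1)
    hence "C1 * t powr l \<le> C1" using C1 by simp
    moreover have "0 \<le> C1 * t powr l" using C1 by simp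
    ultimately have "\<bar>f (t / c) - C1 * t powr l\<bar> \<le> S + C1"
      using entire_range[OF E, of "t / c"] by linarith
    also have "\<dots> \<le> (S + C1) * ((2 * K / c) powr (l + 1) * t powr (l + 1))"
      using mult_left_mono[OF big, of "S + C1"] S0 C1 by simp
    also have "\<dots> = (S + C1) * (2 * K / c) powr (l + 1) * t powr (l + 1)" by simp
    also have "\<dots> \<le> C2 * t powr (l + 1)" using first by (intro mult_right_mono) (auto simp: C2_def)
    finally show ?thesis .
  qed
  show ?thesis
  proof (intro exI conjI allI impI)
    show "l + 1 > lam" by (simp add: l_def)
    show "C1 > 0" by (rule C1)
    show "C2 > 0" using first second by (simp add: C2_def)
    fix t :: real assume "0 < t \<and> t < 1"
    thus "\<bar>f (t / c) - C1 * (max t 0) powr lam\<bar> \<le> C2 * (max t 0) powr (l + 1)"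
      using est[of t] by (simp add: l_def)
  qed
qed

lemma entire_semi_wavefront:
  assumes c: "c > 0" "c\<^sup>2 = D * (m * q / (m - 1))" and e: "e > 0" "\<And>t. 0 < t \<Longrightarrow> t \<le> e \<Longrightarrow> flux f t \<ge> 0"
  shows "semi_wavefront D m c r b d \<kappa> (\<lambda>t. f (t / c))"
    and "ereal \<zeta>1 \<le> Liminf at_top (\<lambda>t. ereal (f (t / c)))"
    and "Limsup at_top (\<lambda>t. ereal (f (t / c))) \<le> ereal \<zeta>2"
proof -
  have "filterlim (\<lambda>t. t / c) at_top at_top" using c(1) by real_asymp
  hence "eventually (\<lambda>t. \<zeta>1 \<le> f (t / c)) at_top" using entire_lower_bound[OF e] by (rule eventually_compose_filterlim[rotated])
  thus low: "ereal \<zeta>1 \<le> Liminf at_top (\<lambda>t. ereal (f (t / c)))" by (intro Liminf_bounded) auto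
  show up: "Limsup at_top (\<lambda>t. ereal (f (t / c))) \<le> ereal \<zeta>2"
    by (intro Limsup_bounded) (simp add: entire_le_zeta2[OF E])
  have "eventually (\<lambda>t. f (t / c) = 0) at_bot"
    using eventually_le_at_bot[of 0] by eventually_elim (use c in \<open>auto intro!: entire_past simp: divide_le_0_iff\<close>)
  hence "((\<lambda>t. f (t / c)) \<longlongrightarrow> 0) at_bot" by (rule tendsto_eventually)
  moreover have "0 < Liminf at_top (\<lambda>t. ereal (f (t / c)))" using low order(1)
    by (meson ereal_less(2) less_le_trans)
  moreover have "Limsup at_top (\<lambda>t. ereal (f (t / c))) < \<infinity>" using up by (rule le_less_trans) simp
  moreover have "\<exists>B. \<forall>t. \<bar>f (t / c)\<bar> \<le> B" using entire_range[OF E] by (intro exI[of _ S]) auto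
  ultimately show "semi_wavefront D m c r b d \<kappa> (\<lambda>t. f (t / c))"
    unfolding semi_wavefront_def
    using c(1) entire_range(1)[OF E] entire_W11_loc[OF c(1) e] entire_wave_profile_eq[OF c] entire_maximal_increase[OF c(1) e]
    by blast
qed

end
end

theorem theorem2p3:
  fixes m D r \<kappa> sM :: real and b d b' d' d'' :: "real \<Rightarrow> real"
  assumes m: "m > 1" and D: "D > 0" and r: "r \<ge> 0"
    \<comment> \<open>d in C^2([0,+infinity)), d(0) = 0, d' > 0 and d'' \<ge> 0 on (0,+infinity)\<close>
    and d_deriv: "\<And>s. s \<ge> 0 \<Longrightarrow> (d has_real_derivative d' s) (at s within {0..})"
    and d'_deriv: "\<And>s. s \<ge> 0 \<Longrightarrow> (d' has_real_derivative d'' s) (at s within {0..})"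
    and d''_cont: "continuous_on {0..} d''"
    and d0: "d 0 = 0"
    and d'_pos: "\<And>s. s > 0 \<Longrightarrow> d' s > 0"
    and d''_nonneg: "\<And>s. s > 0 \<Longrightarrow> d'' s \<ge> 0"
    \<comment> \<open>b in C^1([0,+infinity);[0,+infinity))\<close>
    and b_deriv: "\<And>s. s \<ge> 0 \<Longrightarrow> (b has_real_derivative b' s) (at s within {0..})"
    and b'_cont: "continuous_on {0..} b'"
    and b_nonneg: "\<And>s. s \<ge> 0 \<Longrightarrow> b s \<ge> 0"
    \<comment> \<open>exactly one positive local extremum point s_M, which is the global maximum point\<close>
    and sM_ext: "pos_local_extremum b sM"
    and sM_unique: "\<And>s. pos_local_extremum b s \<Longrightarrow> s = sM"
    and sM_max: "\<And>s. s \<ge> 0 \<Longrightarrow> b s \<le> b sM"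
    and b0: "b 0 = 0"
    and kappa: "\<kappa> > 0" "b \<kappa> = d \<kappa>"
    and b'0: "b' 0 > d' 0"
    and b'kappa: "b' \<kappa> < d' \<kappa>"
    and bd: "\<And>s. 0 < s \<Longrightarrow> s < \<kappa> \<Longrightarrow> d s < b s \<and> b s \<le> b' 0 * s"
    and sM_kappa: "sM < \<kappa>"
  shows "\<exists>c0 > 0. \<exists>\<phi>.
           semi_wavefront D m c0 r b d \<kappa> \<phi> \<and>
           (\<forall>t\<le>0. \<phi> t = 0) \<and> (\<forall>t>0. \<phi> t > 0) \<and>
           0 < zeta1 b d sM \<and>
           ereal (zeta1 b d sM) \<le> Liminf at_top (\<lambda>t. ereal (\<phi> t)) \<and>
           Liminf at_top (\<lambda>t. ereal (\<phi> t)) \<le> Limsup at_top (\<lambda>t. ereal (\<phi> t)) \<and>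
           Limsup at_top (\<lambda>t. ereal (\<phi> t)) \<le> ereal (zeta2 b d sM) \<and>
           (\<exists>\<Lambda> C1 C2. \<Lambda> > 1 / (m - 1) \<and> C1 > 0 \<and> C2 > 0 \<and>
              (\<forall>t. 0 < t \<and> t < 1 \<longrightarrow>
                 \<bar>\<phi> t - C1 * (max t 0) powr (1 / (m - 1))\<bar> \<le> C2 * (max t 0) powr \<Lambda>))"
proof -
  have bd': "d s < b s" if "0 < s" "s < \<kappa>" for s using bd[OF that] by blast
  interpret BD: birth_death \<kappa> sM b d b' d' d''
    by unfold_locales fact+
  let ?z1 = "zeta1 b d sM" and ?z2 = "zeta2 b d sM"
  note z1 = BD.zeta1 and z2 = BD.zeta2
  obtain K where K: "K > 0" "\<forall>x\<in>{0..?z2 + 1}. \<forall>y\<in>{0..?z2 + 1}.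
      \<bar>b x - b y\<bar> \<le> K * \<bar>x - y\<bar> \<and> \<bar>d x - d y\<bar> \<le> K * \<bar>x - y\<bar>"
    using BD.common_lipschitz by blast
  interpret DR: delay_reaction m r "?z2 + 1" K \<kappa> ?z1 ?z2 b d
  proof unfold_locales
    show "b x \<le> d ?z2" if "0 \<le> x" for x using sM_max[OF that] z2(2) by simp
    show "b ?z1 < b \<kappa>" using BD.b_greater[of \<kappa> ?z2] sM_kappa z1(3) z2(1) by simp
    show "b x < b ?z1" if "0 \<le> x" "x < ?z1" for x using BD.b_less[of x ?z1] that z1(2) by simp
    show "?z1 < \<kappa>" using z1(2) sM_kappa by simp
  qed (use m r K z1 z2 b0 d0 kappa bd BD.b_pos BD.d_less BD.b_min in auto)
  obtain \<delta> \<beta> \<sigma> where lin: "0 < \<delta>" "\<delta> < \<beta>" "0 < \<sigma>" "\<sigma> \<le> \<kappa>"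
      "\<And>x. x \<in> {0..\<sigma>} \<Longrightarrow> d x \<le> \<delta> * x \<and> \<beta> * x \<le> b x"
    using BD.linear_bounds by blast
  obtain q f where q: "q > 0" and f: "DR.entire_profile q f"
    and early: "\<And>t. 0 < t \<Longrightarrow> t \<le> 1 / (2 * K) \<Longrightarrow>
      \<bar>f t powr (m - 1) - q * t\<bar> \<le> q * K * t\<^sup>2 \<and> DR.flux f t \<ge> 0"
    using DR.entire_profile_exists[OF lin(3,4,1,2,5)] by blast
  define c where "c = sqrt (D * (m * q / (m - 1)))"
  have pos: "D * (m * q / (m - 1)) > 0" using D m q by simp
  have c: "c > 0" "c\<^sup>2 = D * (m * q / (m - 1))" using pos by (simp_all add: c_def)
  have K0: "1 / (2 * K) > 0" using K(1) by simp
  define \<phi> where "\<phi> t = f (t / c)" for t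
  have wave: "semi_wavefront D m c r b d \<kappa> \<phi>" "ereal ?z1 \<le> Liminf at_top (\<lambda>t. ereal (\<phi> t))"
      "Limsup at_top (\<lambda>t. ereal (\<phi> t)) \<le> ereal ?z2"
    unfolding \<phi>_def[abs_def] using DR.entire_semi_wavefront[OF f c K0] early by blast+
  have support: "\<forall>t\<le>0. \<phi> t = 0" "\<forall>t>0. \<phi> t > 0"
    using DR.entire_past[OF f] DR.entire_pos[OF f] c(1) by (auto simp: \<phi>_def divide_le_0_iff)
  have expansion: "\<exists>\<Lambda> C1 C2. \<Lambda> > 1 / (m - 1) \<and> C1 > 0 \<and> C2 > 0 \<and>
      (\<forall>t. 0 < t \<and> t < 1 \<longrightarrow> \<bar>\<phi> t - C1 * (max t 0) powr (1 / (m - 1))\<bar> \<le> C2 * (max t 0) powr \<Lambda>)"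
    unfolding \<phi>_def using early by (intro DR.entire_expansion[OF f c(1)]) blast
  have le: "Liminf at_top (\<lambda>t. ereal (\<phi> t)) \<le> Limsup at_top (\<lambda>t. ereal (\<phi> t))"
    by (intro Liminf_le_Limsup) simp
  show ?thesis
    by (rule exI[of _ c], rule conjI[OF c(1)], rule exI[of _ \<phi>], intro conjI)
      (fact wave support z1(1) le expansion)+
qed

end
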